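(* Let $\mathcal A$, $\varepsilon$, $a$, $Q$, $\sigma^I$, $\overline\sigma_I$, $G_\pm$, $\Lambda_L{}^K$ and the functionals $f_\pm,\tilde f_\pm$ be as in the context. Then there exist functionals $F_{\pm L}{}^{K}:\mathcal A\to\mathbb C$, given by $$F_{\pm L}{}^K=\frac1Q\left(\tilde f_{\mp\dot\beta}{}^{\dot\alpha}\,\overline\sigma_{L\dot\alpha}{}^{\delta}\star f_{\pm\delta}{}^{\gamma}\,\sigma^K{}_\gamma{}^{\dot\beta}\right),$$ such that for each choice of sign: (a) for all $b\in\mathcal A$: $\ \Lambda_L{}^I\,(F_{\pm I}{}^K\star b)=(b\star F_{\pm L}{}^I)\,\Lambda_I{}^K$; (b) for all $b\in\mathcal A$: $\ (F_{\pm L}{}^K(b))^\star=F_{\pm L}{}^K(S(b^\star))$; (c) for all $b,c\in\mathcal A$: $$F_{\pm L}{}^K(bc)=F_{\pm L}{}^I(b)\,F_{\pm I}{}^K(c),\qquad F_{\pm L}{}^K(\varepsilon(b)I_{\mathcal A})=\delta^K_L\,\varepsilon(b),$$ $$(F_{\pm L}{}^I\star F_{\pm I}{}^K\circ S)(b)=(F_{\pm L}{}^I\circ S\star F_{\pm I}{}^K)(b)=\delta^K_L\,\varepsilon(b),$$ where $\varepsilon(b)$ is the counit of $\mathcal A$ at $b$; (d) with $\mathcal R^{\pm NM}_{\ \ KL}:=F_{\pm K}{}^M(\Lambda_L{}^N)$, $$\mathcal R^{\pm NM}_{\ \ KL}\,G_\pm^{KL}=G_\pm^{NM},\qquad \mathcal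 R^{\pm NM}_{\ \ KL}\,G_{\pm NM}=G_{\pm KL},$$ and the matrices $\mathcal R^\pm$ satisfy the Yang-Baxter equations $$\mathcal R^\pm_{12}\mathcal R^\pm_{23}\mathcal R^\pm_{12}=\mathcal R^\pm_{23}\mathcal R^\pm_{12}\mathcal R^\pm_{23}$$ and the Hecke relations $$(\mathcal R^\pm+a^{\pm2})(\mathcal R^\pm+a^{\mp2})(\mathcal R^\pm-1)=0.$$
   Context: Conventions. Spinor indices $\alpha,\beta,\dots$ and dotted indices $\dot\alpha,\dot\beta,\dots$ run over $\{1,2\}$; $I,J,K,L,\dots$ run over $\{0,1,2,3\}$. Repeated indices are summed; an undotted index $\alpha$ and the dotted index $\dot\alpha$ with the same letter have the same numerical value. On complex numbers $\star$ is complex conjugation. In formulas with $\pm,\mp$ the upper signs go together and the lower signs go together. Spinor metric. $(\varepsilon_{\alpha\beta})$ is an invertible complex $2\times2$ matrix with inverse $(\varepsilon^{\alpha\beta})$: $\varepsilon^{\alpha\gamma}\varepsilon_{\gamma\beta}=\delta^\alpha_\beta=\varepsilon_{\beta\gamma}\varepsilon^{\gamma\alpha}$. Dotted versions: $\varepsilon_{\dot\beta\dot\alpha}:=(\varepsilon_{\alpha\beta})^\star$, $\varepsilon^{\dot\beta\dot\alpha}:=(\varepsilon^{\alpha\beta})^\star$. It is assumed that $\varepsilon_{\dot\beta\dot\alpha}=-\varepsilon^{\alpha\beta}$ and $\varepsilon^{\dot\beta\dot\alpha}=-\varepsilon_{\alpha\beta}$. $R$ matrices. $a\neq0$ is a real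 number with $a+a^{-1}+\varepsilon^{\alpha\beta}\varepsilon_{\alpha\beta}=0$ (then $a>0$, and $a^{1/2}$ is the positive root), $Q:=a+a^{-1}$, and $R^{\pm\alpha\beta}_{\ \ \gamma\delta}=\delta^\alpha_\gamma\delta^\beta_\delta+a^{\pm1}\varepsilon^{\alpha\beta}\varepsilon_{\gamma\delta}$. Mixed $R$ matrices are defined by $R^{\pm\dot\delta\gamma}_{\ \ \alpha\dot\sigma}:=a^{\pm1/2}R^{\mp\gamma\sigma}_{\ \ \delta\alpha}$ and $R^{\mp\gamma\dot\delta}_{\ \ \dot\sigma\alpha}:=a^{\pm1/2}\varepsilon_{\delta\lambda}R^{\mp\gamma\lambda}_{\ \ \nu\alpha}\varepsilon^{\nu\sigma}$. The $\star$-Hopf algebra $\mathcal A$ (quantum $SL(2,\mathbb C)$). $\mathcal A$ is a complex unital $\star$-algebra with unit $I_{\mathcal A}$ ($\star$ antilinear and antimultiplicative) generated by $M_\alpha{}^\beta$ and $M_{\dot\alpha}{}^{\dot\beta}:=(M_\alpha{}^\beta)^\star$, satisfying $\varepsilon_{\alpha\beta}M_\gamma{}^\alpha M_\delta{}^\beta=\varepsilon_{\gamma\delta}I_{\mathcal A}$, $\varepsilon^{\gamma\delta}M_\gamma{}^\alpha M_\delta{}^\beta=\varepsilon^{\alpha\beta}I_{\mathcal A}$, the same relations with all indices dotted, and, for both signs, $M_\alpha{}^\gamma M_{\dot\sigma}{}^{\dot\delta}R^{\pm\dot\rho\beta}_{\ \ \gamma\dot\delta}=R^{\pm\dot\delta\gamma}_{\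 \ \alpha\dot\sigma}M_{\dot\delta}{}^{\dot\rho}M_\gamma{}^\beta$. It is a $\star$-Hopf algebra with $\Delta(M_\alpha{}^\beta)=M_\alpha{}^\gamma\otimes M_\gamma{}^\beta$, counit $\varepsilon(M_\alpha{}^\beta)=\delta_\alpha^\beta$, antipode $S(M_\alpha{}^\beta)=\varepsilon_{\alpha\gamma}M_\delta{}^\gamma\varepsilon^{\delta\beta}$, and the same formulas with dotted indices; $S^{-1}(M_{\dot\alpha}{}^{\dot\beta})=\varepsilon^{\dot\beta\dot\delta}M_{\dot\delta}{}^{\dot\gamma}\varepsilon_{\dot\gamma\dot\alpha}$. Convolution. For linear functionals $f,g$ on $\mathcal A$ and $b\in\mathcal A$: $b\star f=(f\otimes \mathrm{id})\Delta(b)$, $f\star b=(\mathrm{id}\otimes f)\Delta(b)$, $(f\star g)(b)=(f\otimes g)\Delta(b)$. Functionals of the bicovariant calculus (given data, standing assumptions). There are linear functionals $f_{\pm\alpha}{}^\beta,\tilde f_{\pm\alpha}{}^\beta,f_{\pm\dot\alpha}{}^{\dot\beta},\tilde f_{\pm\dot\alpha}{}^{\dot\beta}:\mathcal A\to\mathbb C$ such that for all $b,c\in\mathcal A$ (for each sign): - $f_{\alpha}{}^\beta(bc)=f_\alpha{}^\gamma(b)f_\gamma{}^\beta(c)$, $\tilde f_\alpha{}^\beta(bc)=\tilde f_\gamma{}^\beta(b)\tilde f_\alpha{}^\gamma(c)$, the same with dotted indices, and each takes the value Kronecker delta at $I_{\mathcal A}$; - $M_\alpha{}^\gamma(f_\gamma{}^\beta\star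 b)=(b\star f_\alpha{}^\gamma)M_\gamma{}^\beta$, $S(M_\gamma{}^\alpha)(\tilde f_\beta{}^\gamma\star b)=(b\star\tilde f_\gamma{}^\alpha)S(M_\beta{}^\gamma)$, $M_{\dot\alpha}{}^{\dot\gamma}(f_{\dot\gamma}{}^{\dot\beta}\star b)=(b\star f_{\dot\alpha}{}^{\dot\gamma})M_{\dot\gamma}{}^{\dot\beta}$, $S^{-1}(M_{\dot\gamma}{}^{\dot\alpha})(\tilde f_{\dot\beta}{}^{\dot\gamma}\star b)=(b\star\tilde f_{\dot\gamma}{}^{\dot\alpha})S^{-1}(M_{\dot\beta}{}^{\dot\gamma})$; - $f_\alpha{}^\beta=\tilde f_\alpha{}^\beta\circ S$, $f_{\dot\alpha}{}^{\dot\beta}=\tilde f_{\dot\alpha}{}^{\dot\beta}\circ S^{-1}$, $f_\alpha{}^\beta=\varepsilon^{\beta\delta}\tilde f_\delta{}^\gamma\varepsilon_{\gamma\alpha}$, $\tilde f_{\dot\alpha}{}^{\dot\beta}=\varepsilon^{\dot\beta\dot\delta}f_{\dot\delta}{}^{\dot\gamma}\varepsilon_{\dot\gamma\dot\alpha}$; - $f_{\pm\dot\alpha}{}^{\dot\beta}=\tilde f_{\pm\beta}{}^{\alpha}$, $\tilde f_{\pm\dot\alpha}{}^{\dot\beta}=f_{\pm\beta}{}^\alpha$; - $(f_{\pm\alpha}{}^\beta(b))^\star=f_{\mp\dot\alpha}{}^{\dot\beta}(S(b^\star))$, $(\tilde f_{\pm\alpha}{}^\beta(b))^\star=\tilde f_{\mp\dot\alpha}{}^{\dot\beta}(S(b^\star))$,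 and the same with dotted and undotted exchanged; - values on generators: $f_{\pm\gamma}{}^\alpha(M_\delta{}^\rho)=a^{\mp1/2}R^{\pm\rho\alpha}_{\ \ \gamma\delta}$, $f_{\pm\gamma}{}^\alpha(S(M_\delta{}^\rho))=a^{\pm1/2}R^{\mp\alpha\rho}_{\ \ \delta\gamma}$, $f_{\pm\alpha}{}^\gamma(M_{\dot\sigma}{}^{\dot\delta})=R^{\pm\dot\delta\gamma}_{\ \ \alpha\dot\sigma}$, $f_{\pm\alpha}{}^\gamma(S(M_{\dot\sigma}{}^{\dot\delta}))=R^{\mp\gamma\dot\delta}_{\ \ \dot\sigma\alpha}$. Quantum Pauli matrices, metric and Lorentz generators. $\sigma^I=(\sigma^I_{\alpha\dot\beta})$, $I=0,\dots,3$, are four linearly independent hermitean complex $2\times2$ matrices ($(\sigma^I_{\alpha\dot\beta})^\star=\sigma^I_{\beta\dot\alpha}$), and $\overline\sigma_\pm^{I\dot\alpha\beta}:=\varepsilon^{\dot\alpha\dot\lambda}R^{\mp\sigma\dot\rho}_{\ \ \dot\lambda\nu}\varepsilon^{\nu\beta}\sigma^I_{\sigma\dot\rho}$. The metric is $G_\pm^{IJ}:=\frac1Q\varepsilon^{\alpha\nu}\sigma^I_{\alpha\dot\beta}\overline\sigma_\pm^{J\dot\beta\gamma}\varepsilon_{\gamma\nu}$, and $(G_{\pm IJ})$ is the inverse matrix of $(G_\pm^{IJ})$. One sets $\overline\sigma_I^{\dot\alpha\beta}:=G_{\pm IJ}\overline\sigma_\pm^{J\dot\alpha\beta}$ (both signs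 give the same matrices), $\overline\sigma_{L\dot\gamma}{}^{\alpha}:=\varepsilon_{\dot\gamma\dot\delta}\overline\sigma_L^{\dot\delta\alpha}$, $\sigma^K{}_\sigma{}^{\dot\rho}:=\varepsilon^{\dot\rho\dot\beta}\sigma^K_{\sigma\dot\beta}$, and $\Lambda_L{}^K:=\frac1Q\overline\sigma_{L\dot\gamma}{}^\alpha M_\alpha{}^\sigma\sigma^K{}_\sigma{}^{\dot\rho}S^{-1}(M_{\dot\rho}{}^{\dot\gamma})\in\mathcal A$. Matrix notation. $\mathcal R^\pm$ is regarded as the operator on $\mathbb C^4\otimes\mathbb C^4$ with lower index pair $KL$ as input and upper pair $NM$ as output, so products are $(\mathcal R\mathcal R)^{NM}_{KL}=\mathcal R^{NM}_{IJ}\mathcal R^{IJ}_{KL}$; $\mathcal R_{12},\mathcal R_{23}$ act on the indicated adjacent factors of $(\mathbb C^4)^{\otimes3}$; $1$ is the identity. *)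

theory Defs
  imports "HOL-Analysis.Analysis" "HOL-Library.Multiset"
begin

section \<open>Complex vector spaces and complex unital \<open>\<star>\<close>-algebras\<close>

class scaleC =
  fixes scaleC :: "complex \<Rightarrow> 'a \<Rightarrow> 'a"  (infixr "*\<^sub>C" 75)

class complex_vector = scaleC + ab_group_add +
  assumes scaleC_add_right: "c *\<^sub>C (x + y) = c *\<^sub>C x + c *\<^sub>C y"
    and scaleC_add_left: "(c + d) *\<^sub>C x = c *\<^sub>C x + d *\<^sub>C x"
    and scaleC_scaleC: "c *\<^sub>C d *\<^sub>C x = (c * d) *\<^sub>C x"
    and scaleC_one: "1 *\<^sub>C x = x"

class complex_algebra_1 = complex_vector + ring_1 +
  assumes mult_scaleC_left: "(c *\<^sub>C x) * y = c *\<^sub>C (x * y)"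
    and mult_scaleC_right: "x * (c *\<^sub>C y) = c *\<^sub>C (x * y)"

class complex_star_algebra_1 = complex_algebra_1 +
  fixes star :: "'a \<Rightarrow> 'a"
  assumes star_star: "star (star x) = x"
    and star_add: "star (x + y) = star x + star y"
    and star_scaleC: "star (c *\<^sub>C x) = cnj c *\<^sub>C star x"
    and star_mult: "star (x * y) = star y * star x"

global_interpretation complex_vector:
  vector_space "scaleC :: complex \<Rightarrow> 'a \<Rightarrow> 'a::complex_vector"
  by unfold_locales
    (simp_all add: scaleC_add_right scaleC_add_left scaleC_scaleC scaleC_one)

instantiation complex :: complex_star_algebra_1
begin

definition scaleC_complex :: "complex \<Rightarrow> complex \<Rightarrow> complex"
  where "scaleC_complex = (*)"

definition star_complex :: "complex \<Rightarrow> complex"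
  where "star_complex = cnj"

instance
  by intro_classes (simp_all add: scaleC_complex_def star_complex_def algebra_simps)

end

abbreviation clinear :: "('a::complex_vector \<Rightarrow> 'b::complex_vector) \<Rightarrow> bool"
  where "clinear \<equiv> Vector_Spaces.linear scaleC scaleC"

definition unital_subalgebra :: "'a::complex_algebra_1 set \<Rightarrow> bool"
  where "unital_subalgebra B \<longleftrightarrow>
    1 \<in> B \<and> (\<forall>x\<in>B. \<forall>y\<in>B. x + y \<in> B \<and> x * y \<in> B) \<and> (\<forall>c. \<forall>x\<in>B. c *\<^sub>C x \<in> B)"


section \<open>The algebraic tensor product over the complex numbers\<close>

text \<open>A multiset of pairs stands for the formal sum of the corresponding pure tensors; scalars
  need no separate treatment because they can be absorbed into either factor.\<close>

inductive tensor_rel ::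
  "('a::complex_vector \<times> 'b::complex_vector) multiset \<Rightarrow> ('a \<times> 'b) multiset \<Rightarrow> bool"
where
  tensor_rel_refl: "tensor_rel t t"
| tensor_rel_sym: "tensor_rel t u \<Longrightarrow> tensor_rel u t"
| tensor_rel_trans: "tensor_rel t u \<Longrightarrow> tensor_rel u v \<Longrightarrow> tensor_rel t v"
| tensor_rel_cong: "tensor_rel t u \<Longrightarrow> tensor_rel (t + v) (u + v)"
| tensor_rel_add_left: "tensor_rel {#(x + x', y)#} {#(x, y), (x', y)#}"
| tensor_rel_add_right: "tensor_rel {#(x, y + y')#} {#(x, y), (x, y')#}"
| tensor_rel_scale: "tensor_rel {#(c *\<^sub>C x, y)#} {#(x, c *\<^sub>C y)#}"
| tensor_rel_zero: "tensor_rel {#(0, y)#} {#}"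

quotient_type (overloaded) ('a, 'b) tensor  (infixr "\<otimes>" 75) =
  "('a::complex_vector \<times> 'b::complex_vector) multiset" / tensor_rel
  by (intro equivpI reflpI sympI transpI)
    (auto intro: tensor_rel_refl tensor_rel_sym tensor_rel_trans)

lemma tensor_rel_cong2:
  assumes "tensor_rel t u" "tensor_rel t' u'"
  shows "tensor_rel (t + t') (u + u')"
  using tensor_rel_cong[OF assms(1), of t'] tensor_rel_cong[OF assms(2), of u]
  by (metis add.commute tensor_rel_trans)

lemma tensor_rel_image_scale:
  assumes "tensor_rel t u"
  shows "tensor_rel (image_mset (map_prod ((*\<^sub>C) c) id) t) (image_mset (map_prod ((*\<^sub>C) c) id) u)"
  using assms
proof induction
  case (tensor_rel_scale d x y)
  then show ?case
    using tensor_rel.tensor_rel_scale[of d "c *\<^sub>C x" y]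
    by (simp add: scaleC_scaleC mult.commute)
qed (auto simp: scaleC_add_right intro: tensor_rel.intros)

lemma tensor_rel_scale_add:
  "tensor_rel (image_mset (map_prod ((*\<^sub>C) (c + d)) id) t)
    (image_mset (map_prod ((*\<^sub>C) c) id) t + image_mset (map_prod ((*\<^sub>C) d) id) t)"
proof (induction t)
  case empty
  then show ?case by (simp add: tensor_rel_refl)
next
  case (add p t)
  then show ?case
    using tensor_rel_cong2[OF tensor_rel_add_left[of "c *\<^sub>C fst p" "d *\<^sub>C fst p" "snd p"] add]
    by (cases p) (simp add: scaleC_add_left add_mset_commute)
qed

lemma tensor_rel_scale_zero:
  "tensor_rel (image_mset (map_prod ((*\<^sub>C) 0) id) t) {#}"
proof (induction t)
  case empty
  then show ?case by (simp add: tensor_rel_refl)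
next
  case (add p t)
  then show ?case
    using tensor_rel_cong2[OF tensor_rel_zero[of "snd p"] add] by (cases p) simp
qed

instantiation tensor :: (complex_vector, complex_vector) complex_vector
begin

lift_definition zero_tensor :: "'a \<otimes> 'b" is "{#}" .

lift_definition plus_tensor :: "'a \<otimes> 'b \<Rightarrow> 'a \<otimes> 'b \<Rightarrow> 'a \<otimes> 'b" is "(+)"
  by (rule tensor_rel_cong2)

lift_definition scaleC_tensor :: "complex \<Rightarrow> 'a \<otimes> 'b \<Rightarrow> 'a \<otimes> 'b"
  is "\<lambda>c. image_mset (map_prod ((*\<^sub>C) c) id)"
  by (rule tensor_rel_image_scale)

definition uminus_tensor :: "'a \<otimes> 'b \<Rightarrow> 'a \<otimes> 'b"
  where "uminus_tensor t = (-1) *\<^sub>C t"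

definition minus_tensor :: "'a \<otimes> 'b \<Rightarrow> 'a \<otimes> 'b \<Rightarrow> 'a \<otimes> 'b"
  where "minus_tensor t u = t + (- u)"

instance
proof
  fix t u v :: "'a \<otimes> 'b" and c d :: complex
  show "t + u + v = t + (u + v)"
    by transfer (simp add: ac_simps tensor_rel_refl)
  show "t + u = u + t"
    by transfer (simp add: ac_simps tensor_rel_refl)
  show "0 + t = t"
    by transfer (simp add: tensor_rel_refl)
  show add: "(c + d) *\<^sub>C t = c *\<^sub>C t + d *\<^sub>C t" for c d
    by transfer (rule tensor_rel_scale_add)
  show one: "1 *\<^sub>C t = t"
    by transfer (simp add: map_prod_def scaleC_one tensor_rel_refl)
  have zero: "0 *\<^sub>C t = 0"
    by transfer (rule tensor_rel_scale_zero)
  show "- t + t = 0"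
    using add[of "-1" 1] one zero by (simp add: uminus_tensor_def)
  show "t - u = t + - u"
    by (simp add: minus_tensor_def)
  show "c *\<^sub>C (t + u) = c *\<^sub>C t + c *\<^sub>C u"
    by transfer (simp add: tensor_rel_refl)
  show "c *\<^sub>C d *\<^sub>C t = (c * d) *\<^sub>C t"
    by transfer (simp add: multiset.map_comp o_def map_prod_def case_prod_unfold
        scaleC_scaleC tensor_rel_refl)
qed

end

lift_definition tensor :: "'a::complex_vector \<Rightarrow> 'b::complex_vector \<Rightarrow> 'a \<otimes> 'b"
  (infixr "\<otimes>" 75)
  is "\<lambda>x y. {#(x, y)#}" .

text \<open>The additive map on the tensor product induced by a balanced biadditive map. It is defined
  through a chosen representative, hence meaningful only for balanced maps
  (see \<open>tensor_lift_tensor\<close>). Bilinear maps and the conjugate-bilinear map used for the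
  \<open>\<star>\<close>-structure are both balanced.\<close>

definition balanced ::
  "('a::complex_vector \<Rightarrow> 'b::complex_vector \<Rightarrow> 'c::ab_group_add) \<Rightarrow> bool"
  where "balanced h \<longleftrightarrow>
    (\<forall>x x' y. h (x + x') y = h x y + h x' y) \<and>
    (\<forall>x y y'. h x (y + y') = h x y + h x y') \<and>
    (\<forall>c x y. h (c *\<^sub>C x) y = h x (c *\<^sub>C y))"

definition tensor_lift ::
  "('a::complex_vector \<Rightarrow> 'b::complex_vector \<Rightarrow> 'c::ab_group_add) \<Rightarrow> 'a \<otimes> 'b \<Rightarrow> 'c"
  where "tensor_lift h t = (\<Sum>(x, y)\<in>#rep_tensor t. h x y)"

lemma balanced_sum_mset_eq:
  assumes "balanced h" "tensor_rel t u"
  shows "(\<Sum>(x, y)\<in>#t. h x y) = (\<Sum>(x, y)\<in>#u. h x y)"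
  using assms(2)
proof induction
  case (tensor_rel_zero y)
  have "h (0 + 0) y = h 0 y + h 0 y"
    using assms(1) unfolding balanced_def by blast
  then show ?case by simp
qed (use assms(1) in \<open>auto simp: balanced_def\<close>)

lemma tensor_lift_abs:
  assumes "balanced h"
  shows "tensor_lift h (abs_tensor t) = (\<Sum>(x, y)\<in>#t. h x y)"
proof -
  have "tensor_rel (rep_tensor (abs_tensor t)) t"
    using Quotient3_rep_abs[OF Quotient3_tensor] tensor_rel_refl by blast
  then show ?thesis
    unfolding tensor_lift_def by (rule balanced_sum_mset_eq[OF assms])
qed

lemma tensor_lift_tensor:
  assumes "balanced h"
  shows "tensor_lift h (x \<otimes> y) = h x y"
  by (simp add: tensor.abs_eq tensor_lift_abs[OF assms])

lemma tensor_lift_add: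
  assumes "balanced h"
  shows "tensor_lift h (t + u) = tensor_lift h t + tensor_lift h u"
  by (induction t rule: tensor.abs_induct, induction u rule: tensor.abs_induct)
    (simp add: plus_tensor.abs_eq tensor_lift_abs[OF assms])

lemma tensor_add_left: "(x + x') \<otimes> y = x \<otimes> y + x' \<otimes> y"
  by transfer (use tensor_rel_add_left in \<open>simp add: add_mset_commute\<close>)

lemma tensor_add_right: "x \<otimes> (y + y') = x \<otimes> y + x \<otimes> y'"
  by transfer (use tensor_rel_add_right in \<open>simp add: add_mset_commute\<close>)

lemma tensor_scaleC_left: "(c *\<^sub>C x) \<otimes> y = c *\<^sub>C (x \<otimes> y)"
  by transfer (simp add: tensor_rel_refl)

lemma tensor_scaleC_right: "x \<otimes> (c *\<^sub>C y) = c *\<^sub>C (x \<otimes> y)"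
  by transfer (simp add: tensor_rel_sym[OF tensor_rel_scale])

lemma tensor_induct [case_names zero add]:
  assumes "P 0" and "\<And>x y t. P t \<Longrightarrow> P (x \<otimes> y + t)"
  shows "P t"
proof (induction t rule: tensor.abs_induct)
  case (1 m)
  show ?case
  proof (induction m)
    case empty
    then show ?case using assms(1) by (simp add: zero_tensor.abs_eq)
  next
    case (add p m)
    then show ?case
      using assms(2)[of "abs_tensor m" "fst p" "snd p"]
      by (simp add: tensor.abs_eq plus_tensor.abs_eq)
  qed
qed

definition tensor_map ::
  "('a::complex_vector \<Rightarrow> 'c::complex_vector) \<Rightarrow> ('b::complex_vector \<Rightarrow> 'd::complex_vector) \<Rightarrow>
    'a \<otimes> 'b \<Rightarrow> 'c \<otimes> 'd"
  where "tensor_map f g = tensor_lift (\<lambda>x y. f x \<otimes> g y)"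

definition tensor_assoc ::
  "('a::complex_vector \<otimes> 'b::complex_vector) \<otimes> 'c::complex_vector \<Rightarrow> 'a \<otimes> 'b \<otimes> 'c"
  where "tensor_assoc = tensor_lift (\<lambda>t z. tensor_lift (\<lambda>x y. x \<otimes> y \<otimes> z) t)"

definition tensor_mult ::
  "'a::complex_algebra_1 \<otimes> 'b::complex_algebra_1 \<Rightarrow> 'a \<otimes> 'b \<Rightarrow> 'a \<otimes> 'b"
  where "tensor_mult t u =
    tensor_lift (\<lambda>x y. tensor_lift (\<lambda>x' y'. (x * x') \<otimes> (y * y')) u) t"

definition tensor_star ::
  "'a::complex_star_algebra_1 \<otimes> 'b::complex_star_algebra_1 \<Rightarrow> 'a \<otimes> 'b"
  where "tensor_star = tensor_lift (\<lambda>x y. star x \<otimes> star y)"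

lemma tensor_map_tensor:
  assumes "clinear f" "clinear g"
  shows "tensor_map f g (x \<otimes> y) = f x \<otimes> g y"
  unfolding tensor_map_def
  by (rule tensor_lift_tensor)
    (simp add: balanced_def tensor_add_left tensor_add_right tensor_scaleC_left
      tensor_scaleC_right Vector_Spaces.linear_iff[THEN iffD1, OF assms(1)]
      Vector_Spaces.linear_iff[THEN iffD1, OF assms(2)])

lemma tensor_lift_fun_add:
  "tensor_lift (\<lambda>x y. g x y + h x y) t = tensor_lift g t + tensor_lift h t"
  by (simp add: tensor_lift_def case_prod_unfold sum_mset.distrib)

lemma tensor_assoc_tensor:
  fixes x :: "'a::complex_vector" and y :: "'b::complex_vector" and z :: "'c::complex_vector"
  shows "tensor_assoc ((x \<otimes> y) \<otimes> z) = x \<otimes> y \<otimes> z"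
proof -
  have b: "balanced (\<lambda>(x :: 'a) (y :: 'b). x \<otimes> y \<otimes> z)" for z :: 'c
    by (simp add: balanced_def tensor_add_left tensor_add_right tensor_scaleC_left
        tensor_scaleC_right)
  have "tensor_lift (\<lambda>x y. x \<otimes> y \<otimes> z) (c *\<^sub>C t)
      = tensor_lift (\<lambda>x y. x \<otimes> y \<otimes> c *\<^sub>C z) t" for c and z :: 'c and t :: "'a \<otimes> 'b"
  proof (induction t rule: tensor_induct)
    case zero
    have "tensor_lift (\<lambda>x y. x \<otimes> y \<otimes> z) (0 :: 'a \<otimes> 'b) = 0" for z :: 'c
      using tensor_lift_add[OF b, of z 0 0] by simp
    then show ?case by (simp only: complex_vector.scale_zero_right)
  next
    case (add x y t)
    have "c *\<^sub>C (x \<otimes> y + t) = (c *\<^sub>C x) \<otimes> y + c *\<^sub>C t"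
      by (simp only: scaleC_add_right tensor_scaleC_left)
    moreover have "(c *\<^sub>C x) \<otimes> y \<otimes> z = x \<otimes> y \<otimes> c *\<^sub>C z"
      by (simp only: tensor_scaleC_left tensor_scaleC_right)
    ultimately show ?case
      by (simp only: tensor_lift_add[OF b] tensor_lift_tensor[OF b] add)
  qed
  then have "balanced (\<lambda>t z. tensor_lift (\<lambda>x y. x \<otimes> y \<otimes> z) (t :: 'a \<otimes> 'b) :: 'a \<otimes> 'b \<otimes> 'c)"
    by (simp add: balanced_def tensor_lift_add[OF b] tensor_add_right tensor_lift_fun_add)
  then show ?thesis
    by (simp add: tensor_assoc_def tensor_lift_tensor b)
qed

lemma tensor_star_tensor: "tensor_star (x \<otimes> y) = star x \<otimes> star y"
  unfolding tensor_star_def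
  by (rule tensor_lift_tensor)
    (simp add: balanced_def star_add star_scaleC tensor_add_left tensor_add_right
      tensor_scaleC_left tensor_scaleC_right)

lemma tensor_mult_tensor:
  fixes x x' :: "'a::complex_algebra_1" and y y' :: "'b::complex_algebra_1"
  shows "tensor_mult (x \<otimes> y) (x' \<otimes> y') = (x * x') \<otimes> (y * y')"
proof -
  have inner: "balanced (\<lambda>x' y'. (x * x') \<otimes> (y * y'))" for x :: 'a and y :: 'b
    by (simp add: balanced_def distrib_left mult_scaleC_right tensor_add_left tensor_add_right
        tensor_scaleC_left tensor_scaleC_right)
  have outer: "balanced (\<lambda>x y. tensor_lift (\<lambda>x' y'. (x * x') \<otimes> (y * y')) u)" for u :: "'a \<otimes> 'b"
    by (simp add: balanced_def distrib_right mult_scaleC_left tensor_add_left tensor_add_right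
        tensor_scaleC_left tensor_scaleC_right tensor_lift_fun_add)
  show ?thesis
    unfolding tensor_mult_def
    by (rule trans[OF tensor_lift_tensor[OF outer] tensor_lift_tensor[OF inner]])
qed


section \<open>Hopf \<open>\<star>\<close>-algebras and convolution\<close>

locale hopf_star_algebra =
  fixes cop :: "'a::complex_star_algebra_1 \<Rightarrow> 'a \<otimes> 'a"
    and counit :: "'a \<Rightarrow> complex"
    and S :: "'a \<Rightarrow> 'a"
  assumes cop_linear: "clinear cop"
    and cop_mult: "cop (b * c) = tensor_mult (cop b) (cop c)"
    and cop_one: "cop 1 = 1 \<otimes> 1"
    and coassoc: "tensor_assoc (tensor_map cop id (cop b)) = tensor_map id cop (cop b)"
    and counit_linear: "clinear counit"
    and counit_mult: "counit (b * c) = counit b * counit c"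
    and counit_one: "counit 1 = 1"
    and counit_left: "tensor_lift (\<lambda>x y. counit x *\<^sub>C y) (cop b) = b"
    and counit_right: "tensor_lift (\<lambda>x y. counit y *\<^sub>C x) (cop b) = b"
    and S_linear: "clinear S"
    and antipode_left: "tensor_lift (\<lambda>x y. S x * y) (cop b) = counit b *\<^sub>C 1"
    and antipode_right: "tensor_lift (\<lambda>x y. x * S y) (cop b) = counit b *\<^sub>C 1"
    and cop_star: "cop (star b) = tensor_star (cop b)"
    and counit_star: "counit (star b) = cnj (counit b)"
    and S_star: "S (star (S (star b))) = b"

text \<open>In this order: \<open>b \<star> f\<close>, \<open>f \<star> b\<close> and \<open>f \<star> g\<close>; they are meaningful for linear
  functionals \<open>f\<close> and \<open>g\<close>.\<close>

definition conv_right ::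
  "('a::complex_vector \<Rightarrow> 'a \<otimes> 'a) \<Rightarrow> 'a \<Rightarrow> ('a \<Rightarrow> complex) \<Rightarrow> 'a"
  where "conv_right cop b f = tensor_lift (\<lambda>x y. f x *\<^sub>C y) (cop b)"

definition conv_left ::
  "('a::complex_vector \<Rightarrow> 'a \<otimes> 'a) \<Rightarrow> ('a \<Rightarrow> complex) \<Rightarrow> 'a \<Rightarrow> 'a"
  where "conv_left cop f b = tensor_lift (\<lambda>x y. f y *\<^sub>C x) (cop b)"

definition conv ::
  "('a::complex_vector \<Rightarrow> 'a \<otimes> 'a) \<Rightarrow> ('a \<Rightarrow> complex) \<Rightarrow> ('a \<Rightarrow> complex) \<Rightarrow> 'a \<Rightarrow> complex"
  where "conv cop f g b = tensor_lift (\<lambda>x y. f x * g y) (cop b)"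


section \<open>Spinor metric and \<open>R\<close> matrices\<close>

datatype pm = Plus | Minus

fun flip :: "pm \<Rightarrow> pm" where
  "flip Plus = Minus"
| "flip Minus = Plus"

fun pm_int :: "pm \<Rightarrow> int" where
  "pm_int Plus = 1"
| "pm_int Minus = -1"

text \<open>Spinor indices have type \<open>2\<close>. Dotted and undotted indices are not distinguished by
  type; objects carrying dotted indices are separate constants.\<close>

definition eps_lo :: "complex^2^2 \<Rightarrow> 2 \<Rightarrow> 2 \<Rightarrow> complex"
  where "eps_lo eps \<alpha> \<beta> = eps $ \<alpha> $ \<beta>"

definition eps_up :: "complex^2^2 \<Rightarrow> 2 \<Rightarrow> 2 \<Rightarrow> complex"
  where "eps_up eps \<alpha> \<beta> = matrix_inv eps $ \<alpha> $ \<beta>"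

definition eps_lo_dot :: "complex^2^2 \<Rightarrow> 2 \<Rightarrow> 2 \<Rightarrow> complex"
  where "eps_lo_dot eps \<beta> \<alpha> = cnj (eps_lo eps \<alpha> \<beta>)"

definition eps_up_dot :: "complex^2^2 \<Rightarrow> 2 \<Rightarrow> 2 \<Rightarrow> complex"
  where "eps_up_dot eps \<beta> \<alpha> = cnj (eps_up eps \<alpha> \<beta>)"

locale spinor_metric =
  fixes eps :: "complex^2^2" and a :: real
  assumes eps_invertible: "invertible eps"
    and eps_lo_dot_eq: "eps_lo_dot eps \<beta> \<alpha> = - eps_up eps \<alpha> \<beta>"
    and eps_up_dot_eq: "eps_up_dot eps \<beta> \<alpha> = - eps_lo eps \<alpha> \<beta>"
    and a_nonzero: "a \<noteq> 0"
    and a_eps: "complex_of_real (a + inverse a)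
      + (\<Sum>\<alpha>\<in>UNIV. \<Sum>\<beta>\<in>UNIV. eps_up eps \<alpha> \<beta> * eps_lo eps \<alpha> \<beta>) = 0"

definition Q_of :: "real \<Rightarrow> complex"
  where "Q_of a = complex_of_real (a + inverse a)"

definition a_pow :: "real \<Rightarrow> pm \<Rightarrow> complex"
  where "a_pow a s = complex_of_real (a powi pm_int s)"

definition a_half_pow :: "real \<Rightarrow> pm \<Rightarrow> complex"
  where "a_half_pow a s = complex_of_real (sqrt a powi pm_int s)"

text \<open>In all \<open>R\<close> matrices the two upper indices come first, then the two lower ones. The letters
  \<open>d\<close> and \<open>u\<close> in the names of the mixed matrices give the order of the dotted and the undotted
  upper index; the lower indices occur in the opposite order.\<close>

definition R_mat :: "complex^2^2 \<Rightarrow> real \<Rightarrow> pm \<Rightarrow> 2 \<Rightarrow> 2 \<Rightarrow> 2 \<Rightarrow> 2 \<Rightarrow> complex"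
  where "R_mat eps a s \<alpha> \<beta> \<gamma> \<delta> =
    of_bool (\<alpha> = \<gamma>) * of_bool (\<beta> = \<delta>) + a_pow a s * eps_up eps \<alpha> \<beta> * eps_lo eps \<gamma> \<delta>"

definition R_du :: "complex^2^2 \<Rightarrow> real \<Rightarrow> pm \<Rightarrow> 2 \<Rightarrow> 2 \<Rightarrow> 2 \<Rightarrow> 2 \<Rightarrow> complex"
  where "R_du eps a s \<delta> \<gamma> \<alpha> \<sigma> = a_half_pow a s * R_mat eps a (flip s) \<gamma> \<sigma> \<delta> \<alpha>"

definition R_ud :: "complex^2^2 \<Rightarrow> real \<Rightarrow> pm \<Rightarrow> 2 \<Rightarrow> 2 \<Rightarrow> 2 \<Rightarrow> 2 \<Rightarrow> complex"
  where "R_ud eps a s \<gamma> \<delta> \<sigma> \<alpha> = a_half_pow a (flip s) *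
    (\<Sum>\<mu>\<in>UNIV. \<Sum>\<nu>\<in>UNIV. eps_lo eps \<delta> \<mu> * R_mat eps a s \<gamma> \<mu> \<nu> \<alpha> * eps_up eps \<nu> \<sigma>)"


section \<open>The quantum group \<open>SL(2,\<complex>)\<close>\<close>

locale quantum_SL2C = hopf_star_algebra cop counit S + spinor_metric eps a
  for cop :: "'a::complex_star_algebra_1 \<Rightarrow> 'a \<otimes> 'a"
    and counit :: "'a \<Rightarrow> complex"
    and S :: "'a \<Rightarrow> 'a"
    and eps :: "complex^2^2"
    and a :: real +
  fixes M :: "2 \<Rightarrow> 2 \<Rightarrow> 'a"
    and Md :: "2 \<Rightarrow> 2 \<Rightarrow> 'a"
  assumes Md_def: "Md \<alpha> \<beta> = star (M \<alpha> \<beta>)"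
    and generated:
      "unital_subalgebra hull ({M \<alpha> \<beta> |\<alpha> \<beta>. True} \<union> {Md \<alpha> \<beta> |\<alpha> \<beta>. True}) = UNIV"
    and M_eps_lo: "(\<Sum>\<alpha>\<in>UNIV. \<Sum>\<beta>\<in>UNIV. eps_lo eps \<alpha> \<beta> *\<^sub>C (M \<gamma> \<alpha> * M \<delta> \<beta>))
      = eps_lo eps \<gamma> \<delta> *\<^sub>C 1"
    and M_eps_up: "(\<Sum>\<gamma>\<in>UNIV. \<Sum>\<delta>\<in>UNIV. eps_up eps \<gamma> \<delta> *\<^sub>C (M \<gamma> \<alpha> * M \<delta> \<beta>))
      = eps_up eps \<alpha> \<beta> *\<^sub>C 1"
    and Md_eps_lo: "(\<Sum>\<alpha>\<in>UNIV. \<Sum>\<beta>\<in>UNIV. eps_lo_dot eps \<alpha> \<beta> *\<^sub>C (Md \<gamma> \<alpha> * Md \<delta> \<beta>))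
      = eps_lo_dot eps \<gamma> \<delta> *\<^sub>C 1"
    and Md_eps_up: "(\<Sum>\<gamma>\<in>UNIV. \<Sum>\<delta>\<in>UNIV. eps_up_dot eps \<gamma> \<delta> *\<^sub>C (Md \<gamma> \<alpha> * Md \<delta> \<beta>))
      = eps_up_dot eps \<alpha> \<beta> *\<^sub>C 1"
    and M_Md: "(\<Sum>\<gamma>\<in>UNIV. \<Sum>\<delta>\<in>UNIV. R_du eps a s \<rho> \<beta> \<gamma> \<delta> *\<^sub>C (M \<alpha> \<gamma> * Md \<sigma> \<delta>))
      = (\<Sum>\<delta>\<in>UNIV. \<Sum>\<gamma>\<in>UNIV. R_du eps a s \<delta> \<gamma> \<alpha> \<sigma> *\<^sub>C (Md \<delta> \<rho> * M \<gamma> \<beta>))"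
    and cop_M: "cop (M \<alpha> \<beta>) = (\<Sum>\<gamma>\<in>UNIV. M \<alpha> \<gamma> \<otimes> M \<gamma> \<beta>)"
    and cop_Md: "cop (Md \<alpha> \<beta>) = (\<Sum>\<gamma>\<in>UNIV. Md \<alpha> \<gamma> \<otimes> Md \<gamma> \<beta>)"
    and counit_M: "counit (M \<alpha> \<beta>) = of_bool (\<alpha> = \<beta>)"
    and counit_Md: "counit (Md \<alpha> \<beta>) = of_bool (\<alpha> = \<beta>)"
    and S_M: "S (M \<alpha> \<beta>) =
      (\<Sum>\<gamma>\<in>UNIV. \<Sum>\<delta>\<in>UNIV. (eps_lo eps \<alpha> \<gamma> * eps_up eps \<delta> \<beta>) *\<^sub>C M \<delta> \<gamma>)"
    and S_Md: "S (Md \<alpha> \<beta>) =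
      (\<Sum>\<gamma>\<in>UNIV. \<Sum>\<delta>\<in>UNIV. (eps_lo_dot eps \<alpha> \<gamma> * eps_up_dot eps \<delta> \<beta>) *\<^sub>C Md \<delta> \<gamma>)"
    and inv_S_Md: "inv S (Md \<alpha> \<beta>) =
      (\<Sum>\<gamma>\<in>UNIV. \<Sum>\<delta>\<in>UNIV. (eps_up_dot eps \<beta> \<delta> * eps_lo_dot eps \<gamma> \<alpha>) *\<^sub>C Md \<delta> \<gamma>)"


section \<open>Functionals of the bicovariant calculus\<close>

text \<open>\<open>f\<close>, \<open>ft\<close> stand for \<open>f\<close>, \<open>f\<close> with a tilde on undotted indices, \<open>fd\<close>, \<open>ftd\<close> for their dotted
  versions; the arguments are the sign, the lower index and the upper index.\<close>

locale bicovariant_functionals = quantum_SL2C cop counit S eps a M Md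
  for cop :: "'a::complex_star_algebra_1 \<Rightarrow> 'a \<otimes> 'a"
    and counit :: "'a \<Rightarrow> complex"
    and S :: "'a \<Rightarrow> 'a"
    and eps :: "complex^2^2"
    and a :: real
    and M :: "2 \<Rightarrow> 2 \<Rightarrow> 'a"
    and Md :: "2 \<Rightarrow> 2 \<Rightarrow> 'a" +
  fixes f :: "pm \<Rightarrow> 2 \<Rightarrow> 2 \<Rightarrow> 'a \<Rightarrow> complex"
    and ft :: "pm \<Rightarrow> 2 \<Rightarrow> 2 \<Rightarrow> 'a \<Rightarrow> complex"
    and fd :: "pm \<Rightarrow> 2 \<Rightarrow> 2 \<Rightarrow> 'a \<Rightarrow> complex"
    and ftd :: "pm \<Rightarrow> 2 \<Rightarrow> 2 \<Rightarrow> 'a \<Rightarrow> complex"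
  assumes f_linear: "clinear (f s \<alpha> \<beta>)"
    and ft_linear: "clinear (ft s \<alpha> \<beta>)"
    and fd_linear: "clinear (fd s \<alpha> \<beta>)"
    and ftd_linear: "clinear (ftd s \<alpha> \<beta>)"
    and f_mult: "f s \<alpha> \<beta> (b * c) = (\<Sum>\<gamma>\<in>UNIV. f s \<alpha> \<gamma> b * f s \<gamma> \<beta> c)"
    and ft_mult: "ft s \<alpha> \<beta> (b * c) = (\<Sum>\<gamma>\<in>UNIV. ft s \<gamma> \<beta> b * ft s \<alpha> \<gamma> c)"
    and fd_mult: "fd s \<alpha> \<beta> (b * c) = (\<Sum>\<gamma>\<in>UNIV. fd s \<alpha> \<gamma> b * fd s \<gamma> \<beta> c)"
    and ftd_mult: "ftd s \<alpha> \<beta> (b * c) = (\<Sum>\<gamma>\<in>UNIV. ftd s \<gamma> \<beta> b * ftd s \<alpha> \<gamma> c)"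
    and f_one: "f s \<alpha> \<beta> 1 = of_bool (\<alpha> = \<beta>)"
    and ft_one: "ft s \<alpha> \<beta> 1 = of_bool (\<alpha> = \<beta>)"
    and fd_one: "fd s \<alpha> \<beta> 1 = of_bool (\<alpha> = \<beta>)"
    and ftd_one: "ftd s \<alpha> \<beta> 1 = of_bool (\<alpha> = \<beta>)"
    and f_bicov: "(\<Sum>\<gamma>\<in>UNIV. M \<alpha> \<gamma> * conv_left cop (f s \<gamma> \<beta>) b)
      = (\<Sum>\<gamma>\<in>UNIV. conv_right cop b (f s \<alpha> \<gamma>) * M \<gamma> \<beta>)"
    and ft_bicov: "(\<Sum>\<gamma>\<in>UNIV. S (M \<gamma> \<alpha>) * conv_left cop (ft s \<beta> \<gamma>) b)
      = (\<Sum>\<gamma>\<in>UNIV. conv_right cop b (ft s \<gamma> \<alpha>) * S (M \<beta> \<gamma>))"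
    and fd_bicov: "(\<Sum>\<gamma>\<in>UNIV. Md \<alpha> \<gamma> * conv_left cop (fd s \<gamma> \<beta>) b)
      = (\<Sum>\<gamma>\<in>UNIV. conv_right cop b (fd s \<alpha> \<gamma>) * Md \<gamma> \<beta>)"
    and ftd_bicov: "(\<Sum>\<gamma>\<in>UNIV. inv S (Md \<gamma> \<alpha>) * conv_left cop (ftd s \<beta> \<gamma>) b)
      = (\<Sum>\<gamma>\<in>UNIV. conv_right cop b (ftd s \<gamma> \<alpha>) * inv S (Md \<beta> \<gamma>))"
    and f_ft_S: "f s \<alpha> \<beta> = ft s \<alpha> \<beta> \<circ> S"
    and fd_ftd_inv_S: "fd s \<alpha> \<beta> = ftd s \<alpha> \<beta> \<circ> inv S"
    and f_ft_eps: "f s \<alpha> \<beta> b =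
      (\<Sum>\<delta>\<in>UNIV. \<Sum>\<gamma>\<in>UNIV. eps_up eps \<beta> \<delta> * ft s \<delta> \<gamma> b * eps_lo eps \<gamma> \<alpha>)"
    and ftd_fd_eps: "ftd s \<alpha> \<beta> b =
      (\<Sum>\<delta>\<in>UNIV. \<Sum>\<gamma>\<in>UNIV. eps_up_dot eps \<beta> \<delta> * fd s \<delta> \<gamma> b * eps_lo_dot eps \<gamma> \<alpha>)"
    and fd_ft: "fd s \<alpha> \<beta> = ft s \<beta> \<alpha>"
    and ftd_f: "ftd s \<alpha> \<beta> = f s \<beta> \<alpha>"
    and f_star: "cnj (f s \<alpha> \<beta> b) = fd (flip s) \<alpha> \<beta> (S (star b))"
    and ft_star: "cnj (ft s \<alpha> \<beta> b) = ftd (flip s) \<alpha> \<beta> (S (star b))"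
    and fd_star: "cnj (fd s \<alpha> \<beta> b) = f (flip s) \<alpha> \<beta> (S (star b))"
    and ftd_star: "cnj (ftd s \<alpha> \<beta> b) = ft (flip s) \<alpha> \<beta> (S (star b))"
    and f_M: "f s \<gamma> \<alpha> (M \<delta> \<rho>) = a_half_pow a (flip s) * R_mat eps a s \<rho> \<alpha> \<gamma> \<delta>"
    and f_S_M: "f s \<gamma> \<alpha> (S (M \<delta> \<rho>)) = a_half_pow a s * R_mat eps a (flip s) \<alpha> \<rho> \<delta> \<gamma>"
    and f_Md: "f s \<alpha> \<gamma> (Md \<sigma> \<delta>) = R_du eps a s \<delta> \<gamma> \<alpha> \<sigma>"
    and f_S_Md: "f s \<alpha> \<gamma> (S (Md \<sigma> \<delta>)) = R_ud eps a (flip s) \<gamma> \<delta> \<sigma> \<alpha>"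


section \<open>Quantum Pauli matrices, metric and Lorentz generators\<close>

text \<open>Vector indices have type \<open>4\<close>, whose elements are \<open>0, 1, 2, 3\<close>.\<close>

definition pauli_matrices :: "(4 \<Rightarrow> complex^2^2) \<Rightarrow> bool"
  where "pauli_matrices sig \<longleftrightarrow>
    (\<forall>I \<alpha> \<beta>. cnj (sig I $ \<alpha> $ \<beta>) = sig I $ \<beta> $ \<alpha>) \<and>
    (\<forall>c :: 4 \<Rightarrow> complex.
      (\<forall>\<alpha> \<beta>. (\<Sum>I\<in>UNIV. c I * sig I $ \<alpha> $ \<beta>) = 0) \<longrightarrow> (\<forall>I. c I = 0))"

definition sig_bar ::
  "complex^2^2 \<Rightarrow> real \<Rightarrow> (4 \<Rightarrow> complex^2^2) \<Rightarrow> pm \<Rightarrow> 4 \<Rightarrow> 2 \<Rightarrow> 2 \<Rightarrow> complex"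
  where "sig_bar eps a sig s I \<alpha> \<beta> =
    (\<Sum>\<mu>\<in>UNIV. \<Sum>\<sigma>\<in>UNIV. \<Sum>\<rho>\<in>UNIV. \<Sum>\<nu>\<in>UNIV.
      eps_up_dot eps \<alpha> \<mu> * R_ud eps a (flip s) \<sigma> \<rho> \<mu> \<nu> * eps_up eps \<nu> \<beta> * sig I $ \<sigma> $ \<rho>)"

definition metric_up ::
  "complex^2^2 \<Rightarrow> real \<Rightarrow> (4 \<Rightarrow> complex^2^2) \<Rightarrow> pm \<Rightarrow> complex^4^4"
  where "metric_up eps a sig s = (\<chi> I J. 1 / Q_of a *
    (\<Sum>\<alpha>\<in>UNIV. \<Sum>\<nu>\<in>UNIV. \<Sum>\<beta>\<in>UNIV. \<Sum>\<gamma>\<in>UNIV.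
      eps_up eps \<alpha> \<nu> * sig I $ \<alpha> $ \<beta> * sig_bar eps a sig s J \<beta> \<gamma> * eps_lo eps \<gamma> \<nu>))"

definition metric_lo ::
  "complex^2^2 \<Rightarrow> real \<Rightarrow> (4 \<Rightarrow> complex^2^2) \<Rightarrow> pm \<Rightarrow> complex^4^4"
  where "metric_lo eps a sig s = matrix_inv (metric_up eps a sig s)"

text \<open>The lowered matrices do not depend on the sign used to form them; the sign is kept as a
  parameter \<open>t\<close> here and in everything built from them.\<close>

definition sig_bar_lo ::
  "complex^2^2 \<Rightarrow> real \<Rightarrow> (4 \<Rightarrow> complex^2^2) \<Rightarrow> pm \<Rightarrow> 4 \<Rightarrow> 2 \<Rightarrow> 2 \<Rightarrow> complex"
  where "sig_bar_lo eps a sig t I \<alpha> \<beta> =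
    (\<Sum>J\<in>UNIV. metric_lo eps a sig t $ I $ J * sig_bar eps a sig t J \<alpha> \<beta>)"

definition sig_bar_mixed ::
  "complex^2^2 \<Rightarrow> real \<Rightarrow> (4 \<Rightarrow> complex^2^2) \<Rightarrow> pm \<Rightarrow> 4 \<Rightarrow> 2 \<Rightarrow> 2 \<Rightarrow> complex"
  where "sig_bar_mixed eps a sig t L \<gamma> \<alpha> =
    (\<Sum>\<delta>\<in>UNIV. eps_lo_dot eps \<gamma> \<delta> * sig_bar_lo eps a sig t L \<delta> \<alpha>)"

definition sig_mixed :: "complex^2^2 \<Rightarrow> (4 \<Rightarrow> complex^2^2) \<Rightarrow> 4 \<Rightarrow> 2 \<Rightarrow> 2 \<Rightarrow> complex"
  where "sig_mixed eps sig K \<sigma> \<rho> = (\<Sum>\<beta>\<in>UNIV. eps_up_dot eps \<rho> \<beta> * sig K $ \<sigma> $ \<beta>)"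

definition Lorentz ::
  "complex^2^2 \<Rightarrow> real \<Rightarrow> (4 \<Rightarrow> complex^2^2) \<Rightarrow> pm \<Rightarrow>
    ('a::complex_star_algebra_1 \<Rightarrow> 'a) \<Rightarrow> (2 \<Rightarrow> 2 \<Rightarrow> 'a) \<Rightarrow> (2 \<Rightarrow> 2 \<Rightarrow> 'a) \<Rightarrow> 4 \<Rightarrow> 4 \<Rightarrow> 'a"
  where "Lorentz eps a sig t S M Md L K = (1 / Q_of a) *\<^sub>C
    (\<Sum>\<gamma>\<in>UNIV. \<Sum>\<alpha>\<in>UNIV. \<Sum>\<sigma>\<in>UNIV. \<Sum>\<rho>\<in>UNIV.
      (sig_bar_mixed eps a sig t L \<gamma> \<alpha> * sig_mixed eps sig K \<sigma> \<rho>) *\<^sub>C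
        (M \<alpha> \<sigma> * inv S (Md \<rho> \<gamma>)))"


section \<open>Matrices acting on tensor powers of \<open>\<complex>\<^sup>4\<close>\<close>

text \<open>Rows are indexed by the upper (output) pair \<open>(N, M)\<close>, columns by the lower (input) pair
  \<open>(K, L)\<close>.\<close>

definition R_Lorentz ::
  "(4 \<Rightarrow> 4 \<Rightarrow> 'a \<Rightarrow> complex) \<Rightarrow> (4 \<Rightarrow> 4 \<Rightarrow> 'a) \<Rightarrow> complex^(4 \<times> 4)^(4 \<times> 4)"
  where "R_Lorentz F \<Lambda> = (\<chi> p q. case (p, q) of ((N, M), (K, L)) \<Rightarrow> F K M (\<Lambda> L N))"

definition leg12 :: "complex^(4 \<times> 4)^(4 \<times> 4) \<Rightarrow> complex^(4 \<times> 4 \<times> 4)^(4 \<times> 4 \<times> 4)"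
  where "leg12 R = (\<chi> p q. case (p, q) of ((N, M, P), (K, L, T)) \<Rightarrow>
    R $ (N, M) $ (K, L) * of_bool (P = T))"

definition leg23 :: "complex^(4 \<times> 4)^(4 \<times> 4) \<Rightarrow> complex^(4 \<times> 4 \<times> 4)^(4 \<times> 4 \<times> 4)"
  where "leg23 R = (\<chi> p q. case (p, q) of ((N, M, P), (K, L, T)) \<Rightarrow>
    of_bool (N = K) * R $ (M, P) $ (L, T))"

end

theory Submission
  imports Defs
begin

text \<open>
  The key observation is that both families of the theorem are tensor products, up to one change of
  basis. The generators \<open>\<Lambda>\<close> come from the corepresentation \<open>spinor_corep = M \<otimes> N\<close>, where \<open>N\<close> is
  the transposed image of the dotted generators under the inverse antipode, and the functionals \<open>F\<close>
  come from the tensor product \<open>spinor_rep\<close> of the representations \<open>f\<close> of the two signs. The base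
  change is given by the Pauli matrices (\<open>pauli_map\<close>) and the barred Pauli matrices (\<open>pauli_inv\<close>),
  which are inverse to each other (\<open>pauli_inv_map\<close>).

  Multiplicativity, the antipode relations and bicovariance are preserved by tensor products and by
  base change, so they pass from the given functionals to \<open>F\<close>
  (\<open>matrix_hom_conv_tensor\<close>, \<open>bicovariant_tensor\<close>, \<open>bicovariant_base_change\<close>). Reality follows from
  uniqueness of convolution inverses: hermiticity of the Pauli matrices shows that the conjugate of
  \<open>F\<close> is inverse to \<open>F\<close>, as is \<open>F \<circ> S\<close> (\<open>F_star\<close>). The braid relation is bicovariance of \<open>\<Lambda>\<close> and \<open>F\<close>,
  evaluated at \<open>\<Lambda>\<close> and mapped by \<open>F\<close> (\<open>braid_identity\<close>).

  For the remaining claims \<open>\<R>\<close> is computed in spinor indices (\<open>spinor_rep_corep\<close>). It acts on four strands as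
  \<open>X (R \<otimes> R') X\<^sup>-\<^sup>1\<close>, where \<open>R\<close> and \<open>R'\<close> are the spinor \<open>R\<close> matrices of opposite signs and \<open>X\<close> is
  \<open>R\<close> on the middle strands. Each \<open>R\<close> matrix is the identity plus a multiple of a Temperley-Lieb
  projection, with eigenvalues \<open>1\<close> and \<open>- a\<^sup>2\<close> or \<open>1\<close> and \<open>- a\<^sup>-\<^sup>2\<close>. The eigenvalues of \<open>\<R>\<close> are therefore
  \<open>1\<close>, \<open>- a\<^sup>2\<close> and \<open>- a\<^sup>-\<^sup>2\<close>, which is the cubic relation (\<open>kron_R_matrix_cubic\<close>). The metric is, up to a scalar,
  the image under \<open>X\<close> of two spinor metrics placed side by side (\<open>metric_up_eq\<close>, \<open>middle_up_vec\<close>), an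
  eigenvector of \<open>R \<otimes> R'\<close> with eigenvalue \<open>(- a\<^sup>2) * (- a\<^sup>-\<^sup>2) = 1\<close>; hence \<open>\<R>\<close> fixes it, and dually for
  the lower metric.
\<close>

section \<open>Linear and bilinear maps on tensor products\<close>

lemma clinear_iff:
  "clinear f \<longleftrightarrow> (\<forall>x y. f (x + y) = f x + f y) \<and> (\<forall>c x. f (c *\<^sub>C x) = c *\<^sub>C f x)"
  by (simp add: Vector_Spaces.linear_iff complex_vector.vector_space_axioms)

lemma clinear_add: "clinear f \<Longrightarrow> f (x + y) = f x + f y"
  and clinear_scaleC: "clinear f \<Longrightarrow> f (c *\<^sub>C x) = c *\<^sub>C f x"
  by (simp_all add: clinear_iff)

lemma clinear_zero: "clinear f \<Longrightarrow> f 0 = 0"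
  by (metis clinear_add add_cancel_right_right)

lemma clinear_sum:
  assumes "clinear f"
  shows "f (sum g A) = (\<Sum>i\<in>A. f (g i))"
  by (induction A rule: infinite_finite_induct) (simp_all add: assms clinear_zero clinear_add)

lemma scaleC_sum_right: "c *\<^sub>C sum g A = (\<Sum>i\<in>A. c *\<^sub>C (g i :: 'v::complex_vector))"
  by (rule complex_vector.scale_sum_right)

lemma clinear_fun_sum:
  assumes "\<And>i. i \<in> A \<Longrightarrow> clinear (f i)"
  shows "clinear (\<lambda>b. \<Sum>i\<in>A. f i b)"
  using assms by (simp add: clinear_iff sum.distrib scaleC_sum_right)

lemma clinear_fun_scaleC:
  assumes "clinear f"
  shows "clinear (\<lambda>b. c *\<^sub>C f b)"
  using assms by (simp add: clinear_iff scaleC_add_right scaleC_scaleC mult.commute)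

definition cbilinear ::
  "('a::complex_vector \<Rightarrow> 'b::complex_vector \<Rightarrow> 'c::complex_vector) \<Rightarrow> bool"
  where "cbilinear h \<longleftrightarrow> (\<forall>y. clinear (\<lambda>x. h x y)) \<and> (\<forall>x. clinear (h x))"

lemma cbilinear_iff: "cbilinear h \<longleftrightarrow>
   (\<forall>x x' y. h (x + x') y = h x y + h x' y) \<and> (\<forall>x y y'. h x (y + y') = h x y + h x y')
   \<and> (\<forall>c x y. h (c *\<^sub>C x) y = c *\<^sub>C h x y) \<and> (\<forall>c x y. h x (c *\<^sub>C y) = c *\<^sub>C h x y)"
  unfolding cbilinear_def clinear_iff by blast

lemma cbilinear_balanced: "cbilinear h \<Longrightarrow> balanced h"
  by (simp add: cbilinear_iff balanced_def)

lemma cbilinear_tensor: "cbilinear (\<lambda>x y. x \<otimes> y)"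
  by (simp add: cbilinear_iff tensor_add_left tensor_add_right tensor_scaleC_left tensor_scaleC_right)

lemma cbilinear_times: "cbilinear (\<lambda>x y. x * y :: 'a::complex_algebra_1)"
  by (simp add: cbilinear_iff distrib_left distrib_right mult_scaleC_left mult_scaleC_right)

lemma cbilinear_sum:
  assumes "cbilinear h"
  shows "h (sum f A) (sum g B) = (\<Sum>i\<in>A. \<Sum>j\<in>B. h (f i) (g j))"
proof -
  have l: "clinear (\<lambda>x. h x y)" and r: "clinear (h x)" for x y
    using assms by (auto simp: cbilinear_def)
  have "h (sum f A) (sum g B) = (\<Sum>i\<in>A. h (f i) (sum g B))"
    by (rule clinear_sum[OF l])
  then show ?thesis by (simp add: clinear_sum[OF r])
qed

lemma tensor_lift_fun_zero: "tensor_lift (\<lambda>x y. 0) t = 0"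
  by (simp add: tensor_lift_def case_prod_unfold)

lemma tensor_lift_fun_sum: "tensor_lift (\<lambda>x y. \<Sum>i\<in>A. h i x y) t = (\<Sum>i\<in>A. tensor_lift (h i) t)"
  by (induction A rule: infinite_finite_induct)
    (simp_all add: tensor_lift_fun_zero tensor_lift_fun_add)

lemma clinear_tensor_lift:
  fixes h :: "'a::complex_vector \<Rightarrow> 'b::complex_vector \<Rightarrow> 'c::complex_vector"
    and g :: "'c \<Rightarrow> 'd::complex_vector"
  assumes "clinear g"
  shows "g (tensor_lift h t) = tensor_lift (\<lambda>x y. g (h x y)) t"
proof -
  have "g (\<Sum>p\<in>#m. k p) = (\<Sum>p\<in>#m. g (k p))" for m :: "('a \<times> 'b) multiset" and k
    by (induction m) (simp_all add: clinear_zero[OF assms] clinear_add[OF assms])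
  then show ?thesis by (simp add: tensor_lift_def case_prod_unfold)
qed

lemma tensor_lift_fun_scaleC:
  fixes h :: "'a::complex_vector \<Rightarrow> 'b::complex_vector \<Rightarrow> 'c::complex_vector"
  shows "tensor_lift (\<lambda>x y. c *\<^sub>C h x y) t = c *\<^sub>C tensor_lift h t"
proof -
  have "clinear (\<lambda>z :: 'c. c *\<^sub>C z)"
    by (simp add: clinear_iff scaleC_add_right scaleC_scaleC mult.commute)
  from clinear_tensor_lift[OF this, of h t] show ?thesis by simp
qed

lemma tensor_lift_linear:
  assumes "cbilinear h"
  shows "clinear (tensor_lift h)"
proof -
  note b = cbilinear_balanced[OF assms]
  have add: "tensor_lift h (t + u) = tensor_lift h t + tensor_lift h u" for t u
    by (rule tensor_lift_add[OF b])
  have zero: "tensor_lift h 0 = 0"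
    using add[of 0 0] by simp
  have "tensor_lift h (c *\<^sub>C t) = c *\<^sub>C tensor_lift h t" for c t
  proof (induction t rule: tensor_induct)
    case zero
    then show ?case by (simp add: \<open>tensor_lift h 0 = 0\<close>)
  next
    case (add x y t)
    have "c *\<^sub>C (x \<otimes> y + t) = (c *\<^sub>C x) \<otimes> y + c *\<^sub>C t"
      by (simp only: scaleC_add_right tensor_scaleC_left)
    then show ?case
      using assms
      by (simp add: \<open>\<And>t u. tensor_lift h (t + u) = tensor_lift h t + tensor_lift h u\<close>
          tensor_lift_tensor[OF b] add scaleC_add_right cbilinear_iff)
  qed
  with add show ?thesis by (simp add: clinear_iff)
qed

lemma tensor_lift_pure:
  assumes "cbilinear h"
  shows "tensor_lift h (x \<otimes> y) = h x y"
  by (rule tensor_lift_tensor[OF cbilinear_balanced[OF assms]])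

lemma tensor_eqI:
  assumes "clinear f" "clinear g" "\<And>x y. f (x \<otimes> y) = g (x \<otimes> y)"
  shows "f t = g t"
  by (induction t rule: tensor_induct)
    (simp_all add: clinear_zero[OF assms(1)] clinear_zero[OF assms(2)]
      clinear_add[OF assms(1)] clinear_add[OF assms(2)] assms(3))

lemma clinear_comp: "clinear f \<Longrightarrow> clinear g \<Longrightarrow> clinear (\<lambda>x. g (f x))"
  by (simp add: clinear_iff)

lemma clinear_id: "clinear id" "clinear (\<lambda>x. x)"
  by (simp_all add: clinear_iff)

lemma tensor_map_linear:
  assumes "clinear f" "clinear g"
  shows "clinear (tensor_map f g)"
  unfolding tensor_map_def
  by (rule tensor_lift_linear)
    (use assms in \<open>simp add: cbilinear_iff clinear_iff tensor_add_left tensor_add_right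
      tensor_scaleC_left tensor_scaleC_right\<close>)

lemma cbilinear_assoc:
  "cbilinear (\<lambda>t z. tensor_lift (\<lambda>x y. x \<otimes> y \<otimes> z)
    (t :: 'a::complex_vector \<otimes> 'b::complex_vector) :: 'a \<otimes> 'b \<otimes> 'c::complex_vector)"
proof -
  have "cbilinear (\<lambda>(x :: 'a) (y :: 'b). x \<otimes> y \<otimes> z)" for z :: 'c
    by (simp add: cbilinear_iff tensor_add_left tensor_add_right tensor_scaleC_left
        tensor_scaleC_right)
  from tensor_lift_linear[OF this] show ?thesis
    by (simp add: cbilinear_iff clinear_iff tensor_add_right tensor_scaleC_right
        tensor_lift_fun_add tensor_lift_fun_scaleC)
qed

lemma cbilinear_tensor_mult:
  "cbilinear (tensor_mult :: 'a::complex_algebra_1 \<otimes> 'b::complex_algebra_1 \<Rightarrow> _)"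
proof -
  have inner: "cbilinear (\<lambda>(x' :: 'a) (y' :: 'b). (x * x') \<otimes> (y * y'))" for x y
    by (simp add: cbilinear_iff distrib_left mult_scaleC_right tensor_add_left tensor_add_right
        tensor_scaleC_left tensor_scaleC_right)
  have outer: "cbilinear (\<lambda>x y. tensor_lift (\<lambda>x' y'. (x * x') \<otimes> (y * y')) u)" for u :: "'a \<otimes> 'b"
    by (simp add: cbilinear_iff distrib_right mult_scaleC_left tensor_add_left tensor_add_right
        tensor_scaleC_left tensor_scaleC_right tensor_lift_fun_add tensor_lift_fun_scaleC)
  show ?thesis
    unfolding cbilinear_def
  proof (intro conjI allI)
    show "clinear (\<lambda>t. tensor_mult t u)" for u :: "'a \<otimes> 'b"
      unfolding tensor_mult_def by (rule tensor_lift_linear[OF outer])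
    show "clinear (tensor_mult t)" for t :: "'a \<otimes> 'b"
      using tensor_lift_linear[OF inner]
      by (simp add: clinear_iff tensor_mult_def tensor_lift_fun_add tensor_lift_fun_scaleC)
  qed
qed

lemma tensor_lift_mult:
  fixes t u :: "'a::complex_algebra_1 \<otimes> 'b::complex_algebra_1"
  assumes "cbilinear h"
  shows "tensor_lift h (tensor_mult t u)
    = tensor_lift (\<lambda>x y. tensor_lift (\<lambda>x' y'. h (x * x') (y * y')) u) t"
proof (rule tensor_eqI[of "\<lambda>t. tensor_lift h (tensor_mult t u)"])
  note lh = tensor_lift_linear[OF assms]
  have ml: "clinear (\<lambda>t. tensor_mult t u)" and mr: "clinear (tensor_mult t)" for t u :: "'a \<otimes> 'b"
    using cbilinear_tensor_mult unfolding cbilinear_def by blast+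
  show "clinear (\<lambda>t. tensor_lift h (tensor_mult t u))"
    by (rule clinear_comp[OF ml lh])
  have inner: "cbilinear (\<lambda>x' y'. h (x * x') (y * y'))" for x y
    using assms by (simp add: cbilinear_iff distrib_left mult_scaleC_right)
  have outer: "cbilinear (\<lambda>x y. tensor_lift (\<lambda>x' y'. h (x * x') (y * y')) u)"
    using assms by (simp add: cbilinear_iff distrib_right mult_scaleC_left
        tensor_lift_fun_add tensor_lift_fun_scaleC)
  show "clinear (tensor_lift (\<lambda>x y. tensor_lift (\<lambda>x' y'. h (x * x') (y * y')) u))"
    by (rule tensor_lift_linear[OF outer])
  fix x y
  show "tensor_lift h (tensor_mult (x \<otimes> y) u)
      = tensor_lift (\<lambda>x y. tensor_lift (\<lambda>x' y'. h (x * x') (y * y')) u) (x \<otimes> y)"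
    unfolding tensor_lift_pure[OF outer]
    by (rule tensor_eqI[OF clinear_comp[OF mr lh] tensor_lift_linear[OF inner]])
      (simp add: tensor_mult_tensor tensor_lift_pure[OF inner] tensor_lift_pure[OF assms])
qed

context hopf_star_algebra
begin

text \<open>The form in which coassociativity is applied below: iterated sums over coproduct components
  may be regrouped under any trilinear expression. The map induced by \<open>h\<close> on
  \<open>A \<otimes> (A \<otimes> A)\<close> takes the two sides of the coassociativity axiom to the two sides
  here.\<close>
lemma coassoc_lift:
  fixes h :: "'a \<Rightarrow> 'a \<Rightarrow> 'a \<Rightarrow> 'v::complex_vector"
  assumes "\<And>z. cbilinear (\<lambda>x y. h x y z)" "\<And>x. cbilinear (h x)"
  shows "tensor_lift (\<lambda>x z. tensor_lift (\<lambda>u v. h u v z) (cop x)) (cop b)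
    = tensor_lift (\<lambda>x y. tensor_lift (h x) (cop y)) (cop b)"
proof -
  define L where "L = tensor_lift (\<lambda>x w. tensor_lift (h x) w)"
  note lin = tensor_lift_linear[OF assms(1)] tensor_lift_linear[OF assms(2)]
  have "h (x + x') = (\<lambda>u v. h x u v + h x' u v)" "h (c *\<^sub>C x) = (\<lambda>u v. c *\<^sub>C h x u v)" for c x x'
    using assms(1) by (auto simp: cbilinear_iff fun_eq_iff)
  then have bL: "cbilinear (\<lambda>x w. tensor_lift (h x) w)"
    using lin(2)
    by (simp add: cbilinear_iff clinear_iff tensor_lift_fun_add tensor_lift_fun_scaleC)
  have linL: "clinear L"
    unfolding L_def by (rule tensor_lift_linear[OF bL])
  have right: "L (tensor_map id cop t) = tensor_lift (\<lambda>x y. tensor_lift (h x) (cop y)) t" for t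
  proof (rule tensor_eqI[OF clinear_comp[OF tensor_map_linear[OF clinear_id(1) cop_linear] linL]])
    have b: "cbilinear (\<lambda>x y. tensor_lift (h x) (cop y))"
      using bL cop_linear by (simp add: cbilinear_iff clinear_iff)
    show "clinear (tensor_lift (\<lambda>x y. tensor_lift (h x) (cop y)))"
      by (rule tensor_lift_linear[OF b])
    show "L (tensor_map id cop (x \<otimes> y)) = tensor_lift (\<lambda>x y. tensor_lift (h x) (cop y)) (x \<otimes> y)"
      for x y
      by (simp add: tensor_map_tensor[OF clinear_id(1) cop_linear] tensor_lift_pure[OF b]
          L_def tensor_lift_pure[OF bL])
  qed
  have linA: "clinear (tensor_assoc :: ('a \<otimes> 'a) \<otimes> 'a \<Rightarrow> _)"
    unfolding tensor_assoc_def by (rule tensor_lift_linear[OF cbilinear_assoc])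
  have L_pure: "L (tensor_assoc (w \<otimes> z)) = tensor_lift (\<lambda>u v. h u v z) w" for w z
  proof (rule tensor_eqI[OF _ lin(1)])
    show "clinear (\<lambda>w. L (tensor_assoc (w \<otimes> z)))"
      using linA linL by (simp add: clinear_iff tensor_add_left tensor_scaleC_left)
    show "L (tensor_assoc ((x \<otimes> y) \<otimes> z)) = tensor_lift (\<lambda>u v. h u v z) (x \<otimes> y)" for x y
      by (simp add: tensor_assoc_tensor L_def tensor_lift_pure[OF bL] tensor_lift_pure[OF assms(1)]
          tensor_lift_pure[OF assms(2)])
  qed
  have "L (tensor_assoc (tensor_map cop id t))
      = tensor_lift (\<lambda>x z. tensor_lift (\<lambda>u v. h u v z) (cop x)) t" for t
  proof (rule tensor_eqI[OF clinear_comp[OF clinear_comp[OF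
            tensor_map_linear[OF cop_linear clinear_id(1)] linA] linL]])
    have b: "cbilinear (\<lambda>x z. tensor_lift (\<lambda>u v. h u v z) (cop x))"
      using assms lin cop_linear
      by (simp add: cbilinear_iff clinear_iff tensor_lift_fun_add tensor_lift_fun_scaleC)
    show "clinear (tensor_lift (\<lambda>x z. tensor_lift (\<lambda>u v. h u v z) (cop x)))"
      by (rule tensor_lift_linear[OF b])
    show "L (tensor_assoc (tensor_map cop id (x \<otimes> z)))
      = tensor_lift (\<lambda>x z. tensor_lift (\<lambda>u v. h u v z) (cop x)) (x \<otimes> z)" for x z
      by (simp add: tensor_map_tensor[OF cop_linear clinear_id(1)] tensor_lift_pure[OF b] L_pure)
  qed
  from this[of "cop b"] right[of "cop b"] show ?thesis by (simp add: coassoc)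
qed

end

section \<open>Matrices of elements and of functionals\<close>

lemma scaleC_complex: "c *\<^sub>C (z::complex) = c * z"
  by (simp add: scaleC_complex_def)

lemma clinear_functional_iff:
  "clinear (g :: 'a::complex_vector \<Rightarrow> complex) \<longleftrightarrow>
    (\<forall>x y. g (x + y) = g x + g y) \<and> (\<forall>c x. g (c *\<^sub>C x) = c * g x)"
  by (simp add: clinear_iff scaleC_complex)

lemma cbilinear_functionals:
  assumes "clinear (g :: 'a::complex_vector \<Rightarrow> complex)" "clinear (h :: 'b::complex_vector \<Rightarrow> complex)"
  shows "cbilinear (\<lambda>x y. g x * h y)"
  using assms by (simp add: cbilinear_iff clinear_functional_iff scaleC_complex algebra_simps)

lemma sum_UNIV_prod: "(\<Sum>p\<in>UNIV. g p) = (\<Sum>i\<in>(UNIV :: 'i::finite set). \<Sum>j\<in>(UNIV :: 'j::finite set). g (i, j))"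
  by (simp add: sum.cartesian_product flip: UNIV_Times_UNIV)

definition base_change ::
  "('k \<Rightarrow> 'i \<Rightarrow> complex) \<Rightarrow> ('i \<Rightarrow> 'k \<Rightarrow> complex) \<Rightarrow>
    ('i::finite \<Rightarrow> 'i \<Rightarrow> 'v::complex_vector) \<Rightarrow> 'k \<Rightarrow> 'k \<Rightarrow> 'v"
  where "base_change P P' X L K = (\<Sum>x\<in>UNIV. \<Sum>y\<in>UNIV. (P L x * P' y K) *\<^sub>C X x y)"

definition mutually_inverse ::
  "('k::finite \<Rightarrow> 'i::finite \<Rightarrow> complex) \<Rightarrow> ('i \<Rightarrow> 'k \<Rightarrow> complex) \<Rightarrow> bool"
  where "mutually_inverse P P' \<longleftrightarrow>
    (\<forall>L K. (\<Sum>x\<in>UNIV. P L x * P' x K) = of_bool (L = K)) \<and>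
    (\<forall>x y. (\<Sum>L\<in>UNIV. P' x L * P L y) = of_bool (x = y))"

lemma clinear_base_change:
  assumes "clinear g"
  shows "g (base_change P P' X L K) = base_change P P' (\<lambda>x y. g (X x y)) L K"
  by (simp add: base_change_def clinear_sum[OF assms] clinear_scaleC[OF assms])

text \<open>Matrix multiplication over an arbitrary bilinear product is compatible with a change of basis,
  because the inner matrices \<open>P'\<close> and \<open>P\<close> cancel. The product is left abstract so that one
  statement serves numbers, algebra elements and tensors; this is what carries every property of
  the spinor matrices over to vector indices.\<close>
lemma base_change_matrix_mult:
  assumes "mutually_inverse P P'" and "cbilinear h"
  shows "(\<Sum>I\<in>UNIV. h (base_change P P' X L I) (base_change P P' Y I K))
    = base_change P P' (\<lambda>x y. \<Sum>z\<in>UNIV. h (X x z) (Y z y)) L K"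
proof -
  have h: "h (c *\<^sub>C x) y = c *\<^sub>C h x y" "h x (c *\<^sub>C y) = c *\<^sub>C h x y" for c x y
    using assms(2) by (auto simp: cbilinear_iff)
  have "(\<Sum>I\<in>UNIV. h (base_change P P' X L I) (base_change P P' Y I K))
    = (\<Sum>I\<in>UNIV. \<Sum>x\<in>UNIV. \<Sum>x'\<in>UNIV. \<Sum>z\<in>UNIV. \<Sum>y\<in>UNIV.
        (P L x * P' y K * (P' z I * P I x')) *\<^sub>C h (X x z) (Y x' y))"
    unfolding base_change_def
    by (simp add: cbilinear_sum[OF assms(2)] h scaleC_scaleC ac_simps)
  also have "\<dots> = (\<Sum>x\<in>UNIV. \<Sum>x'\<in>UNIV. \<Sum>z\<in>UNIV. \<Sum>y\<in>UNIV. \<Sum>I\<in>UNIV.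
        (P L x * P' y K * (P' z I * P I x')) *\<^sub>C h (X x z) (Y x' y))"
    apply (subst sum.swap, rule sum.cong[OF refl])
    apply (subst sum.swap, rule sum.cong[OF refl])
    apply (subst sum.swap, rule sum.cong[OF refl])
    apply (subst sum.swap, rule sum.cong[OF refl])
    apply (rule refl)
    done
  also have "\<dots> = (\<Sum>x\<in>UNIV. \<Sum>x'\<in>UNIV. \<Sum>z\<in>UNIV. \<Sum>y\<in>UNIV.
        (P L x * P' y K * (\<Sum>I\<in>UNIV. P' z I * P I x')) *\<^sub>C h (X x z) (Y x' y))"
    by (simp add: complex_vector.scale_sum_left sum_distrib_left)
  also have "\<dots> = (\<Sum>x\<in>UNIV. \<Sum>x'\<in>UNIV. \<Sum>z\<in>UNIV. \<Sum>y\<in>UNIV.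
        if z = x' then (P L x * P' y K) *\<^sub>C h (X x z) (Y x' y) else 0)"
    using assms(1) by (intro sum.cong refl) (simp add: mutually_inverse_def)
  also have "\<dots> = (\<Sum>x\<in>UNIV. \<Sum>x'\<in>UNIV. \<Sum>y\<in>UNIV. (P L x * P' y K) *\<^sub>C h (X x x') (Y x' y))"
    by (rule sum.cong[OF refl], rule sum.cong[OF refl], subst sum.swap) simp
  also have "\<dots> = (\<Sum>x\<in>UNIV. \<Sum>y\<in>UNIV. \<Sum>x'\<in>UNIV. (P L x * P' y K) *\<^sub>C h (X x x') (Y x' y))"
    by (rule sum.cong[OF refl], rule sum.swap)
  also have "\<dots> = base_change P P' (\<lambda>x y. \<Sum>z\<in>UNIV. h (X x z) (Y z y)) L K"
    by (simp add: base_change_def scaleC_sum_right)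
  finally show ?thesis .
qed

lemma base_change_delta:
  assumes "mutually_inverse P P'"
  shows "base_change P P' (\<lambda>x y. of_bool (x = y) *\<^sub>C v) L K = of_bool (L = K) *\<^sub>C v"
proof -
  have "base_change P P' (\<lambda>x y. of_bool (x = y) *\<^sub>C v) L K
    = (\<Sum>x\<in>UNIV. \<Sum>y\<in>UNIV. if x = y then (P L x * P' y K) *\<^sub>C v else 0)"
    unfolding base_change_def by (intro sum.cong refl) (simp add: scaleC_scaleC)
  also have "\<dots> = (\<Sum>x\<in>UNIV. P L x * P' x K) *\<^sub>C v"
    by (simp add: complex_vector.scale_sum_left)
  finally show ?thesis
    using assms by (simp add: mutually_inverse_def)
qed

text \<open>A matrix of functionals with these properties is a finite-dimensional representation of the
  algebra, written in coordinates.\<close>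
definition matrix_hom :: "('i::finite \<Rightarrow> 'i \<Rightarrow> 'a::complex_algebra_1 \<Rightarrow> complex) \<Rightarrow> bool"
  where "matrix_hom \<phi> \<longleftrightarrow> (\<forall>i j. clinear (\<phi> i j)) \<and>
    (\<forall>i j b c. \<phi> i j (b * c) = (\<Sum>k\<in>UNIV. \<phi> i k b * \<phi> k j c)) \<and>
    (\<forall>i j. \<phi> i j 1 = of_bool (i = j))"

lemma matrix_homD:
  assumes "matrix_hom \<phi>"
  shows "clinear (\<phi> i j)" "\<phi> i j (b * c) = (\<Sum>k\<in>UNIV. \<phi> i k b * \<phi> k j c)"
    "\<phi> i j 1 = of_bool (i = j)"
  using assms by (simp_all add: matrix_hom_def)

abbreviation functional_base_change where
  "functional_base_change P P' \<phi> L K \<equiv> (\<lambda>b. base_change P P' (\<lambda>x y. \<phi> x y b) L K)"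

lemma matrix_hom_base_change:
  assumes "mutually_inverse P P'" "matrix_hom \<phi>"
  shows "matrix_hom (functional_base_change P P' \<phi>)"
  unfolding matrix_hom_def
proof (intro conjI allI)
  note \<phi> = matrix_homD[OF assms(2)]
  show "clinear (functional_base_change P P' \<phi> i j)" for i j
    unfolding base_change_def
    by (intro clinear_fun_sum clinear_fun_scaleC \<phi>)
  show "functional_base_change P P' \<phi> i j (b * c)
      = (\<Sum>k\<in>UNIV. functional_base_change P P' \<phi> i k b * functional_base_change P P' \<phi> k j c)"
    for i j b c
    using base_change_matrix_mult[OF assms(1) cbilinear_times,
        of "\<lambda>x y. \<phi> x y b" i "\<lambda>x y. \<phi> x y c" j]
    by (simp add: \<phi>)
  show "functional_base_change P P' \<phi> i j 1 = of_bool (i = j)" for i j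
    using base_change_delta[OF assms(1), of "1 :: complex"] by (simp add: \<phi> scaleC_complex)
qed

section \<open>Convolution algebra and representations\<close>

context hopf_star_algebra
begin

lemma conv_linear:
  assumes "clinear g" "clinear h"
  shows "clinear (conv cop g h)"
  unfolding conv_def
  by (rule clinear_comp[OF cop_linear tensor_lift_linear[OF cbilinear_functionals[OF assms]]])

lemma clinear_conv_left: "clinear h \<Longrightarrow> clinear (conv_left cop h)"
  unfolding conv_left_def
  by (rule clinear_comp[OF cop_linear tensor_lift_linear])
    (simp add: cbilinear_iff clinear_functional_iff scaleC_add_left scaleC_add_right scaleC_scaleC mult.commute)

lemma clinear_conv_right: "clinear h \<Longrightarrow> clinear (\<lambda>b. conv_right cop b h)"
  unfolding conv_right_def
  by (rule clinear_comp[OF cop_linear tensor_lift_linear])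
    (simp add: cbilinear_iff clinear_functional_iff scaleC_add_left scaleC_add_right scaleC_scaleC mult.commute)

lemma conv_assoc:
  assumes "clinear g" "clinear h" "clinear k"
  shows "conv cop (conv cop g h) k b = conv cop g (conv cop h k) b"
proof -
  have "tensor_lift (\<lambda>x z. tensor_lift (\<lambda>u v. g u * h v * k z) (cop x)) (cop b)
    = tensor_lift (\<lambda>x y. tensor_lift (\<lambda>u v. g x * h u * k v) (cop y)) (cop b)"
    by (rule coassoc_lift)
      (use assms in \<open>simp_all add: cbilinear_iff clinear_functional_iff scaleC_complex algebra_simps\<close>)
  moreover have "tensor_lift (\<lambda>u v. g u * h v * k z) (cop x) = conv cop g h x * k z" for x z
    using tensor_lift_fun_scaleC[of "k z" "\<lambda>u v. g u * h v" "cop x"]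
    by (simp add: conv_def scaleC_complex mult.commute)
  moreover have "tensor_lift (\<lambda>u v. g x * h u * k v) (cop y) = g x * conv cop h k y" for x y
    using tensor_lift_fun_scaleC[of "g x" "\<lambda>u v. h u * k v" "cop y"]
    by (simp add: conv_def scaleC_complex mult.assoc)
  ultimately show ?thesis by (simp add: conv_def[where b = b])
qed

lemma conv_counit_left: "clinear g \<Longrightarrow> conv cop counit g b = g b"
  using clinear_tensor_lift[of g "\<lambda>x y. counit x *\<^sub>C y" "cop b"]
  by (simp add: conv_def counit_left clinear_functional_iff)

lemma conv_counit_right: "clinear g \<Longrightarrow> conv cop g counit b = g b"
  using clinear_tensor_lift[of g "\<lambda>x y. counit y *\<^sub>C x" "cop b"]
  by (simp add: conv_def counit_right clinear_functional_iff mult.commute)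

lemma conv_sum_left: "conv cop (\<lambda>x. \<Sum>i\<in>A. g i x) h b = (\<Sum>i\<in>A. conv cop (g i) h b)"
  by (simp add: conv_def sum_distrib_right tensor_lift_fun_sum)

lemma conv_sum_right: "conv cop h (\<lambda>x. \<Sum>i\<in>A. g i x) b = (\<Sum>i\<in>A. conv cop h (g i) b)"
  by (simp add: conv_def sum_distrib_left tensor_lift_fun_sum)

lemma conv_scale_left: "conv cop (\<lambda>x. c * g x) h b = c * conv cop g h b"
  using tensor_lift_fun_scaleC[of c "\<lambda>x y. g x * h y" "cop b"]
  by (simp add: conv_def scaleC_complex mult.assoc)

lemma conv_scale_right: "conv cop g (\<lambda>x. c * h x) b = c * conv cop g h b"
  using tensor_lift_fun_scaleC[of c "\<lambda>x y. g x * h y" "cop b"]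
  by (simp add: conv_def scaleC_complex ac_simps)

lemma conv_left_conv:
  assumes "clinear g" "clinear h"
  shows "conv_left cop (conv cop g h) b = conv_left cop g (conv_left cop h b)"
proof -
  have "conv_left cop g (conv_left cop h b)
    = tensor_lift (\<lambda>x z. tensor_lift (\<lambda>u v. h z *\<^sub>C g v *\<^sub>C u) (cop x)) (cop b)"
    by (simp only: conv_left_def[of cop h b] clinear_tensor_lift[OF clinear_conv_left[OF assms(1)]]
        clinear_scaleC[OF clinear_conv_left[OF assms(1)]] tensor_lift_fun_scaleC)
      (simp only: conv_left_def[of cop g])
  also have "\<dots> = tensor_lift (\<lambda>x y. tensor_lift (\<lambda>u v. h v *\<^sub>C g u *\<^sub>C x) (cop y)) (cop b)"
    by (rule coassoc_lift)
      (use assms in \<open>simp_all add: cbilinear_iff clinear_functional_iff scaleC_add_left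
        scaleC_add_right scaleC_scaleC algebra_simps\<close>)
  also have "\<dots> = conv_left cop (conv cop g h) b"
  proof -
    have "tensor_lift (\<lambda>u v. h v *\<^sub>C g u *\<^sub>C x) (cop y) = conv cop g h y *\<^sub>C x" for x y :: 'a
    proof -
      have "clinear (\<lambda>c :: complex. c *\<^sub>C x)"
        by (simp add: clinear_iff scaleC_add_left scaleC_scaleC scaleC_complex)
      from clinear_tensor_lift[OF this, of "\<lambda>u v. g u * h v" "cop y"]
      show ?thesis by (simp add: conv_def scaleC_scaleC mult.commute)
    qed
    then show ?thesis by (simp add: conv_left_def)
  qed
  finally show ?thesis by simp
qed

lemma conv_right_conv:
  assumes "clinear g" "clinear h"
  shows "conv_right cop b (conv cop g h) = conv_right cop (conv_right cop b g) h"
proof -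
  have "conv_right cop (conv_right cop b g) h
    = tensor_lift (\<lambda>x y. tensor_lift (\<lambda>u v. g x *\<^sub>C h u *\<^sub>C v) (cop y)) (cop b)"
    by (simp only: conv_right_def[of cop b g] clinear_tensor_lift[OF clinear_conv_right[OF assms(2)]]
        clinear_scaleC[OF clinear_conv_right[OF assms(2)]] tensor_lift_fun_scaleC)
      (simp only: conv_right_def[of cop _ h])
  also have "\<dots> = tensor_lift (\<lambda>x z. tensor_lift (\<lambda>u v. g u *\<^sub>C h v *\<^sub>C z) (cop x)) (cop b)"
    by (rule coassoc_lift[symmetric])
      (use assms in \<open>simp_all add: cbilinear_iff clinear_functional_iff scaleC_add_left
        scaleC_add_right scaleC_scaleC algebra_simps\<close>)
  also have "\<dots> = conv_right cop b (conv cop g h)"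
  proof -
    have "tensor_lift (\<lambda>u v. g u *\<^sub>C h v *\<^sub>C x) (cop y) = conv cop g h y *\<^sub>C x" for x y :: 'a
    proof -
      have "clinear (\<lambda>c :: complex. c *\<^sub>C x)"
        by (simp add: clinear_iff scaleC_add_left scaleC_scaleC scaleC_complex)
      from clinear_tensor_lift[OF this, of "\<lambda>u v. g u * h v" "cop y"]
      show ?thesis by (simp add: conv_def scaleC_scaleC)
    qed
    then show ?thesis by (simp add: conv_right_def)
  qed
  finally show ?thesis by simp
qed

lemma conv_left_right_commute:
  assumes "clinear g" "clinear h"
  shows "conv_right cop (conv_left cop h b) g = conv_left cop h (conv_right cop b g)"
proof -
  have "conv_right cop (conv_left cop h b) g
    = tensor_lift (\<lambda>x z. tensor_lift (\<lambda>u v. h z *\<^sub>C g u *\<^sub>C v) (cop x)) (cop b)"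
    by (simp only: conv_left_def[of cop h b] clinear_tensor_lift[OF clinear_conv_right[OF assms(1)]]
        clinear_scaleC[OF clinear_conv_right[OF assms(1)]] tensor_lift_fun_scaleC)
      (simp only: conv_right_def[of cop _ g])
  also have "\<dots> = tensor_lift (\<lambda>x y. tensor_lift (\<lambda>u v. g x *\<^sub>C h v *\<^sub>C u) (cop y)) (cop b)"
    unfolding complex_vector.scale_left_commute[of "h _"]
    by (rule coassoc_lift)
      (use assms in \<open>simp_all add: cbilinear_iff clinear_functional_iff scaleC_add_left
        scaleC_add_right scaleC_scaleC algebra_simps\<close>)
  also have "\<dots> = tensor_lift (\<lambda>x y. g x *\<^sub>C conv_left cop h y) (cop b)"
    by (simp only: conv_left_def tensor_lift_fun_scaleC)
  also have "\<dots> = conv_left cop h (conv_right cop b g)"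
    using clinear_tensor_lift[OF clinear_conv_left[OF assms(2)], of "\<lambda>x y. g x *\<^sub>C y" "cop b"]
    by (simp only: conv_right_def clinear_scaleC[OF clinear_conv_left[OF assms(2)]])
  finally show ?thesis .
qed

lemma conv_mult:
  assumes "clinear g" "clinear h"
  shows "conv cop g h (b * c)
    = tensor_lift (\<lambda>x y. tensor_lift (\<lambda>x' y'. g (x * x') * h (y * y')) (cop c)) (cop b)"
  by (simp add: conv_def cop_mult tensor_lift_mult cbilinear_functionals[OF assms])

lemma matrix_hom_antipode_right:
  assumes "matrix_hom \<phi>"
  shows "(\<Sum>k\<in>UNIV. conv cop (\<phi> i k) (\<phi> k j \<circ> S) b) = of_bool (i = j) * counit b"
proof -
  note \<phi> = matrix_homD[OF assms]
  have "(\<Sum>k\<in>UNIV. conv cop (\<phi> i k) (\<phi> k j \<circ> S) b) = tensor_lift (\<lambda>x y. \<phi> i j (x * S y)) (cop b)"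
    by (simp add: conv_def \<phi> tensor_lift_fun_sum)
  also have "\<dots> = \<phi> i j (counit b *\<^sub>C 1)"
    using clinear_tensor_lift[OF \<phi>(1), of i j "\<lambda>x y. x * S y" "cop b"]
    by (simp add: antipode_right)
  finally show ?thesis
    by (simp add: clinear_scaleC[OF \<phi>(1)] \<phi>(3) scaleC_complex)
qed

lemma matrix_hom_antipode_left:
  assumes "matrix_hom \<phi>"
  shows "(\<Sum>k\<in>UNIV. conv cop (\<phi> i k \<circ> S) (\<phi> k j) b) = of_bool (i = j) * counit b"
proof -
  note \<phi> = matrix_homD[OF assms]
  have "(\<Sum>k\<in>UNIV. conv cop (\<phi> i k \<circ> S) (\<phi> k j) b) = tensor_lift (\<lambda>x y. \<phi> i j (S x * y)) (cop b)"
    by (simp add: conv_def \<phi> tensor_lift_fun_sum)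
  also have "\<dots> = \<phi> i j (counit b *\<^sub>C 1)"
    using clinear_tensor_lift[OF \<phi>(1), of i j "\<lambda>x y. S x * y" "cop b"]
    by (simp add: antipode_left)
  finally show ?thesis
    by (simp add: clinear_scaleC[OF \<phi>(1)] \<phi>(3) scaleC_complex)
qed

text \<open>The antipode composed with a representation is its convolution inverse, and an inverse is
  unique; a right inverse therefore has to be \<open>\<phi> \<circ> S\<close>. This is how \<open>\<phi> \<circ> S\<close> is
  recognized for a tensor product \<open>\<phi>\<close>.\<close>
lemma matrix_hom_antipode_unique:
  assumes "matrix_hom \<phi>" and H: "\<And>i j. clinear (H i j)"
    and inv: "\<And>i j b. (\<Sum>k\<in>UNIV. conv cop (\<phi> i k) (H k j) b) = of_bool (i = j) * counit b"
  shows "H i j b = \<phi> i j (S b)"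
proof -
  note \<phi> = matrix_homD[OF assms(1)]
  have \<phi>S: "clinear (\<phi> i j \<circ> S)" for i j
    using clinear_comp[OF S_linear \<phi>(1)] by (simp add: o_def)
  have "H i j b = (\<Sum>k\<in>UNIV. of_bool (i = k) * conv cop counit (H k j) b)"
    by (simp add: conv_counit_left H)
  also have "\<dots> = (\<Sum>k\<in>UNIV. conv cop (\<lambda>b. \<Sum>l\<in>UNIV. conv cop (\<phi> i l \<circ> S) (\<phi> l k) b) (H k j) b)"
    by (simp only: matrix_hom_antipode_left[OF assms(1)] conv_scale_left)
  also have "\<dots> = (\<Sum>k\<in>UNIV. \<Sum>l\<in>UNIV. conv cop (\<phi> i l \<circ> S) (conv cop (\<phi> l k) (H k j)) b)"
    unfolding conv_sum_left by (simp add: conv_assoc[OF \<phi>S \<phi>(1) H])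
  also have "\<dots> = (\<Sum>l\<in>UNIV. conv cop (\<phi> i l \<circ> S) (\<lambda>b. \<Sum>k\<in>UNIV. conv cop (\<phi> l k) (H k j) b) b)"
    unfolding conv_sum_right by (rule sum.swap)
  also have "\<dots> = (\<Sum>l\<in>UNIV. of_bool (l = j) * (\<phi> i l \<circ> S) b)"
    by (simp add: inv conv_scale_right conv_counit_right[OF \<phi>S])
  also have "\<dots> = \<phi> i j (S b)" by simp
  finally show ?thesis .
qed

section \<open>Corepresentations, bicovariance and the braid relation\<close>

definition corepresentation :: "('i::finite \<Rightarrow> 'i \<Rightarrow> 'a) \<Rightarrow> bool"
  where "corepresentation u \<longleftrightarrow> (\<forall>i j. cop (u i j) = (\<Sum>k\<in>UNIV. u i k \<otimes> u k j))"

definition bicovariant :: "('i::finite \<Rightarrow> 'i \<Rightarrow> 'a) \<Rightarrow> ('i \<Rightarrow> 'i \<Rightarrow> 'a \<Rightarrow> complex) \<Rightarrow> bool"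
  where "bicovariant u \<phi> \<longleftrightarrow> (\<forall>i j b.
    (\<Sum>k\<in>UNIV. u i k * conv_left cop (\<phi> k j) b) = (\<Sum>k\<in>UNIV. conv_right cop b (\<phi> i k) * u k j))"

lemma conv_left_base_change:
  "conv_left cop (functional_base_change P P' \<phi> L K) b
    = base_change P P' (\<lambda>x y. conv_left cop (\<phi> x y) b) L K"
  by (simp only: conv_left_def base_change_def complex_vector.scale_sum_left tensor_lift_fun_sum
      scaleC_complex scaleC_scaleC[symmetric] tensor_lift_fun_scaleC)

lemma conv_right_base_change:
  "conv_right cop b (functional_base_change P P' \<phi> L K)
    = base_change P P' (\<lambda>x y. conv_right cop b (\<phi> x y)) L K"
  by (simp only: conv_right_def base_change_def complex_vector.scale_sum_left tensor_lift_fun_sum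
      scaleC_complex scaleC_scaleC[symmetric] tensor_lift_fun_scaleC)

lemma corepresentation_base_change:
  assumes "mutually_inverse P P'" "corepresentation u"
  shows "corepresentation (base_change P P' u)"
  using assms(2) base_change_matrix_mult[OF assms(1) cbilinear_tensor, of u _ u]
  by (simp add: corepresentation_def clinear_base_change[OF cop_linear])

lemma bicovariant_base_change:
  assumes "mutually_inverse P P'" "bicovariant u \<phi>"
  shows "bicovariant (base_change P P' u) (functional_base_change P P' \<phi>)"
  using assms(2)
  by (simp add: bicovariant_def conv_left_base_change conv_right_base_change
      base_change_matrix_mult[OF assms(1) cbilinear_times])

text \<open>The tensor product of two representations. The second factor comes first in the convolution,
  opposite to the order of the factors in \<open>corep_tensor\<close>: with this choice \<open>bicovariant_tensor\<close>
  holds.\<close>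
definition conv_tensor ::
  "('i \<Rightarrow> 'i \<Rightarrow> 'a \<Rightarrow> complex) \<Rightarrow> ('j \<Rightarrow> 'j \<Rightarrow> 'a \<Rightarrow> complex) \<Rightarrow> 'i \<times> 'j \<Rightarrow> 'i \<times> 'j \<Rightarrow> 'a \<Rightarrow> complex"
  where "conv_tensor \<phi> \<psi> x y = conv cop (\<psi> (snd x) (snd y)) (\<phi> (fst x) (fst y))"

definition corep_tensor ::
  "('i \<Rightarrow> 'i \<Rightarrow> 'a) \<Rightarrow> ('j \<Rightarrow> 'j \<Rightarrow> 'a) \<Rightarrow> 'i \<times> 'j \<Rightarrow> 'i \<times> 'j \<Rightarrow> 'a"
  where "corep_tensor u w x y = u (fst x) (fst y) * w (snd x) (snd y)"

lemma matrix_hom_conv_tensor: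
  fixes \<phi> :: "'i::finite \<Rightarrow> 'i \<Rightarrow> 'a \<Rightarrow> complex" and \<psi> :: "'j::finite \<Rightarrow> 'j \<Rightarrow> 'a \<Rightarrow> complex"
  assumes "matrix_hom \<phi>" "matrix_hom \<psi>"
  shows "matrix_hom (conv_tensor \<phi> \<psi>)"
  unfolding matrix_hom_def
proof (intro conjI allI)
  note \<phi> = matrix_homD[OF assms(1)] and \<psi> = matrix_homD[OF assms(2)]
  show "clinear (conv_tensor \<phi> \<psi> x y)" for x y
    unfolding conv_tensor_def by (rule conv_linear[OF \<psi>(1) \<phi>(1)])
  show "conv_tensor \<phi> \<psi> x y 1 = of_bool (x = y)" for x y
    by (auto simp add: conv_tensor_def conv_def cop_one tensor_lift_pure[OF cbilinear_functionals]
        \<phi> \<psi> prod_eq_iff)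
  fix x y :: "'i \<times> 'j" and b c
  have "(\<Sum>z\<in>UNIV. conv_tensor \<phi> \<psi> x z b * conv_tensor \<phi> \<psi> z y c)
    = (\<Sum>k\<in>UNIV. \<Sum>l\<in>UNIV. conv cop (\<psi> (snd x) l) (\<phi> (fst x) k) b
        * conv cop (\<psi> l (snd y)) (\<phi> k (fst y)) c)"
    by (simp add: sum_UNIV_prod conv_tensor_def)
  also have "\<dots> = tensor_lift (\<lambda>p q. tensor_lift (\<lambda>p' q'. \<Sum>k\<in>UNIV. \<Sum>l\<in>UNIV.
      \<psi> (snd x) l p * \<phi> (fst x) k q * (\<psi> l (snd y) p' * \<phi> k (fst y) q')) (cop c)) (cop b)"
  proof -
    have "conv cop g h b * conv cop g' h' c
      = tensor_lift (\<lambda>p q. tensor_lift (\<lambda>p' q'. g p * h q * (g' p' * h' q')) (cop c)) (cop b)"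
      for g h g' h' :: "'a \<Rightarrow> complex"
    proof -
      have "conv cop g h b * conv cop g' h' c
        = tensor_lift (\<lambda>p q. conv cop g' h' c *\<^sub>C (g p * h q)) (cop b)"
        using tensor_lift_fun_scaleC[of "conv cop g' h' c" "\<lambda>p q. g p * h q" "cop b"]
        by (simp add: scaleC_complex conv_def[of cop g h b])
      also have "\<dots> = tensor_lift (\<lambda>p q. (g p * h q) *\<^sub>C conv cop g' h' c) (cop b)"
        by (simp only: scaleC_complex mult.commute)
      finally show ?thesis
        by (simp only: conv_def[of cop g' h' c] tensor_lift_fun_scaleC[symmetric])
          (simp only: scaleC_complex)
    qed
    then show ?thesis by (simp only: tensor_lift_fun_sum)
  qed
  also have "\<dots> = conv_tensor \<phi> \<psi> x y (b * c)"
    unfolding conv_tensor_def conv_mult[OF \<psi>(1) \<phi>(1)] \<phi>(2) \<psi>(2) sum_product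
    by (subst sum.swap) (simp only: ac_simps)
  finally show "conv_tensor \<phi> \<psi> x y (b * c)
    = (\<Sum>z\<in>UNIV. conv_tensor \<phi> \<psi> x z b * conv_tensor \<phi> \<psi> z y c)" by simp
qed

lemma corepresentation_tensor:
  assumes "corepresentation u" "corepresentation w"
  shows "corepresentation (corep_tensor u w)"
  using assms
  by (simp add: corepresentation_def corep_tensor_def cop_mult tensor_mult_tensor sum_UNIV_prod
      cbilinear_sum[OF cbilinear_tensor_mult])

text \<open>The elements \<open>w\<close> move past the inner functionals \<open>\<psi>\<close> first, turning a left into a right
  convolution; left and right convolutions commute, and then the elements \<open>u\<close> move past \<open>\<phi>\<close>.\<close>
lemma bicovariant_tensor:
  fixes \<phi> :: "'i::finite \<Rightarrow> 'i \<Rightarrow> 'a \<Rightarrow> complex" and \<psi> :: "'j::finite \<Rightarrow> 'j \<Rightarrow> 'a \<Rightarrow> complex"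
  assumes "matrix_hom \<phi>" "matrix_hom \<psi>" "bicovariant u \<phi>" "bicovariant w \<psi>"
  shows "bicovariant (corep_tensor u w) (conv_tensor \<phi> \<psi>)"
  unfolding bicovariant_def
proof (intro allI)
  note \<phi> = matrix_homD(1)[OF assms(1)] and \<psi> = matrix_homD(1)[OF assms(2)]
  fix x y :: "'i \<times> 'j" and b
  obtain x1 x2 y1 y2 where xy: "x = (x1, x2)" "y = (y1, y2)" by fastforce
  have "(\<Sum>z\<in>UNIV. corep_tensor u w x z * conv_left cop (conv_tensor \<phi> \<psi> z y) b)
    = (\<Sum>k\<in>UNIV. u x1 k * (\<Sum>l\<in>UNIV. w x2 l * conv_left cop (\<psi> l y2) (conv_left cop (\<phi> k y1) b)))"
    by (simp add: sum_UNIV_prod xy corep_tensor_def conv_tensor_def conv_left_conv \<phi> \<psi>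
        sum_distrib_left mult.assoc)
  also have "\<dots> = (\<Sum>k\<in>UNIV. \<Sum>l\<in>UNIV. u x1 k * conv_left cop (\<phi> k y1) (conv_right cop b (\<psi> x2 l)) * w l y2)"
    using assms(4)
    by (simp add: bicovariant_def conv_left_right_commute \<phi> \<psi> sum_distrib_left mult.assoc)
  also have "\<dots> = (\<Sum>l\<in>UNIV. (\<Sum>k\<in>UNIV. u x1 k * conv_left cop (\<phi> k y1) (conv_right cop b (\<psi> x2 l))) * w l y2)"
    by (subst sum.swap) (simp add: sum_distrib_right)
  also have "\<dots> = (\<Sum>l\<in>UNIV. \<Sum>k\<in>UNIV. conv_right cop b (conv cop (\<psi> x2 l) (\<phi> x1 k)) * (u k y1 * w l y2))"
    using assms(3) by (simp add: bicovariant_def conv_right_conv \<phi> \<psi> sum_distrib_right mult.assoc)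
  also have "\<dots> = (\<Sum>k\<in>UNIV. \<Sum>l\<in>UNIV. conv_right cop b (conv cop (\<psi> x2 l) (\<phi> x1 k)) * (u k y1 * w l y2))"
    by (rule sum.swap)
  also have "\<dots> = (\<Sum>z\<in>UNIV. conv_right cop b (conv_tensor \<phi> \<psi> x z) * corep_tensor u w z y)"
    by (simp add: sum_UNIV_prod xy corep_tensor_def conv_tensor_def)
  finally show "(\<Sum>z\<in>UNIV. corep_tensor u w x z * conv_left cop (conv_tensor \<phi> \<psi> z y) b)
    = (\<Sum>z\<in>UNIV. conv_right cop b (conv_tensor \<phi> \<psi> x z) * corep_tensor u w z y)" .
qed

text \<open>Bicovariance evaluated at a matrix entry of the corepresentation is an exchange relation
  between products of two entries, with coefficients \<open>\<phi> k m (u j n)\<close>. Applying the representation to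
  it gives the braid relation for these coefficients.\<close>
lemma braid_identity:
  assumes "matrix_hom \<phi>" "corepresentation u" "bicovariant u \<phi>"
  shows "(\<Sum>k\<in>UNIV. \<Sum>j\<in>UNIV. \<Sum>z\<in>UNIV. \<phi> x z (u l k) * \<phi> z y (u p j) * \<phi> k m (u j n))
    = (\<Sum>j\<in>UNIV. \<Sum>k\<in>UNIV. \<Sum>z\<in>UNIV. \<phi> l k (u p j) * \<phi> x z (u j n) * \<phi> z y (u k m))"
proof -
  note \<phi> = matrix_homD[OF assms(1)]
  have cl: "conv_left cop (\<phi> k m) (u p n) = (\<Sum>j\<in>UNIV. \<phi> k m (u j n) *\<^sub>C u p j)"
    and cr: "conv_right cop (u p n) (\<phi> l k) = (\<Sum>j\<in>UNIV. \<phi> l k (u p j) *\<^sub>C u j n)" for k l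
  proof -
    have b1: "cbilinear (\<lambda>x y. \<phi> k m y *\<^sub>C x)" and b2: "cbilinear (\<lambda>x y. \<phi> l k x *\<^sub>C y)"
      using \<phi>(1) by (simp_all add: cbilinear_iff clinear_functional_iff scaleC_add_left
        scaleC_add_right scaleC_scaleC mult.commute)
    show "conv_left cop (\<phi> k m) (u p n) = (\<Sum>j\<in>UNIV. \<phi> k m (u j n) *\<^sub>C u p j)"
      using assms(2) by (simp add: conv_left_def corepresentation_def
          clinear_sum[OF tensor_lift_linear[OF b1]] tensor_lift_pure[OF b1])
    show "conv_right cop (u p n) (\<phi> l k) = (\<Sum>j\<in>UNIV. \<phi> l k (u p j) *\<^sub>C u j n)"
      using assms(2) by (simp add: conv_right_def corepresentation_def
          clinear_sum[OF tensor_lift_linear[OF b2]] tensor_lift_pure[OF b2])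
  qed
  have "(\<Sum>k\<in>UNIV. u l k * conv_left cop (\<phi> k m) (u p n))
    = (\<Sum>k\<in>UNIV. conv_right cop (u p n) (\<phi> l k) * u k m)"
    using assms(3) by (simp add: bicovariant_def)
  then have "(\<Sum>k\<in>UNIV. \<Sum>j\<in>UNIV. \<phi> k m (u j n) *\<^sub>C (u l k * u p j))
    = (\<Sum>k\<in>UNIV. \<Sum>j\<in>UNIV. \<phi> l k (u p j) *\<^sub>C (u j n * u k m))"
    by (simp add: cl cr sum_distrib_left sum_distrib_right mult_scaleC_left mult_scaleC_right)
  then have "\<phi> x y (\<Sum>k\<in>UNIV. \<Sum>j\<in>UNIV. \<phi> k m (u j n) *\<^sub>C (u l k * u p j))
    = \<phi> x y (\<Sum>k\<in>UNIV. \<Sum>j\<in>UNIV. \<phi> l k (u p j) *\<^sub>C (u j n * u k m))"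
    by simp
  then have "(\<Sum>k\<in>UNIV. \<Sum>j\<in>UNIV. \<Sum>z\<in>UNIV. \<phi> x z (u l k) * \<phi> z y (u p j) * \<phi> k m (u j n))
    = (\<Sum>k\<in>UNIV. \<Sum>j\<in>UNIV. \<Sum>z\<in>UNIV. \<phi> l k (u p j) * \<phi> x z (u j n) * \<phi> z y (u k m))"
    by (simp add: clinear_sum[OF \<phi>(1)] clinear_scaleC[OF \<phi>(1)] \<phi>(2) scaleC_complex
        sum_distrib_left sum_distrib_right ac_simps)
  also have "\<dots> = (\<Sum>j\<in>UNIV. \<Sum>k\<in>UNIV. \<Sum>z\<in>UNIV. \<phi> l k (u p j) * \<phi> x z (u j n) * \<phi> z y (u k m))"
    by (rule sum.swap)
  finally show ?thesis .
qed

lemma leg_entries: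
  "leg12 A $ (n, m, y) $ (x, l, p) = A $ (n, m) $ (x, l) * of_bool (y = p)"
  "leg23 A $ (n, m, y) $ (x, l, p) = of_bool (n = x) * A $ (m, y) $ (l, p)"
  by (simp_all add: leg12_def leg23_def)

lemma leg12_leg23:
  "(leg12 A ** leg23 B) $ (n, m, y) $ (x, l, p) = (\<Sum>j\<in>UNIV. A $ (n, m) $ (x, j) * B $ (j, y) $ (l, p))"
  unfolding matrix_matrix_mult_def
  by (simp add: sum_UNIV_prod leg_entries of_bool_def if_distrib[of "\<lambda>c. _ * c"]
      if_distrib[of "\<lambda>c. c * _"] cong: if_cong)
    (subst sum.swap, simp)

lemma R_Lorentz_braid:
  assumes "matrix_hom \<phi>" "corepresentation u" "bicovariant u \<phi>"
  defines "R \<equiv> R_Lorentz \<phi> u"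
  shows "leg12 R ** leg23 R ** leg12 R = leg23 R ** leg12 R ** leg23 R"
proof -
  have R: "R $ (n, m) $ (k, l) = \<phi> k m (u l n)" for n m k l
    by (simp add: R_def R_Lorentz_def)
  have l: "(leg12 R ** leg23 R ** leg12 R) $ (n, m, y) $ (x, l, p)
    = (\<Sum>k\<in>UNIV. \<Sum>j\<in>UNIV. \<Sum>z\<in>UNIV. \<phi> x z (u l k) * \<phi> z y (u p j) * \<phi> k m (u j n))"
    for n m y x l p
  proof -
    have "(leg12 R ** leg23 R ** leg12 R) $ (n, m, y) $ (x, l, p)
      = (\<Sum>q\<in>UNIV. (leg12 R ** leg23 R) $ (n, m, y) $ q * leg12 R $ q $ (x, l, p))"
      by (simp add: matrix_matrix_mult_def)
    also have "\<dots> = (\<Sum>k\<in>UNIV. \<Sum>z\<in>UNIV. \<Sum>j\<in>UNIV. \<phi> x z (u l k) * \<phi> z y (u p j) * \<phi> k m (u j n))"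
    proof -
      have delta: "(\<Sum>t\<in>UNIV. g t * (c * of_bool (t = p))) = g p * c"
        for g :: "4 \<Rightarrow> complex" and c
        by (simp add: of_bool_def if_distrib[of "\<lambda>c. _ * c"] cong: if_cong)
      show ?thesis
        by (simp only: sum_UNIV_prod leg_entries delta)
          (simp only: leg12_leg23 R sum_distrib_left sum_distrib_right ac_simps)
    qed
    also have "\<dots> = (\<Sum>k\<in>UNIV. \<Sum>j\<in>UNIV. \<Sum>z\<in>UNIV. \<phi> x z (u l k) * \<phi> z y (u p j) * \<phi> k m (u j n))"
      by (rule sum.cong[OF refl], rule sum.swap)
    finally show ?thesis .
  qed
  have r: "(leg23 R ** leg12 R ** leg23 R) $ (n, m, y) $ (x, l, p)
    = (\<Sum>j\<in>UNIV. \<Sum>k\<in>UNIV. \<Sum>z\<in>UNIV. \<phi> l k (u p j) * \<phi> x z (u j n) * \<phi> z y (u k m))"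
    for n m y x l p
  proof -
    have "(leg23 R ** (leg12 R ** leg23 R)) $ (n, m, y) $ (x, l, p)
      = (\<Sum>q\<in>UNIV. leg23 R $ (n, m, y) $ q * (leg12 R ** leg23 R) $ q $ (x, l, p))"
      by (simp add: matrix_matrix_mult_def)
    also have "\<dots> = (\<Sum>z\<in>UNIV. \<Sum>k\<in>UNIV. \<Sum>j\<in>UNIV.
        \<phi> l k (u p j) * \<phi> x z (u j n) * \<phi> z y (u k m))"
    proof -
      have delta: "(\<Sum>q\<in>UNIV. \<Sum>z\<in>UNIV. \<Sum>k\<in>UNIV. of_bool (n = q) * c z k * g q z k)
        = (\<Sum>z\<in>UNIV. \<Sum>k\<in>UNIV. c z k * g n z k)"
        for c :: "4 \<Rightarrow> 4 \<Rightarrow> complex" and g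
      proof -
        have "(\<Sum>q\<in>UNIV. \<Sum>z\<in>UNIV. \<Sum>k\<in>UNIV. of_bool (n = q) * c z k * g q z k)
          = (\<Sum>q\<in>UNIV. if n = q then \<Sum>z\<in>UNIV. \<Sum>k\<in>UNIV. c z k * g q z k else 0)"
          by (rule sum.cong) auto
        then show ?thesis by simp
      qed
      show ?thesis
        by (simp only: sum_UNIV_prod leg_entries delta)
          (simp only: leg12_leg23 R sum_distrib_left sum_distrib_right ac_simps)
    qed
    also have "\<dots> = (\<Sum>z\<in>UNIV. \<Sum>j\<in>UNIV. \<Sum>k\<in>UNIV.
        \<phi> l k (u p j) * \<phi> x z (u j n) * \<phi> z y (u k m))"
      by (rule sum.cong[OF refl], rule sum.swap)
    also have "\<dots> = (\<Sum>j\<in>UNIV. \<Sum>z\<in>UNIV. \<Sum>k\<in>UNIV.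
        \<phi> l k (u p j) * \<phi> x z (u j n) * \<phi> z y (u k m))"
      by (rule sum.swap)
    also have "\<dots> = (\<Sum>j\<in>UNIV. \<Sum>k\<in>UNIV. \<Sum>z\<in>UNIV.
        \<phi> l k (u p j) * \<phi> x z (u j n) * \<phi> z y (u k m))"
      by (rule sum.cong[OF refl], rule sum.swap)
    finally show ?thesis by (simp add: matrix_mul_assoc)
  qed
  show ?thesis
    by (simp add: vec_eq_iff split_paired_all l r braid_identity[OF assms(1-3)])
qed

end

section \<open>Matrices on tensor powers\<close>

definition kron :: "complex^'n^'m \<Rightarrow> complex^'l^'k \<Rightarrow> complex^('n \<times> 'l)^('m \<times> 'k)"
  where "kron A B = (\<chi> p q. A $ fst p $ fst q * B $ snd p $ snd q)"

lemma kron_entry: "kron A B $ x $ y = A $ fst x $ fst y * B $ snd x $ snd y"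
  by (simp add: kron_def)

lemma kron_mult: "kron A B ** kron C D = kron (A ** C) (B ** D)"
  by (simp add: vec_eq_iff kron_def matrix_matrix_mult_def sum_UNIV_prod sum_product ac_simps)

lemma kron_mat_1: "kron (mat 1) (mat 1) = mat 1"
  by (auto simp: vec_eq_iff kron_def mat_def)

text \<open>The operator \<open>A\<close> acting on the two inner strands of four, which are grouped in two pairs.\<close>
definition middle :: "complex^('j::finite \<times> 'k::finite)^('j \<times> 'k) \<Rightarrow>
    complex^(('i::finite \<times> 'j) \<times> ('k \<times> 'l::finite))^(('i \<times> 'j) \<times> ('k \<times> 'l))"
  where "middle A = (\<chi> p q. of_bool (fst (fst p) = fst (fst q) \<and> snd (snd p) = snd (snd q))
    * A $ (snd (fst p), fst (snd p)) $ (snd (fst q), fst (snd q)))"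

lemma middle_mult_left:
  fixes B :: "complex^'n^(('i::finite \<times> 'j::finite) \<times> ('k::finite \<times> 'l::finite))"
  shows "(middle A ** B) $ ((v2, v1), (y2, y1)) $ q
    = (\<Sum>z\<in>UNIV. \<Sum>t\<in>UNIV. A $ (v1, y2) $ (z, t) * B $ ((v2, z), (t, y1)) $ q)"
proof -
  have "(middle A ** B) $ ((v2, v1), (y2, y1)) $ q
    = (\<Sum>x2\<in>UNIV. \<Sum>z\<in>UNIV. \<Sum>t\<in>UNIV. \<Sum>u1\<in>UNIV. if y1 = u1 then if v2 = x2 then
        A $ (v1, y2) $ (z, t) * B $ ((x2, z), (t, u1)) $ q else 0 else 0)"
    by (simp only: matrix_matrix_mult_def middle_def sum_UNIV_prod vec_lambda_beta fst_conv snd_conv)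
      (intro sum.cong refl, simp)
  also have "\<dots> = (\<Sum>x2\<in>UNIV. if v2 = x2 then \<Sum>z\<in>UNIV. \<Sum>t\<in>UNIV.
        A $ (v1, y2) $ (z, t) * B $ ((x2, z), (t, y1)) $ q else 0)"
    by (intro sum.cong refl) auto
  finally show ?thesis by simp
qed

lemma middle_mult_right:
  fixes B :: "complex^(('i::finite \<times> 'j::finite) \<times> ('k::finite \<times> 'l::finite))^'n"
  shows "(B ** middle A) $ p $ ((x2, x1), (u2, u1))
    = (\<Sum>t\<in>UNIV. \<Sum>z\<in>UNIV. B $ p $ ((x2, t), (z, u1)) * A $ (t, z) $ (x1, u2))"
proof -
  have "(B ** middle A) $ p $ ((x2, x1), (u2, u1))
    = (\<Sum>v2\<in>UNIV. \<Sum>t\<in>UNIV. \<Sum>z\<in>UNIV. \<Sum>y1\<in>UNIV. if y1 = u1 then if v2 = x2 then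
        B $ p $ ((v2, t), (z, y1)) * A $ (t, z) $ (x1, u2) else 0 else 0)"
    by (simp only: matrix_matrix_mult_def middle_def sum_UNIV_prod vec_lambda_beta fst_conv snd_conv)
      (intro sum.cong refl, simp)
  also have "\<dots> = (\<Sum>v2\<in>UNIV. if v2 = x2 then \<Sum>t\<in>UNIV. \<Sum>z\<in>UNIV.
        B $ p $ ((v2, t), (z, u1)) * A $ (t, z) $ (x1, u2) else 0)"
    by (intro sum.cong refl) auto
  finally show ?thesis by simp
qed

lemma middle_mult:
  "middle A ** middle B = (middle (A ** B) ::
    complex^(('i::finite \<times> 'j::finite) \<times> ('k::finite \<times> 'l::finite))^(('i \<times> 'j) \<times> ('k \<times> 'l)))"
  (is "?L = ?R")
proof -
  have "?L $ ((v2, v1), (y2, y1)) $ ((x2, x1), (u2, u1)) = ?R $ ((v2, v1), (y2, y1)) $ ((x2, x1), (u2, u1))"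
    for v2 v1 y2 y1 x2 x1 u2 u1
    by (simp add: middle_mult_left) (simp add: middle_def matrix_matrix_mult_def sum_UNIV_prod)
  then show ?thesis by (simp add: vec_eq_iff split_paired_all)
qed

lemma middle_mat_1: "middle (mat 1) = mat 1"
  by (auto simp: vec_eq_iff middle_def mat_def)

lemma middle_vec:
  "(middle A *v w) $ ((v2, v1), (y2, y1))
    = (\<Sum>z\<in>UNIV. \<Sum>t\<in>UNIV. A $ (v1, y2) $ (z, t) * w $ ((v2, z), (t, y1)))"
  using middle_mult_left[of A "\<chi> p q. w $ p" v2 v1 y2 y1 "undefined :: unit"]
  by (simp add: matrix_matrix_mult_def matrix_vector_mult_def)

lemma transpose_middle: "transpose (middle A) = middle (transpose A)"
  by (auto simp: vec_eq_iff middle_def transpose_def)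

lemma transpose_kron: "transpose (kron A B) = kron (transpose A) (transpose B)"
  by (simp add: vec_eq_iff kron_def transpose_def)

lemma mat_mult_commute: "mat c ** A = (A :: complex^'n^'m) ** mat c"
  by (simp add: vec_eq_iff matrix_matrix_mult_def mat_def if_distrib[of "\<lambda>x. _ * x"]
      if_distrib[of "\<lambda>x. x * _"] mult.commute cong: if_cong)

lemma mat_mult_entry: "(mat c ** A) $ i $ j = c * (A :: complex^'n^'m) $ i $ j"
  by (simp add: matrix_matrix_mult_def mat_def if_distrib[of "\<lambda>x. x * _"] cong: if_cong)

lemma matrix_add_rdistrib: "(A + B) ** C = A ** C + B ** (C :: complex^'n^'m)"
  by (simp add: vec_eq_iff matrix_matrix_mult_def distrib_right sum.distrib)

lemma conjugate_add_mat:
  fixes T :: "complex^'n^'m" and T' :: "complex^'m^'n"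
  assumes "T ** T' = mat 1"
  shows "T ** Y ** T' + mat c = T ** (Y + mat c) ** T'"
proof -
  have "T ** mat c ** T' = mat c"
    by (simp only: mat_mult_commute[of c T, symmetric] matrix_mul_assoc[symmetric] assms matrix_mul_rid)
  then show ?thesis by (simp add: matrix_add_ldistrib matrix_add_rdistrib)
qed

text \<open>On the joint eigenspaces of \<open>J1\<close> and \<open>J2\<close> the operator \<open>Y\<close> is multiplication by \<open>1\<close>, \<open>- c\<close>,
  \<open>- d\<close> or \<open>c * d = 1\<close>. The computation expresses this in terms of the vectors
  \<open>J1 w\<close>, \<open>J2 w\<close> and \<open>J1 (J2 w)\<close>.\<close>
lemma commuting_idempotents_cubic:
  fixes J1 J2 :: "complex^'n^'n"
  assumes "J1 ** J1 = J1" "J2 ** J2 = J2" "J1 ** J2 = J2 ** J1" and cd: "c * d = 1"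
    and Y: "Y = (mat 1 - mat (1 + c) ** J1) ** (mat 1 - mat (1 + d) ** J2)"
  shows "(Y + mat c) ** (Y + mat d) ** (Y - mat 1) = 0"
proof -
  let ?K = "J1 ** J2"
  have scale: "mat k *v w = k *s w" for k and w :: "complex^'n"
    by (simp add: vec_eq_iff matrix_vector_mult_def mat_def if_distrib[of "\<lambda>x. x * _"] cong: if_cong)
  have cdx: "c * (d * x) = x" "d * (c * x) = x" "c * (x * d) = x" "d * (x * c) = x" for x :: complex
  proof -
    have "c * (d * x) = (c * d) * x" by (simp only: ac_simps)
    then show *: "c * (d * x) = x" using cd by simp
    show "d * (c * x) = x" "c * (x * d) = x" "d * (x * c) = x"
      using * by (simp_all only: ac_simps)
  qed
  note simps = matrix_vector_mult_add_rdistrib matrix_vector_right_distrib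
    matrix_vector_mult_diff_rdistrib matrix_vector_mult_diff_distrib vector_scalar_commute
    matrix_vector_mul_assoc[symmetric] scale
  have J: "J1 *v (J1 *v w) = J1 *v w" "J2 *v (J2 *v w) = J2 *v w" "J2 *v (J1 *v w) = J1 *v (J2 *v w)"
    for w :: "complex^'n"
    by (simp_all add: matrix_vector_mul_assoc assms)
  have "((Y + mat c) ** (Y + mat d) ** (Y - mat 1)) *v w = 0" for w
  proof -
    note act = Y simps vec.scale_one
    define A B C where "A = J1 *v w" and "B = J2 *v w" and "C = J1 *v (J2 *v w)"
    have JJ: "J1 *v A = A" "J2 *v A = C" "J1 *v B = C" "J2 *v B = B" "J1 *v C = C" "J2 *v C = C"
      by (simp_all add: A_def B_def C_def J)
    have Yw: "Y *v w - w = - (1 + c) *s A - (1 + d) *s B + ((1 + c) * (1 + d)) *s C"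
      by (simp only: act A_def[symmetric] B_def[symmetric]
          C_def[folded B_def, symmetric])
        (simp add: vec_eq_iff algebra_simps)
    have YA: "Y *v A = - c *s A + (c + 1) *s C"
      by (simp only: act JJ) (simp add: vec_eq_iff algebra_simps cdx cd)
    have YB: "Y *v B = - d *s B + (d + 1) *s C"
      by (simp only: act JJ) (simp add: vec_eq_iff algebra_simps cdx cd)
    have YC: "Y *v C = C"
      by (simp only: act JJ) (simp add: vec_eq_iff algebra_simps cdx cd)
    have "((Y + mat c) ** (Y + mat d) ** (Y - mat 1)) *v w
      = (Y + mat c) *v ((Y + mat d) *v (Y *v w - w))"
      by (simp only: simps vec.scale_one)
    also have "\<dots> = 0"
      unfolding Yw by (simp only: simps YA YB YC) (simp add: vec_eq_iff algebra_simps cdx cd)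
    finally show ?thesis .
  qed
  then show ?thesis by (simp add: matrix_eq)
qed

section \<open>Spinor metric and the spinor braiding\<close>

lemma flip_flip [simp]: "flip (flip s) = s"
  by (cases s) simp_all

lemma delta_sum: "(\<Sum>\<beta>\<in>UNIV. of_bool (\<alpha> = \<beta>) * g \<beta>) = g (\<alpha> :: 2)"
  "(\<Sum>\<beta>\<in>UNIV. of_bool (\<beta> = \<alpha>) * g \<beta>) = g \<alpha>" for g :: "2 \<Rightarrow> complex"
  by (simp_all add: of_bool_def if_distrib[of "\<lambda>c. c * _"] cong: if_cong)

context spinor_metric
begin

abbreviation "lo \<equiv> eps_lo eps"
abbreviation "up \<equiv> eps_up eps"
abbreviation "p \<equiv> a_pow a"
abbreviation "h \<equiv> a_half_pow a"

lemma eps_inverse: "eps ** matrix_inv eps = mat 1" "matrix_inv eps ** eps = mat 1"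
proof -
  have "\<exists>B. eps ** B = mat 1 \<and> B ** eps = mat 1"
    using eps_invertible by (simp add: invertible_def)
  then have "eps ** matrix_inv eps = mat 1 \<and> matrix_inv eps ** eps = mat 1"
    unfolding matrix_inv_def by (rule someI_ex)
  then show "eps ** matrix_inv eps = mat 1" "matrix_inv eps ** eps = mat 1" by auto
qed

lemma lo_up: "(\<Sum>\<gamma>\<in>UNIV. lo \<alpha> \<gamma> * up \<gamma> \<beta>) = of_bool (\<alpha> = \<beta>)"
  using arg_cong[OF eps_inverse(1), of "\<lambda>A. A $ \<alpha> $ \<beta>"]
  by (simp add: matrix_matrix_mult_def mat_def eps_lo_def eps_up_def)

lemma up_lo: "(\<Sum>\<gamma>\<in>UNIV. up \<alpha> \<gamma> * lo \<gamma> \<beta>) = of_bool (\<alpha> = \<beta>)"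
  using arg_cong[OF eps_inverse(2), of "\<lambda>A. A $ \<alpha> $ \<beta>"]
  by (simp add: matrix_matrix_mult_def mat_def eps_lo_def eps_up_def)

lemma up_trace: "(\<Sum>\<alpha>\<in>UNIV. \<Sum>\<beta>\<in>UNIV. up \<alpha> \<beta> * lo \<alpha> \<beta>) = - Q_of a"
  using a_eps by (simp add: Q_of_def add_eq_0_iff)

text \<open>The reality condition on the spinor metric turns \<open>a + inverse a\<close> into a sum of squares.\<close>
lemma a_pos: "a > 0"
proof -
  have "complex_of_real (a + inverse a) = (\<Sum>\<alpha>\<in>UNIV. \<Sum>\<beta>\<in>UNIV. cnj (lo \<alpha> \<beta>) * lo \<alpha> \<beta>)"
    using a_eps eps_lo_dot_eq unfolding eps_lo_dot_def
    by (simp add: sum_negf add_eq_0_iff)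
  also have "\<dots> = complex_of_real (\<Sum>\<alpha>\<in>UNIV. \<Sum>\<beta>\<in>UNIV. (cmod (lo \<alpha> \<beta>))\<^sup>2)"
    by (simp add: complex_norm_square mult.commute del: of_real_power)
  finally have "a + inverse a = (\<Sum>\<alpha>\<in>UNIV. \<Sum>\<beta>\<in>UNIV. (cmod (lo \<alpha> \<beta>))\<^sup>2)"
    by (simp only: of_real_eq_iff)
  also have "\<dots> \<ge> 0" by (simp add: sum_nonneg)
  finally have "a + inverse a \<ge> 0" .
  moreover have "a < 0 \<Longrightarrow> inverse a < 0" by simp
  ultimately show ?thesis using a_nonzero by linarith
qed

lemma p_flip: "p s * p (flip s) = 1"
  using a_pos by (cases s) (simp_all add: a_pow_def flip: of_real_mult)

lemma h_flip: "h s * h (flip s) = 1"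
  using a_pos by (cases s) (simp_all add: a_half_pow_def flip: of_real_mult)

lemma h_square: "h s * h s = p s"
  using a_pos by (cases s) (simp_all add: a_half_pow_def a_pow_def flip: of_real_mult inverse_mult_distrib)

lemma h_flip_p: "h (flip s) * p s = h s"
  by (metis h_flip h_square mult.commute mult.assoc mult.right_neutral)

lemma h_p_flip: "h s * p (flip s) = h (flip s)"
  using h_flip_p[of "flip s"] by simp

lemma Q_eq: "Q_of a = p s + p (flip s)"
  by (cases s) (simp_all add: Q_of_def a_pow_def)

lemma Q_nonzero: "Q_of a \<noteq> 0"
proof -
  have "a + inverse a > 0" using a_pos by (simp add: add_pos_pos)
  then show ?thesis unfolding Q_of_def by (metis of_real_eq_0_iff less_irrefl)
qed

text \<open>Up to a scalar and a change of basis, \<open>cup\<close> is the metric with upper and \<open>cap\<close> the metric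
  with lower indices. The pairs are ordered as (undotted, dotted). As diagrams they are two parallel
  arcs whose inner ends are braided, see \<open>middle_up_vec\<close> and \<open>middle_lo_vec\<close>.\<close>
definition cup :: "pm \<Rightarrow> complex^(2 \<times> 2)^(2 \<times> 2)"
  where "cup s = (\<chi> v y. up (fst v) (snd v) * up (fst y) (snd y)
    + p s * up (snd v) (fst y) * up (fst v) (snd y))"

definition cap :: "pm \<Rightarrow> complex^(2 \<times> 2)^(2 \<times> 2)"
  where "cap s = (\<chi> x u. lo (fst x) (snd x) * lo (fst u) (snd u)
    + p (flip s) * lo (snd x) (fst u) * lo (fst x) (snd u))"

text \<open>Expanding the product gives four terms. Three of them are proportional to
  \<open>up v2 v1 * lo z2 z1\<close> and cancel because the trace of the spinor metric is
  \<open>- (p s + p (flip s))\<close>.\<close>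
lemma cup_cap: "cup s ** cap s = mat 1"
proof -
  have "(cup s ** cap s) $ (v2, v1) $ (z2, z1) = mat 1 $ (v2, v1) $ (z2, z1)" for v2 v1 z2 z1
  proof -
    have t2: "(\<Sum>y2\<in>UNIV. \<Sum>y1\<in>UNIV. up y2 y1 * lo y1 z2 * lo y2 z1) = lo z2 z1"
      by (simp only: sum_distrib_right[symmetric] up_lo delta_sum)
    have t3: "(\<Sum>y2\<in>UNIV. \<Sum>y1\<in>UNIV. up v1 y2 * lo y2 y1 * up v2 y1) = up v2 v1"
      by (subst sum.swap) (simp only: sum_distrib_right[symmetric] up_lo delta_sum)
    have t4: "(\<Sum>y2\<in>UNIV. \<Sum>y1\<in>UNIV. (up v1 y2 * lo y2 z1) * (up v2 y1 * lo y1 z2))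
        = of_bool (v1 = z1) * of_bool (v2 = z2)"
      by (simp only: sum_product[symmetric] up_lo)
    have "(cup s ** cap s) $ (v2, v1) $ (z2, z1) = (\<Sum>y2\<in>UNIV. \<Sum>y1\<in>UNIV.
        (up v2 v1 * up y2 y1 + p s * up v1 y2 * up v2 y1)
        * (lo y2 y1 * lo z2 z1 + p (flip s) * lo y1 z2 * lo y2 z1))"
      by (simp add: matrix_matrix_mult_def cup_def cap_def sum_UNIV_prod)
    also have "\<dots> = up v2 v1 * lo z2 z1 * (\<Sum>y2\<in>UNIV. \<Sum>y1\<in>UNIV. up y2 y1 * lo y2 y1)
      + p (flip s) * up v2 v1 * (\<Sum>y2\<in>UNIV. \<Sum>y1\<in>UNIV. up y2 y1 * lo y1 z2 * lo y2 z1)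
      + p s * lo z2 z1 * (\<Sum>y2\<in>UNIV. \<Sum>y1\<in>UNIV. up v1 y2 * lo y2 y1 * up v2 y1)
      + p s * p (flip s) * (\<Sum>y2\<in>UNIV. \<Sum>y1\<in>UNIV. (up v1 y2 * lo y2 z1) * (up v2 y1 * lo y1 z2))"
      by (simp add: sum_distrib_left sum.distrib[symmetric] algebra_simps)
    also have "\<dots> = of_bool (v1 = z1) * of_bool (v2 = z2)"
      by (simp only: t2 t3 t4 up_trace p_flip Q_eq[of s]) (simp add: algebra_simps)
    also have "\<dots> = mat 1 $ (v2, v1) $ (z2, z1)"
      by (auto simp: mat_def)
    finally show ?thesis .
  qed
  then show ?thesis by (simp add: vec_eq_iff split_paired_all)
qed

lemma cap_cup: "cap s ** cup s = mat 1"
  using cup_cap matrix_left_right_inverse by blast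

text \<open>The metric pairs a Pauli matrix with a barred one through a twist \<open>up \<alpha> \<nu> * lo \<gamma> \<nu>\<close> of each
  spinor index; applied to one argument of \<open>cup\<close> the twists only interchange its two arguments.
  This is the symmetry needed to identify the metric in \<open>metric_up_eq\<close>.\<close>
lemma cup_rotate:
  "(\<Sum>\<gamma>\<in>UNIV. \<Sum>\<xi>\<in>UNIV. (\<Sum>\<nu>\<in>UNIV. up \<alpha> \<nu> * lo \<gamma> \<nu>) * (\<Sum>\<nu>\<in>UNIV. up \<kappa> \<nu> * lo \<xi> \<nu>)
      * cup s $ (\<sigma>, \<tau>) $ (\<gamma>, \<xi>)) = cup s $ (\<alpha>, \<kappa>) $ (\<sigma>, \<tau>)"
proof -
  define D where "D \<alpha> \<gamma> = (\<Sum>\<nu>\<in>UNIV. up \<alpha> \<nu> * lo \<gamma> \<nu>)" for \<alpha> \<gamma>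
  have D: "(\<Sum>\<xi>\<in>UNIV. up \<gamma> \<xi> * D \<kappa> \<xi>) = up \<kappa> \<gamma>" for \<gamma> \<kappa>
  proof -
    have "(\<Sum>\<xi>\<in>UNIV. up \<gamma> \<xi> * D \<kappa> \<xi>) = (\<Sum>\<nu>\<in>UNIV. (\<Sum>\<xi>\<in>UNIV. up \<gamma> \<xi> * lo \<xi> \<nu>) * up \<kappa> \<nu>)"
      unfolding D_def sum_distrib_left sum_distrib_right
      by (subst sum.swap) (simp only: ac_simps)
    then show ?thesis by (simp only: up_lo delta_sum)
  qed
  have "(\<Sum>\<gamma>\<in>UNIV. \<Sum>\<xi>\<in>UNIV. D \<alpha> \<gamma> * D \<kappa> \<xi> * cup s $ (\<sigma>, \<tau>) $ (\<gamma>, \<xi>))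
    = up \<sigma> \<tau> * (\<Sum>\<gamma>\<in>UNIV. D \<alpha> \<gamma> * (\<Sum>\<xi>\<in>UNIV. up \<gamma> \<xi> * D \<kappa> \<xi>))
      + p s * ((\<Sum>\<gamma>\<in>UNIV. up \<tau> \<gamma> * D \<alpha> \<gamma>) * (\<Sum>\<xi>\<in>UNIV. up \<sigma> \<xi> * D \<kappa> \<xi>))"
    by (simp add: cup_def sum_product sum_distrib_left sum.distrib algebra_simps)
      (subst sum.swap, rule refl)
  also have "\<dots> = up \<sigma> \<tau> * (\<Sum>\<gamma>\<in>UNIV. D \<alpha> \<gamma> * up \<kappa> \<gamma>) + p s * (up \<alpha> \<tau> * up \<kappa> \<sigma>)"
    by (simp only: D)
  also have "(\<Sum>\<gamma>\<in>UNIV. D \<alpha> \<gamma> * up \<kappa> \<gamma>) = up \<alpha> \<kappa>"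
    using D[of \<kappa> \<alpha>] by (simp only: mult.commute)
  also have "up \<sigma> \<tau> * up \<alpha> \<kappa> + p s * (up \<alpha> \<tau> * up \<kappa> \<sigma>) = cup s $ (\<alpha>, \<kappa>) $ (\<sigma>, \<tau>)"
    by (simp add: cup_def)
  finally show ?thesis by (simp only: D_def)
qed

text \<open>This evaluates the mixed \<open>R\<close> matrix inside the barred Pauli matrices: up to normalization
  they are the Pauli matrices contracted with \<open>cup\<close>.\<close>
lemma R_ud_up:
  "(\<Sum>\<nu>\<in>UNIV. R_ud eps a (flip s) \<sigma> \<rho> \<gamma> \<nu> * up \<nu> \<alpha>)
    = h (flip s) * (\<Sum>\<tau>\<in>UNIV. lo \<rho> \<tau> * cup s $ (\<sigma>, \<tau>) $ (\<alpha>, \<gamma>))"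
proof -
  define T where "T = (\<Sum>\<mu>\<in>UNIV. lo \<rho> \<mu> * up \<sigma> \<mu>)"
  have R: "R_ud eps a (flip s) \<sigma> \<rho> \<gamma> \<nu>
    = h s * (lo \<rho> \<nu> * up \<sigma> \<gamma>) + h (flip s) * T * (\<Sum>\<kappa>\<in>UNIV. lo \<kappa> \<nu> * up \<kappa> \<gamma>)" for \<nu>
  proof -
    have "(\<Sum>\<mu>\<in>UNIV. \<Sum>\<kappa>\<in>UNIV. lo \<rho> \<mu> * R_mat eps a (flip s) \<sigma> \<mu> \<kappa> \<nu> * up \<kappa> \<gamma>)
      = (\<Sum>\<mu>\<in>UNIV. \<Sum>\<kappa>\<in>UNIV. of_bool (\<mu> = \<nu>) * (of_bool (\<sigma> = \<kappa>) * (lo \<rho> \<mu> * up \<kappa> \<gamma>))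
        + p (flip s) * ((lo \<rho> \<mu> * up \<sigma> \<mu>) * (lo \<kappa> \<nu> * up \<kappa> \<gamma>)))"
      by (simp only: R_mat_def algebra_simps)
    also have "\<dots> = (\<Sum>\<mu>\<in>UNIV. of_bool (\<mu> = \<nu>) * (\<Sum>\<kappa>\<in>UNIV. of_bool (\<sigma> = \<kappa>) * (lo \<rho> \<mu> * up \<kappa> \<gamma>)))
        + p (flip s) * (T * (\<Sum>\<kappa>\<in>UNIV. lo \<kappa> \<nu> * up \<kappa> \<gamma>))"
      unfolding T_def sum_product by (simp only: sum.distrib sum_distrib_left)
    finally have "(\<Sum>\<mu>\<in>UNIV. \<Sum>\<kappa>\<in>UNIV. lo \<rho> \<mu> * R_mat eps a (flip s) \<sigma> \<mu> \<kappa> \<nu> * up \<kappa> \<gamma>)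
      = lo \<rho> \<nu> * up \<sigma> \<gamma> + p (flip s) * (T * (\<Sum>\<kappa>\<in>UNIV. lo \<kappa> \<nu> * up \<kappa> \<gamma>))"
      by (simp only: delta_sum)
    then show ?thesis
      by (simp add: R_ud_def distrib_left h_p_flip[of s, symmetric] mult.assoc)
  qed
  have "(\<Sum>\<nu>\<in>UNIV. R_ud eps a (flip s) \<sigma> \<rho> \<gamma> \<nu> * up \<nu> \<alpha>)
    = h s * up \<sigma> \<gamma> * (\<Sum>\<nu>\<in>UNIV. lo \<rho> \<nu> * up \<nu> \<alpha>)
      + h (flip s) * T * (\<Sum>\<kappa>\<in>UNIV. (\<Sum>\<nu>\<in>UNIV. lo \<kappa> \<nu> * up \<nu> \<alpha>) * up \<kappa> \<gamma>)"
  proof -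
    have "(\<Sum>\<nu>\<in>UNIV. (\<Sum>\<kappa>\<in>UNIV. lo \<kappa> \<nu> * up \<kappa> \<gamma>) * up \<nu> \<alpha>)
      = (\<Sum>\<kappa>\<in>UNIV. (\<Sum>\<nu>\<in>UNIV. lo \<kappa> \<nu> * up \<nu> \<alpha>) * up \<kappa> \<gamma>)"
      unfolding sum_distrib_right by (subst sum.swap) (simp only: ac_simps)
    then show ?thesis
      by (simp add: R distrib_right sum.distrib mult.assoc sum_distrib_left[symmetric])
        (simp add: sum_distrib_left ac_simps)
  qed
  also have "\<dots> = h s * up \<sigma> \<gamma> * of_bool (\<rho> = \<alpha>) + h (flip s) * T * up \<alpha> \<gamma>"
    by (simp only: lo_up delta_sum)
  also have "\<dots> = h (flip s) * (T * up \<alpha> \<gamma> + p s * ((\<Sum>\<tau>\<in>UNIV. lo \<rho> \<tau> * up \<tau> \<alpha>) * up \<sigma> \<gamma>))"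
    by (simp add: lo_up h_flip_p[of s, symmetric] algebra_simps)
  also have "\<dots> = h (flip s) * (\<Sum>\<tau>\<in>UNIV. lo \<rho> \<tau> * cup s $ (\<sigma>, \<tau>) $ (\<alpha>, \<gamma>))"
    by (simp add: cup_def T_def sum_distrib_left sum_distrib_right sum.distrib algebra_simps)
  finally show ?thesis .
qed

definition R_matrix :: "pm \<Rightarrow> complex^(2 \<times> 2)^(2 \<times> 2)"
  where "R_matrix s = (\<chi> x y. R_mat eps a s (fst x) (snd x) (fst y) (snd y))"

text \<open>The Temperley-Lieb idempotent, the projection onto the line spanned by the spinor metric; the
  \<open>R\<close> matrices are linear combinations of it and the identity.\<close>
definition TL :: "complex^(2 \<times> 2)^(2 \<times> 2)"
  where "TL = (\<chi> x y. - (1 / Q_of a) * (up (fst x) (snd x) * lo (fst y) (snd y)))"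

definition up_vec :: "complex^(2 \<times> 2)"
  where "up_vec = (\<chi> x. up (fst x) (snd x))"

definition lo_vec :: "complex^(2 \<times> 2)"
  where "lo_vec = (\<chi> x. lo (fst x) (snd x))"

lemma lo_up_trace: "(\<Sum>\<alpha>\<in>UNIV. \<Sum>\<beta>\<in>UNIV. lo \<alpha> \<beta> * up \<alpha> \<beta>) = - Q_of a"
  using up_trace by (simp add: mult.commute)

lemma TL_idempotent: "TL ** TL = TL"
proof -
  have "(TL ** TL) $ x $ y = 1 / Q_of a * (1 / Q_of a) * up (fst x) (snd x) * lo (fst y) (snd y)
    * (\<Sum>\<alpha>\<in>UNIV. \<Sum>\<beta>\<in>UNIV. lo \<alpha> \<beta> * up \<alpha> \<beta>)" for x y
    by (simp add: TL_def matrix_matrix_mult_def sum_UNIV_prod sum_distrib_left sum_divide_distrib ac_simps)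
  then show ?thesis
    using Q_nonzero by (simp add: vec_eq_iff lo_up_trace TL_def)
qed

lemma R_matrix_TL: "R_matrix s = mat 1 - mat (1 + p s ^ 2) ** TL"
proof -
  have "(1 + p s ^ 2) / Q_of a = p s"
    using Q_nonzero p_flip[of s]
    by (simp add: Q_eq[of s] field_simps power2_eq_square)
  moreover have "(1 + p s ^ 2) * (- (1 / Q_of a) * z) = - ((1 + p s ^ 2) / Q_of a * z)" for z
    by simp
  ultimately have "(1 + p s ^ 2) * (- (1 / Q_of a) * z) = - (p s * z)" for z
    by simp
  then show ?thesis
    by (simp only: vec_eq_iff vector_minus_component mat_mult_entry)
      (auto simp: R_matrix_def TL_def R_mat_def mat_def mult.assoc)
qed

lemma R_matrix_inverse: "R_matrix s ** R_matrix (flip s) = mat 1"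
proof -
  have "R_matrix s ** R_matrix (flip s) = mat 1"
    if "c * d = 1" "R_matrix s = mat 1 - mat (1 + c) ** TL" "R_matrix (flip s) = mat 1 - mat (1 + d) ** TL" for c d
  proof -
    have "(R_matrix s ** R_matrix (flip s)) $ x $ y = mat 1 $ x $ y" for x y
    proof -
      have "(R_matrix s ** R_matrix (flip s)) $ x $ y = (\<Sum>z\<in>UNIV. (mat 1 $ x $ z - (1 + c) * TL $ x $ z)
        * (mat 1 $ z $ y - (1 + d) * TL $ z $ y))"
      proof -
        have "R_matrix s $ x $ z = mat 1 $ x $ z - (1 + c) * TL $ x $ z"
          "R_matrix (flip s) $ z $ y = mat 1 $ z $ y - (1 + d) * TL $ z $ y" for z
          by (simp_all add: that mat_mult_entry)
        then show ?thesis by (simp add: matrix_matrix_mult_def)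
      qed
      also have "\<dots> = (mat 1 ** mat 1) $ x $ y - (1 + c) * (TL ** mat 1) $ x $ y
          - (1 + d) * (mat 1 ** TL) $ x $ y + (1 + c) * (1 + d) * (TL ** TL) $ x $ y"
        unfolding matrix_matrix_mult_def
        by (simp add: sum_distrib_left sum.distrib sum_subtractf algebra_simps)
      also have "\<dots> = mat 1 $ x $ y + (c * d - 1) * TL $ x $ y"
        by (simp add: TL_idempotent algebra_simps)
      finally show ?thesis using that by simp
    qed
    then show ?thesis by (simp add: vec_eq_iff)
  qed
  moreover have "p s ^ 2 * p (flip s) ^ 2 = 1"
    using p_flip[of s] by (simp flip: power_mult_distrib)
  ultimately show ?thesis using R_matrix_TL by blast
qed

lemma R_matrix_up_vec: "(\<Sum>z\<in>UNIV. \<Sum>t\<in>UNIV. R_matrix s $ x $ (z, t) * up z t) = - (p s ^ 2) * up (fst x) (snd x)"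
proof -
  obtain x1 x2 where x: "x = (x1, x2)" by fastforce
  have "(\<Sum>z\<in>UNIV. \<Sum>t\<in>UNIV. R_matrix s $ x $ (z, t) * up z t)
    = (\<Sum>z\<in>UNIV. of_bool (x1 = z) * (\<Sum>t\<in>UNIV. of_bool (x2 = t) * up z t))
      + p s * up x1 x2 * (\<Sum>z\<in>UNIV. \<Sum>t\<in>UNIV. lo z t * up z t)"
    unfolding R_matrix_def R_mat_def sum_distrib_left sum.distrib[symmetric]
    by (simp add: x algebra_simps)
  also have "\<dots> = (1 - p s * (p s + p (flip s))) * up x1 x2"
    by (simp only: delta_sum lo_up_trace Q_eq[of s]) (simp add: algebra_simps)
  also have "\<dots> = - (p s ^ 2) * up x1 x2"
    by (simp add: distrib_left p_flip power2_eq_square)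
  finally show ?thesis by (simp add: x)
qed

lemma R_matrix_lo_vec: "(\<Sum>z\<in>UNIV. \<Sum>t\<in>UNIV. R_matrix s $ (z, t) $ x * lo z t) = - (p s ^ 2) * lo (fst x) (snd x)"
proof -
  obtain x1 x2 where x: "x = (x1, x2)" by fastforce
  have "(\<Sum>z\<in>UNIV. \<Sum>t\<in>UNIV. R_matrix s $ (z, t) $ x * lo z t)
    = (\<Sum>z\<in>UNIV. of_bool (z = x1) * (\<Sum>t\<in>UNIV. of_bool (t = x2) * lo z t))
      + p s * lo x1 x2 * (\<Sum>z\<in>UNIV. \<Sum>t\<in>UNIV. lo z t * up z t)"
    unfolding R_matrix_def R_mat_def sum_distrib_left sum.distrib[symmetric]
    by (simp add: x algebra_simps)
  also have "\<dots> = (1 - p s * (p s + p (flip s))) * lo x1 x2"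
    by (simp only: delta_sum lo_up_trace Q_eq[of s]) (simp add: algebra_simps)
  also have "\<dots> = - (p s ^ 2) * lo x1 x2"
    by (simp add: distrib_left p_flip power2_eq_square)
  finally show ?thesis by (simp add: x)
qed

text \<open>The matrix \<open>\<R>\<close> of the theorem in spinor indices, acting on four strands
  \<open>(undotted, dotted, undotted, dotted)\<close>. In this form it is visibly conjugate to the tensor product
  of two \<open>R\<close> matrices with opposite signs, which determines its spectrum and its fixed vectors.\<close>
definition spinor_R :: "pm \<Rightarrow> complex^((2 \<times> 2) \<times> (2 \<times> 2))^((2 \<times> 2) \<times> (2 \<times> 2))"
  where "spinor_R s = middle (R_matrix s) ** kron (R_matrix s) (R_matrix (flip s)) ** middle (R_matrix (flip s))"

lemma middle_R_matrix_inverse: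
  "middle (R_matrix s) ** middle (R_matrix (flip s)) = (mat 1 :: complex^((2 \<times> 2) \<times> (2 \<times> 2))^((2 \<times> 2) \<times> (2 \<times> 2)))"
  "middle (R_matrix (flip s)) ** middle (R_matrix s) = (mat 1 :: complex^((2 \<times> 2) \<times> (2 \<times> 2))^((2 \<times> 2) \<times> (2 \<times> 2)))"
  using R_matrix_inverse[of s] R_matrix_inverse[of "flip s"] by (simp_all add: middle_mult middle_mat_1)

lemma kron_R_matrix_cubic:
  "(kron (R_matrix s) (R_matrix (flip s)) + mat (p s ^ 2)) ** (kron (R_matrix s) (R_matrix (flip s)) + mat (p (flip s) ^ 2))
    ** (kron (R_matrix s) (R_matrix (flip s)) - mat 1) = 0"
proof (rule commuting_idempotents_cubic[of "kron TL (mat 1)" "kron (mat 1) TL"])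
  show "kron TL (mat 1) ** kron TL (mat 1) = kron TL (mat 1 :: complex^(2\<times>2)^(2\<times>2))"
    "kron (mat 1) TL ** kron (mat 1) TL = kron (mat 1 :: complex^(2\<times>2)^(2\<times>2)) TL"
    "kron TL (mat 1) ** kron (mat 1) TL = kron (mat 1) TL ** kron TL (mat 1)"
    by (simp_all add: kron_mult TL_idempotent)
  show "p s ^ 2 * p (flip s) ^ 2 = 1"
    using p_flip[of s] by (simp flip: power_mult_distrib)
  have k: "kron (mat 1 - mat c ** TL) (mat 1) = mat 1 - mat c ** kron TL (mat 1 :: complex^(2\<times>2)^(2\<times>2))"
    "kron (mat 1) (mat 1 - mat c ** TL) = mat 1 - mat c ** kron (mat 1 :: complex^(2\<times>2)^(2\<times>2)) TL" for c
    by (simp_all only: vec_eq_iff vector_minus_component mat_mult_entry kron_entry)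
      (auto simp: algebra_simps mat_def)
  have "kron (R_matrix s) (R_matrix (flip s)) = kron (R_matrix s) (mat 1) ** kron (mat 1) (R_matrix (flip s))"
    by (simp add: kron_mult)
  then show "kron (R_matrix s) (R_matrix (flip s)) = (mat 1 - mat (1 + p s ^ 2) ** kron TL (mat 1))
    ** (mat 1 - mat (1 + p (flip s) ^ 2) ** kron (mat 1) TL)"
    by (simp only: R_matrix_TL k)
qed

definition cup_vec :: "pm \<Rightarrow> complex^((2 \<times> 2) \<times> (2 \<times> 2))"
  where "cup_vec s = (\<chi> q. cup s $ fst q $ snd q)"

definition cap_vec :: "pm \<Rightarrow> complex^((2 \<times> 2) \<times> (2 \<times> 2))"
  where "cap_vec s = (\<chi> q. cap s $ fst q $ snd q)"

definition tensor_vec :: "complex^'n \<Rightarrow> complex^'m \<Rightarrow> complex^('n \<times> 'm)"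
  where "tensor_vec v w = (\<chi> q. v $ fst q * w $ snd q)"

lemma middle_up_vec: "middle (R_matrix s) *v tensor_vec up_vec up_vec = cup_vec s"
proof -
  have "(middle (R_matrix s) *v tensor_vec up_vec up_vec) $ ((v2, v1), (y2, y1))
      = cup_vec s $ ((v2, v1), (y2, y1))" for v2 v1 y2 y1
  proof -
    have "(middle (R_matrix s) *v tensor_vec up_vec up_vec) $ ((v2, v1), (y2, y1))
      = (\<Sum>z\<in>UNIV. of_bool (v1 = z) * (\<Sum>t\<in>UNIV. of_bool (y2 = t) * (up v2 z * up t y1)))
        + p s * up v1 y2 * (\<Sum>t\<in>UNIV. (\<Sum>z\<in>UNIV. up v2 z * lo z t) * up t y1)"
      unfolding sum_distrib_right sum.swap[of "\<lambda>t z. up v2 z * lo z t * up t y1"]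
      unfolding middle_vec sum_distrib_left sum.distrib[symmetric]
      by (simp add: R_matrix_def R_mat_def tensor_vec_def up_vec_def algebra_simps)
    also have "\<dots> = cup_vec s $ ((v2, v1), (y2, y1))"
      by (simp only: delta_sum up_lo) (simp add: cup_vec_def cup_def)
    finally show ?thesis .
  qed
  then show ?thesis by (simp add: vec_eq_iff split_paired_all)
qed

lemma middle_lo_vec: "transpose (middle (R_matrix (flip s))) *v tensor_vec lo_vec lo_vec = cap_vec s"
proof -
  have "(transpose (middle (R_matrix (flip s))) *v tensor_vec lo_vec lo_vec) $ ((v2, v1), (y2, y1))
      = cap_vec s $ ((v2, v1), (y2, y1))" for v2 v1 y2 y1
  proof -
    have "(transpose (middle (R_matrix (flip s))) *v tensor_vec lo_vec lo_vec) $ ((v2, v1), (y2, y1))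
      = (\<Sum>z\<in>UNIV. of_bool (z = v1) * (\<Sum>t\<in>UNIV. of_bool (t = y2) * (lo v2 z * lo t y1)))
        + p (flip s) * lo v1 y2 * (\<Sum>t\<in>UNIV. (\<Sum>z\<in>UNIV. lo v2 z * up z t) * lo t y1)"
      unfolding sum_distrib_right sum.swap[of "\<lambda>t z. lo v2 z * up z t * lo t y1"]
      unfolding transpose_middle middle_vec sum_distrib_left sum.distrib[symmetric]
      by (simp add: R_matrix_def R_mat_def transpose_def tensor_vec_def lo_vec_def algebra_simps)
    also have "\<dots> = cap_vec s $ ((v2, v1), (y2, y1))"
      by (simp only: delta_sum lo_up) (simp add: cap_vec_def cap_def)
    finally show ?thesis .
  qed
  then show ?thesis by (simp add: vec_eq_iff split_paired_all)
qed

lemma kron_tensor_vec: "kron A B *v tensor_vec v w = tensor_vec (A *v v) (B *v w)"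
  by (simp add: vec_eq_iff kron_def tensor_vec_def matrix_vector_mult_def sum_UNIV_prod sum_product
      ac_simps)

lemma kron_R_matrix_up: "kron (R_matrix s) (R_matrix (flip s)) *v tensor_vec up_vec up_vec = tensor_vec up_vec up_vec"
proof -
  have "(R_matrix s *v up_vec) $ x = - (p s ^ 2) * up_vec $ x" for s x
    using R_matrix_up_vec[of s x] by (simp add: matrix_vector_mult_def up_vec_def sum_UNIV_prod)
  moreover have "p s ^ 2 * p (flip s) ^ 2 = 1"
    using p_flip[of s] by (simp flip: power_mult_distrib)
  ultimately show ?thesis
    by (simp add: kron_tensor_vec) (simp add: vec_eq_iff tensor_vec_def flip: mult.assoc)
qed

lemma kron_R_matrix_lo:
  "transpose (kron (R_matrix s) (R_matrix (flip s))) *v tensor_vec lo_vec lo_vec = tensor_vec lo_vec lo_vec"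
proof -
  have "(transpose (R_matrix s) *v lo_vec) $ x = - (p s ^ 2) * lo_vec $ x" for s x
    using R_matrix_lo_vec[of s x] by (simp add: matrix_vector_mult_def lo_vec_def sum_UNIV_prod transpose_def)
  moreover have "p s ^ 2 * p (flip s) ^ 2 = 1"
    using p_flip[of s] by (simp flip: power_mult_distrib)
  ultimately show ?thesis
    by (simp add: kron_tensor_vec transpose_kron) (simp add: vec_eq_iff tensor_vec_def flip: mult.assoc)
qed

text \<open>Conjugation by the middle braiding reduces the claim to the vector \<open>up \<otimes> up\<close>, on which
  the two \<open>R\<close> matrices act by \<open>- p s ^ 2\<close> and \<open>- p (flip s) ^ 2\<close>, scalars with product \<open>1\<close>.\<close>
lemma spinor_R_cup: "spinor_R s *v cup_vec s = cup_vec s"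
proof -
  have "middle (R_matrix (flip s)) *v cup_vec s = tensor_vec up_vec up_vec"
    unfolding middle_up_vec[symmetric] by (simp add: matrix_vector_mul_assoc middle_R_matrix_inverse)
  then show ?thesis
    by (simp add: spinor_R_def kron_R_matrix_up middle_up_vec flip: matrix_vector_mul_assoc)
qed

lemma spinor_R_cap: "transpose (spinor_R s) *v cap_vec s = cap_vec s"
proof -
  have "transpose (middle (R_matrix s)) *v cap_vec s = tensor_vec lo_vec lo_vec"
    unfolding middle_lo_vec[symmetric]
    by (simp only: matrix_vector_mul_assoc middle_R_matrix_inverse transpose_mat matrix_vector_mul_lid
        matrix_transpose_mul[symmetric])
  then show ?thesis
    by (simp only: spinor_R_def matrix_transpose_mul kron_R_matrix_lo middle_lo_vec
        matrix_vector_mul_assoc[symmetric])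
qed

lemma spinor_R_entry:
  "spinor_R s $ ((v2, v1), (y2, y1)) $ ((x2, x1), (u2, u1)) =
    (\<Sum>z\<in>UNIV. \<Sum>t'\<in>UNIV. \<Sum>t\<in>UNIV. \<Sum>z'\<in>UNIV.
      R_mat eps a s v1 y2 z t' * R_mat eps a s v2 z x2 t * R_mat eps a (flip s) t' y1 z' u1
      * R_mat eps a (flip s) t z' x1 u2)"
  by (simp add: spinor_R_def middle_mult_left middle_mult_right flip: matrix_mul_assoc)
    (simp add: kron_def R_matrix_def sum_distrib_left ac_simps)

end

lemma base_change_comp:
  "base_change A A' (base_change B B' X) L K
    = base_change (\<lambda>L m. \<Sum>x\<in>UNIV. A L x * B x m) (\<lambda>n K. \<Sum>y\<in>UNIV. B' n y * A' y K) X L K"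
proof -
  have "base_change A A' (base_change B B' X) L K
    = (\<Sum>x\<in>UNIV. \<Sum>y\<in>UNIV. \<Sum>m\<in>UNIV. \<Sum>n\<in>UNIV. ((A L x * B x m) * (B' n y * A' y K)) *\<^sub>C X m n)"
    by (simp add: base_change_def scaleC_sum_right ac_simps)
  also have "\<dots> = (\<Sum>x\<in>UNIV. \<Sum>m\<in>UNIV. \<Sum>n\<in>UNIV. \<Sum>y\<in>UNIV. ((A L x * B x m) * (B' n y * A' y K)) *\<^sub>C X m n)"
    by (rule sum.cong[OF refl], subst sum.swap, rule sum.cong[OF refl], rule sum.swap)
  also have "\<dots> = (\<Sum>m\<in>UNIV. \<Sum>n\<in>UNIV. \<Sum>x\<in>UNIV. \<Sum>y\<in>UNIV. ((A L x * B x m) * (B' n y * A' y K)) *\<^sub>C X m n)"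
    by (subst sum.swap, rule sum.cong[OF refl], rule sum.swap)
  finally show ?thesis
    by (simp add: base_change_def sum_product complex_vector.scale_sum_left)
qed

context hopf_star_algebra
begin

lemma conv_base_change:
  assumes "mutually_inverse P P'"
  shows "(\<Sum>I\<in>UNIV. conv cop (functional_base_change P P' \<phi> L I) (functional_base_change P P' \<psi> I K) b)
    = base_change P P' (\<lambda>x y. \<Sum>z\<in>UNIV. conv cop (\<phi> x z) (\<psi> z y) b) L K"
proof -
  have "(\<Sum>I\<in>UNIV. functional_base_change P P' \<phi> L I p * functional_base_change P P' \<psi> I K q)
    = base_change P P' (\<lambda>x y. \<Sum>z\<in>UNIV. \<phi> x z p * \<psi> z y q) L K" for p q
    by (rule base_change_matrix_mult[OF assms cbilinear_times])
  then show ?thesis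
    by (simp only: conv_def tensor_lift_fun_sum[symmetric])
      (simp only: base_change_def tensor_lift_fun_sum tensor_lift_fun_scaleC)
qed

lemma conv_star: "cnj (conv cop g h (star b)) = conv cop (\<lambda>x. cnj (g (star x))) (\<lambda>x. cnj (h (star x))) b"
  if gh: "clinear g" "clinear h"
proof -
  have star_add: "tensor_star (t + u) = tensor_star t + tensor_star u" for t u :: "'a \<otimes> 'a"
    unfolding tensor_star_def
    by (rule tensor_lift_add) (simp add: balanced_def star_add star_scaleC tensor_add_left
        tensor_add_right tensor_scaleC_left tensor_scaleC_right)
  then have star_0: "tensor_star 0 = (0 :: 'a \<otimes> 'a)"
    by (metis add_cancel_right_right)
  note lin = tensor_lift_linear[OF cbilinear_functionals[OF gh]]
  have g: "g (x + y) = g x + g y" "g (c *\<^sub>C x) = c * g x" and h: "h (x + y) = h x + h y" "h (c *\<^sub>C x) = c * h x"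
    for c x y using gh by (simp_all add: clinear_functional_iff)
  have b: "cbilinear (\<lambda>x y. cnj (g (star x)) * cnj (h (star y)))"
    by (simp add: cbilinear_iff complex_star_algebra_1_class.star_add star_scaleC g h scaleC_complex algebra_simps)
  have "cnj (tensor_lift (\<lambda>x y. g x * h y) (tensor_star t))
    = tensor_lift (\<lambda>x y. cnj (g (star x)) * cnj (h (star y))) t" for t
  proof (induction t rule: tensor_induct)
    case zero
    then show ?case
      by (simp add: star_0 clinear_zero[OF lin] clinear_zero[OF tensor_lift_linear[OF b]])
  next
    case (add x y t)
    then show ?case
      by (simp add: star_add clinear_add[OF lin] clinear_add[OF tensor_lift_linear[OF b]]
          tensor_star_tensor tensor_lift_pure[OF b] tensor_lift_pure[OF cbilinear_functionals[OF gh]])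
  qed
  then show ?thesis by (simp add: conv_def cop_star)
qed

text \<open>The convolution inverse of a tensor product of representations is the product of the
  inverses in the opposite order.\<close>
lemma conv_tensor_antipode:
  assumes "matrix_hom \<phi>" "matrix_hom \<psi>"
  shows "(\<Sum>z\<in>UNIV. conv cop (conv_tensor \<phi> \<psi> x z)
      (conv cop (\<phi> (fst z) (fst y) \<circ> S) (\<psi> (snd z) (snd y) \<circ> S)) b) = of_bool (x = y) * counit b"
proof -
  note \<phi> = matrix_homD(1)[OF assms(1)] and \<psi> = matrix_homD(1)[OF assms(2)]
  have \<phi>S: "clinear (\<phi> i j \<circ> S)" and \<psi>S: "clinear (\<psi> k l \<circ> S)" for i j k l
    using clinear_comp[OF S_linear \<phi>] clinear_comp[OF S_linear \<psi>] by (simp_all add: o_def)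
  obtain x1 x2 y1 y2 where xy: "x = (x1, x2)" "y = (y1, y2)" by fastforce
  have "conv cop (conv cop (\<psi> x2 l) (\<phi> x1 k)) (conv cop (\<phi> k y1 \<circ> S) (\<psi> l y2 \<circ> S)) b
    = conv cop (\<psi> x2 l) (conv cop (conv cop (\<phi> x1 k) (\<phi> k y1 \<circ> S)) (\<psi> l y2 \<circ> S)) b" for k l
  proof -
    have "conv cop (\<phi> x1 k) (conv cop (\<phi> k y1 \<circ> S) (\<psi> l y2 \<circ> S))
      = conv cop (conv cop (\<phi> x1 k) (\<phi> k y1 \<circ> S)) (\<psi> l y2 \<circ> S)"
      by (rule ext) (rule conv_assoc[OF \<phi> \<phi>S \<psi>S, symmetric])
    then show ?thesis
      by (simp only: conv_assoc[OF \<psi> \<phi> conv_linear[OF \<phi>S \<psi>S]])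
  qed
  then have "(\<Sum>z\<in>UNIV. conv cop (conv_tensor \<phi> \<psi> x z)
      (conv cop (\<phi> (fst z) (fst y) \<circ> S) (\<psi> (snd z) (snd y) \<circ> S)) b)
    = (\<Sum>l\<in>UNIV. \<Sum>k\<in>UNIV. conv cop (\<psi> x2 l) (conv cop (conv cop (\<phi> x1 k) (\<phi> k y1 \<circ> S)) (\<psi> l y2 \<circ> S)) b)"
    by (simp add: sum_UNIV_prod conv_tensor_def[abs_def] xy) (rule sum.swap)
  also have "\<dots> = (\<Sum>l\<in>UNIV. conv cop (\<psi> x2 l)
      (conv cop (\<lambda>b. \<Sum>k\<in>UNIV. conv cop (\<phi> x1 k) (\<phi> k y1 \<circ> S) b) (\<psi> l y2 \<circ> S)) b)"
    by (simp only: conv_sum_right[symmetric] conv_sum_left[abs_def])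
  also have "\<dots> = (\<Sum>l\<in>UNIV. of_bool (x1 = y1) * conv cop (\<psi> x2 l) (\<psi> l y2 \<circ> S) b)"
    by (simp only: matrix_hom_antipode_right[OF assms(1)] conv_scale_left[abs_def]
        conv_counit_left[OF \<psi>S, abs_def] conv_scale_right)
  also have "\<dots> = of_bool (x = y) * counit b"
    by (simp only: sum_distrib_left[symmetric] matrix_hom_antipode_right[OF assms(2)]) (simp add: xy)
  finally show ?thesis .
qed

lemma conv_corepresentation:
  assumes "corepresentation u" "clinear g" "clinear h"
  shows "conv cop g h (u i j) = (\<Sum>k\<in>UNIV. g (u i k) * h (u k j))"
  using assms(1)
  by (simp add: conv_def corepresentation_def tensor_lift_pure[OF cbilinear_functionals[OF assms(2,3)]]
      clinear_sum[OF tensor_lift_linear[OF cbilinear_functionals[OF assms(2,3)]]])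

end

section \<open>Spinor representations and corepresentations\<close>

context bicovariant_functionals
begin

lemma f_hom: "matrix_hom (f s)"
  by (simp add: matrix_hom_def f_linear f_mult f_one)

text \<open>The dotted generators, transposed and composed with the inverse antipode, form a
  corepresentation on which the functionals take the same values as on \<open>M\<close> (see \<open>f_N\<close>).\<close>
definition N :: "2 \<Rightarrow> 2 \<Rightarrow> 'a"
  where "N \<gamma> \<rho> = inv S (Md \<rho> \<gamma>)"

lemma N_base_change: "N = base_change (\<lambda>\<gamma> \<delta>. lo \<delta> \<gamma>) (\<lambda>\<kappa> \<rho>. up \<rho> \<kappa>) Md"
proof (intro ext)
  fix \<gamma> \<rho>
  show "N \<gamma> \<rho> = base_change (\<lambda>\<gamma> \<delta>. lo \<delta> \<gamma>) (\<lambda>\<kappa> \<rho>. up \<rho> \<kappa>) Md \<gamma> \<rho>"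
    unfolding N_def inv_S_Md base_change_def eps_up_dot_eq eps_lo_dot_eq
    by (subst sum.swap) simp
qed

lemma lo_up_inverse: "mutually_inverse (\<lambda>\<gamma> \<delta>. lo \<delta> \<gamma>) (\<lambda>\<kappa> \<rho>. up \<rho> \<kappa>)"
  unfolding mutually_inverse_def
proof (intro conjI allI)
  show "(\<Sum>x\<in>UNIV. lo x L * up K x) = of_bool (L = K)" for L K
    using up_lo[of K L] by (simp add: mult.commute eq_commute)
  show "(\<Sum>L\<in>UNIV. up L x * lo y L) = of_bool (x = y)" for x y
    using lo_up[of y x] by (simp add: mult.commute eq_commute)
qed

lemma corep_M: "corepresentation M"
  by (simp add: corepresentation_def cop_M)

lemma corep_N: "corepresentation N"
  unfolding N_base_change
  by (rule corepresentation_base_change[OF lo_up_inverse]) (simp add: corepresentation_def cop_Md)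

lemma bicov_M: "bicovariant M (f s)"
  by (simp add: bicovariant_def f_bicov)

lemma bicov_N: "bicovariant N (f s)"
  using ftd_bicov by (simp add: bicovariant_def N_def ftd_f)

lemma f_N: "f s \<alpha> \<beta> (N \<gamma> \<rho>) = h (flip s) * R_mat eps a s \<rho> \<beta> \<alpha> \<gamma>"
proof -
  have "f s \<alpha> \<beta> (N \<gamma> \<rho>) = h s * (\<Sum>\<delta>\<in>UNIV. \<Sum>\<kappa>\<in>UNIV. lo \<delta> \<gamma> * up \<rho> \<kappa> * R_mat eps a (flip s) \<beta> \<delta> \<kappa> \<alpha>)"
    by (simp only: N_base_change clinear_base_change[OF f_linear])
      (simp add: base_change_def f_Md R_du_def scaleC_complex sum_distrib_left ac_simps)
  also have "(\<Sum>\<delta>\<in>UNIV. \<Sum>\<kappa>\<in>UNIV. lo \<delta> \<gamma> * up \<rho> \<kappa> * R_mat eps a (flip s) \<beta> \<delta> \<kappa> \<alpha>)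
    = (\<Sum>\<delta>\<in>UNIV. \<Sum>\<kappa>\<in>UNIV. of_bool (\<delta> = \<alpha>) * (of_bool (\<beta> = \<kappa>) * (lo \<delta> \<gamma> * up \<rho> \<kappa>))
      + p (flip s) * ((up \<beta> \<delta> * lo \<delta> \<gamma>) * (up \<rho> \<kappa> * lo \<kappa> \<alpha>)))"
    by (simp only: R_mat_def algebra_simps)
  also have "\<dots> = (\<Sum>\<delta>\<in>UNIV. of_bool (\<delta> = \<alpha>) * (\<Sum>\<kappa>\<in>UNIV. of_bool (\<beta> = \<kappa>) * (lo \<delta> \<gamma> * up \<rho> \<kappa>)))
      + p (flip s) * ((\<Sum>\<delta>\<in>UNIV. up \<beta> \<delta> * lo \<delta> \<gamma>) * (\<Sum>\<kappa>\<in>UNIV. up \<rho> \<kappa> * lo \<kappa> \<alpha>))"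
    unfolding sum_product by (simp only: sum.distrib sum_distrib_left)
  also have "\<dots> = lo \<alpha> \<gamma> * up \<rho> \<beta> + p (flip s) * (of_bool (\<beta> = \<gamma>) * of_bool (\<rho> = \<alpha>))"
    by (simp only: delta_sum up_lo)
  also have "h s * \<dots> = h (flip s) * R_mat eps a s \<rho> \<beta> \<alpha> \<gamma>"
  proof -
    have "h s * (x + p (flip s) * y) = h (flip s) * (y + p s * x)" for x y
      by (simp add: distrib_left h_p_flip h_flip_p flip: mult.assoc)
    note swap = this
    show ?thesis
      by (simp only: R_mat_def swap) (simp only: ac_simps)
  qed
  finally show ?thesis .
qed

definition spinor_rep :: "pm \<Rightarrow> 2 \<times> 2 \<Rightarrow> 2 \<times> 2 \<Rightarrow> 'a \<Rightarrow> complex"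
  where "spinor_rep s = conv_tensor (f s) (f (flip s))"

definition spinor_corep :: "2 \<times> 2 \<Rightarrow> 2 \<times> 2 \<Rightarrow> 'a"
  where "spinor_corep = corep_tensor M N"

lemma spinor_rep_hom: "matrix_hom (spinor_rep s)"
  unfolding spinor_rep_def by (intro matrix_hom_conv_tensor f_hom)

lemma corep_spinor_corep: "corepresentation spinor_corep"
  unfolding spinor_corep_def by (intro corepresentation_tensor corep_M corep_N)

lemma bicov_spinor_corep: "bicovariant spinor_corep (spinor_rep s)"
  unfolding spinor_corep_def spinor_rep_def by (intro bicovariant_tensor f_hom bicov_M bicov_N)

text \<open>Each generator contributes two \<open>R\<close> matrices, one for each factor of the convolution, and the
  half powers of \<open>a\<close> cancel between the two signs.\<close>
lemma spinor_rep_corep: "spinor_rep s x y (spinor_corep w v) = spinor_R s $ (v, y) $ (x, w)"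
proof -
  obtain x2 x1 y2 y1 w2 w1 v2 v1 where
    eqs: "x = (x2, x1)" "y = (y2, y1)" "w = (w2, w1)" "v = (v2, v1)" by fastforce
  have hh: "h s * c * (h (flip s) * d) = d * c" for c d
    using h_flip[of s] by (simp add: algebra_simps flip: mult.assoc)
  have M: "spinor_rep s (x2, x1) (z2, z1) (M w2 v2) = (\<Sum>t\<in>UNIV.
      R_mat eps a s v2 z2 x2 t * R_mat eps a (flip s) t z1 x1 w2)" for z2 z1
    by (simp add: spinor_rep_def conv_tensor_def conv_corepresentation[OF corep_M f_linear f_linear] f_M hh)
  have N: "spinor_rep s (z2, z1) (y2, y1) (N w1 v1) = (\<Sum>t\<in>UNIV.
      R_mat eps a s v1 y2 z2 t * R_mat eps a (flip s) t y1 z1 w1)" for z2 z1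
    by (simp add: spinor_rep_def conv_tensor_def conv_corepresentation[OF corep_N f_linear f_linear] f_N hh)
  have "spinor_rep s x y (spinor_corep w v) = (\<Sum>z2\<in>UNIV. \<Sum>z1\<in>UNIV. spinor_rep s (x2, x1) (z2, z1) (M w2 v2)
      * spinor_rep s (z2, z1) (y2, y1) (N w1 v1))"
    by (simp add: spinor_corep_def corep_tensor_def eqs matrix_homD(2)[OF spinor_rep_hom] sum_UNIV_prod)
  also have "\<dots> = spinor_R s $ (v, y) $ (x, w)"
    unfolding M N eqs spinor_R_entry
    by (simp add: sum_2 algebra_simps)
  finally show ?thesis .
qed

end

section \<open>Pauli matrices and the metric\<close>

lemma matrix_inv_eqI:
  fixes A B :: "complex^'n^'n"
  assumes "A ** B = mat 1"
  shows "matrix_inv A = B"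
proof -
  have BA: "B ** A = mat 1"
    using assms matrix_left_right_inverse by blast
  have "A ** matrix_inv A = mat 1 \<and> matrix_inv A ** A = mat 1"
    unfolding matrix_inv_def by (rule someI[of _ B]) (simp add: assms BA)
  then have "matrix_inv A = (B ** A) ** matrix_inv A"
    by (simp add: BA)
  also have "\<dots> = B"
    using \<open>A ** matrix_inv A = mat 1 \<and> matrix_inv A ** A = mat 1\<close>
    by (simp flip: matrix_mul_assoc)
  finally show ?thesis .
qed

context spinor_metric
begin

lemma dot_inverse: "(\<Sum>\<delta>\<in>UNIV. eps_lo_dot eps \<gamma> \<delta> * eps_up_dot eps \<delta> \<mu>) = of_bool (\<mu> = \<gamma>)"
  "(\<Sum>\<delta>\<in>UNIV. eps_up_dot eps \<gamma> \<delta> * eps_lo_dot eps \<delta> \<mu>) = of_bool (\<mu> = \<gamma>)"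
proof -
  have "(\<Sum>\<delta>\<in>UNIV. eps_lo_dot eps \<gamma> \<delta> * eps_up_dot eps \<delta> \<mu>) = cnj (\<Sum>\<delta>\<in>UNIV. up \<mu> \<delta> * lo \<delta> \<gamma>)"
    by (simp add: eps_lo_dot_def eps_up_dot_def mult.commute)
  then show "(\<Sum>\<delta>\<in>UNIV. eps_lo_dot eps \<gamma> \<delta> * eps_up_dot eps \<delta> \<mu>) = of_bool (\<mu> = \<gamma>)"
    by (simp add: up_lo)
  have "(\<Sum>\<delta>\<in>UNIV. eps_up_dot eps \<gamma> \<delta> * eps_lo_dot eps \<delta> \<mu>) = cnj (\<Sum>\<delta>\<in>UNIV. lo \<mu> \<delta> * up \<delta> \<gamma>)"
    by (simp add: eps_lo_dot_def eps_up_dot_def mult.commute)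
  then show "(\<Sum>\<delta>\<in>UNIV. eps_up_dot eps \<gamma> \<delta> * eps_lo_dot eps \<delta> \<mu>) = of_bool (\<mu> = \<gamma>)"
    by (simp add: lo_up)
qed

text \<open>The Pauli matrices as the base change from vector indices to spinor pairs, and, for \<open>pauli_inv\<close>, the
  barred Pauli matrices as the base change back; \<open>pauli_inv_map\<close> shows that they are mutually inverse. The
  barred matrices take the dotted index first, whereas pairs list it second.\<close>
definition pauli_map :: "(4 \<Rightarrow> complex^2^2) \<Rightarrow> complex^4^(2 \<times> 2)"
  where "pauli_map sig = (\<chi> y K. sig_mixed eps sig K (fst y) (snd y))"

definition pauli_inv :: "(4 \<Rightarrow> complex^2^2) \<Rightarrow> pm \<Rightarrow> complex^(2 \<times> 2)^4"
  where "pauli_inv sig t = (\<chi> L x. 1 / Q_of a * sig_bar_mixed eps a sig t L (snd x) (fst x))"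

lemma sig_of_mixed: "sig K $ \<alpha> $ \<beta> = (\<Sum>\<kappa>\<in>UNIV. eps_lo_dot eps \<beta> \<kappa> * pauli_map sig $ (\<alpha>, \<kappa>) $ K)"
proof -
  have "(\<Sum>\<kappa>\<in>UNIV. eps_lo_dot eps \<beta> \<kappa> * pauli_map sig $ (\<alpha>, \<kappa>) $ K)
    = (\<Sum>\<mu>\<in>UNIV. (\<Sum>\<kappa>\<in>UNIV. eps_lo_dot eps \<beta> \<kappa> * eps_up_dot eps \<kappa> \<mu>) * sig K $ \<alpha> $ \<mu>)"
    unfolding pauli_map_def sig_mixed_def by (simp add: sum_2 algebra_simps)
  then show ?thesis by (simp only: dot_inverse delta_sum)
qed

text \<open>Linear independence of four matrices in a four-dimensional space. A bijection between the
  index types \<open>4\<close> and \<open>2 \<times> 2\<close> turns \<open>pauli_map\<close> into a square matrix, for which independent columns give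
  a two-sided inverse.\<close>
lemma pauli_map_inverse:
  assumes "pauli_matrices sig"
  shows "\<exists>P. P ** pauli_map sig = mat 1 \<and> pauli_map sig ** P = mat 1"
proof -
  have "card (UNIV :: 4 set) = card (UNIV :: (2 \<times> 2) set)" by simp
  then obtain g :: "4 \<Rightarrow> 2 \<times> 2" where g: "bij g"
    by (metis finite_same_card_bij finite)
  define A :: "complex^4^4" where "A = (\<chi> j I. pauli_map sig $ g j $ I)"
  have "\<forall>c. (\<Sum>i\<in>UNIV. c i *s column i A) = 0 \<longrightarrow> (\<forall>i. c i = 0)"
  proof (intro allI impI)
    fix c :: "4 \<Rightarrow> complex" and i
    assume c: "(\<Sum>i\<in>UNIV. c i *s column i A) = 0"
    have 0: "(\<Sum>I\<in>UNIV. c I * pauli_map sig $ y $ I) = 0" for y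
    proof -
      obtain j where "y = g j" using g by (metis bij_pointE)
      then show ?thesis
        using arg_cong[OF c, of "\<lambda>v. v $ j"] by (simp add: A_def column_def)
    qed
    have "(\<Sum>I\<in>UNIV. c I * sig I $ \<alpha> $ \<beta>) = 0" for \<alpha> \<beta>
    proof -
      have "(\<Sum>I\<in>UNIV. c I * sig I $ \<alpha> $ \<beta>)
        = (\<Sum>\<kappa>\<in>UNIV. eps_lo_dot eps \<beta> \<kappa> * (\<Sum>I\<in>UNIV. c I * pauli_map sig $ (\<alpha>, \<kappa>) $ I))"
        unfolding sig_of_mixed sum_distrib_left by (subst sum.swap) (simp only: ac_simps)
      then show ?thesis by (simp add: 0)
    qed
    then show "c i = 0" using assms by (simp add: pauli_matrices_def)
  qed
  then obtain B where B: "B ** A = mat 1"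
    using matrix_left_invertible_independent_columns[of A] by blast
  then have AB: "A ** B = mat 1" using matrix_left_right_inverse by blast
  define P :: "complex^(2 \<times> 2)^4" where "P = (\<chi> L y. B $ L $ inv g y)"
  have P: "P $ L $ g j = B $ L $ j" for L j
    using g by (simp add: P_def bij_is_inj)
  have "(P ** pauli_map sig) $ L $ K = (B ** A) $ L $ K" for L K
  proof -
    have "(\<Sum>j\<in>UNIV. P $ L $ g j * pauli_map sig $ g j $ K) = (\<Sum>y\<in>UNIV. P $ L $ y * pauli_map sig $ y $ K)"
      using sum.reindex_bij_betw[OF g, of "\<lambda>y. P $ L $ y * pauli_map sig $ y $ K"] by simp
    then show ?thesis by (simp add: matrix_matrix_mult_def P) (simp add: A_def)
  qed
  moreover have "(pauli_map sig ** P) $ x $ y = mat 1 $ x $ y" for x y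
  proof -
    obtain i j where "x = g i" "y = g j" using g by (metis bij_pointE)
    moreover have "(pauli_map sig ** P) $ g i $ g j = (A ** B) $ i $ j"
      by (simp add: matrix_matrix_mult_def P) (simp add: A_def)
    ultimately show ?thesis
      using g by (simp add: AB mat_def bij_is_inj inj_eq)
  qed
  ultimately have "P ** pauli_map sig = mat 1 \<and> pauli_map sig ** P = mat 1"
    by (simp add: vec_eq_iff B)
  then show ?thesis ..
qed

lemma sig_bar_lowered:
  "(\<Sum>\<delta>\<in>UNIV. eps_lo_dot eps \<gamma> \<delta> * sig_bar eps a sig s J \<delta> \<alpha>)
    = - h (flip s) * (transpose (pauli_map sig) ** cup s) $ J $ (\<alpha>, \<gamma>)"
proof -
  define Z where "Z \<mu> = (\<Sum>\<sigma>\<in>UNIV. \<Sum>\<rho>\<in>UNIV.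
    (\<Sum>\<nu>\<in>UNIV. R_ud eps a (flip s) \<sigma> \<rho> \<mu> \<nu> * up \<nu> \<alpha>) * sig J $ \<sigma> $ \<rho>)" for \<mu>
  have "sig_bar eps a sig s J \<delta> \<alpha> = (\<Sum>\<mu>\<in>UNIV. eps_up_dot eps \<delta> \<mu> * Z \<mu>)" for \<delta>
    unfolding sig_bar_def Z_def sum_distrib_left sum_distrib_right by (simp only: ac_simps)
  then have "(\<Sum>\<delta>\<in>UNIV. eps_lo_dot eps \<gamma> \<delta> * sig_bar eps a sig s J \<delta> \<alpha>)
    = (\<Sum>\<mu>\<in>UNIV. (\<Sum>\<delta>\<in>UNIV. eps_lo_dot eps \<gamma> \<delta> * eps_up_dot eps \<delta> \<mu>) * Z \<mu>)"
    by (simp add: sum_2 algebra_simps)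
  also have "\<dots> = Z \<gamma>"
    by (simp only: dot_inverse delta_sum)
  also have "\<dots> = h (flip s) * (\<Sum>\<sigma>\<in>UNIV. \<Sum>\<rho>\<in>UNIV. \<Sum>\<tau>\<in>UNIV. lo \<rho> \<tau> * sig J $ \<sigma> $ \<rho> * cup s $ (\<sigma>, \<tau>) $ (\<alpha>, \<gamma>))"
    unfolding Z_def R_ud_up sum_distrib_left sum_distrib_right by (simp only: ac_simps)
  also have "(\<Sum>\<sigma>\<in>UNIV. \<Sum>\<rho>\<in>UNIV. \<Sum>\<tau>\<in>UNIV. lo \<rho> \<tau> * sig J $ \<sigma> $ \<rho> * cup s $ (\<sigma>, \<tau>) $ (\<alpha>, \<gamma>))
    = (\<Sum>\<sigma>\<in>UNIV. \<Sum>\<tau>\<in>UNIV. - pauli_map sig $ (\<sigma>, \<tau>) $ J * cup s $ (\<sigma>, \<tau>) $ (\<alpha>, \<gamma>))"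
    unfolding pauli_map_def sig_mixed_def eps_up_dot_eq
    by (rule sum.cong[OF refl], subst sum.swap) (simp add: sum_distrib_right sum_negf)
  also have "\<dots> = - (transpose (pauli_map sig) ** cup s) $ J $ (\<alpha>, \<gamma>)"
    by (simp add: matrix_matrix_mult_def transpose_def sum_UNIV_prod sum_negf)
  finally show ?thesis by simp
qed

text \<open>Rewriting both Pauli matrices in mixed index position leaves spinor metrics that combine to a
  twist of each index of \<open>cup\<close>, which \<open>cup_rotate\<close> removes.\<close>
lemma metric_up_eq:
  "metric_up eps a sig s = mat (- h (flip s) / Q_of a) ** (transpose (pauli_map sig) ** cup s ** pauli_map sig)"
proof -
  define D where "D \<alpha> \<gamma> = (\<Sum>\<nu>\<in>UNIV. up \<alpha> \<nu> * lo \<gamma> \<nu>)" for \<alpha> \<gamma>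
  have "(\<Sum>\<alpha>\<in>UNIV. \<Sum>\<nu>\<in>UNIV. \<Sum>\<beta>\<in>UNIV. \<Sum>\<gamma>\<in>UNIV.
      up \<alpha> \<nu> * sig I $ \<alpha> $ \<beta> * sig_bar eps a sig s J \<beta> \<gamma> * lo \<gamma> \<nu>)
    = - h (flip s) * (transpose (pauli_map sig) ** cup s ** pauli_map sig) $ I $ J" for I J
  proof -
    define C where "C \<gamma> \<xi> = (transpose (pauli_map sig) ** cup s) $ J $ (\<gamma>, \<xi>)" for \<gamma> \<xi>
    have bar: "sig_bar eps a sig s J \<beta> \<gamma> = - h (flip s) * (\<Sum>\<xi>\<in>UNIV. eps_up_dot eps \<beta> \<xi> * C \<gamma> \<xi>)" for \<beta> \<gamma>
    proof -
      have "(\<Sum>\<xi>\<in>UNIV. eps_up_dot eps \<beta> \<xi> * (\<Sum>\<delta>\<in>UNIV. eps_lo_dot eps \<xi> \<delta> * sig_bar eps a sig s J \<delta> \<gamma>))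
        = (\<Sum>\<delta>\<in>UNIV. (\<Sum>\<xi>\<in>UNIV. eps_up_dot eps \<beta> \<xi> * eps_lo_dot eps \<xi> \<delta>) * sig_bar eps a sig s J \<delta> \<gamma>)"
        by (simp add: sum_2 algebra_simps)
      then have "sig_bar eps a sig s J \<beta> \<gamma>
        = (\<Sum>\<xi>\<in>UNIV. eps_up_dot eps \<beta> \<xi> * (\<Sum>\<delta>\<in>UNIV. eps_lo_dot eps \<xi> \<delta> * sig_bar eps a sig s J \<delta> \<gamma>))"
        by (simp only: dot_inverse delta_sum)
      then show ?thesis
        unfolding sig_bar_lowered C_def by (simp add: sum_distrib_left ac_simps)
    qed
    have dot: "(\<Sum>\<beta>\<in>UNIV. sig I $ \<alpha> $ \<beta> * (\<Sum>\<xi>\<in>UNIV. eps_up_dot eps \<beta> \<xi> * C \<gamma> \<xi>))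
      = (\<Sum>\<kappa>\<in>UNIV. \<Sum>\<xi>\<in>UNIV. D \<kappa> \<xi> * pauli_map sig $ (\<alpha>, \<kappa>) $ I * C \<gamma> \<xi>)" for \<alpha> \<gamma>
      unfolding sig_of_mixed eps_up_dot_eq eps_lo_dot_eq D_def
      by (simp add: sum_2 algebra_simps)
    have "(\<Sum>\<alpha>\<in>UNIV. \<Sum>\<nu>\<in>UNIV. \<Sum>\<beta>\<in>UNIV. \<Sum>\<gamma>\<in>UNIV.
        up \<alpha> \<nu> * sig I $ \<alpha> $ \<beta> * sig_bar eps a sig s J \<beta> \<gamma> * lo \<gamma> \<nu>)
      = - h (flip s) * (\<Sum>\<alpha>\<in>UNIV. \<Sum>\<gamma>\<in>UNIV. D \<alpha> \<gamma> *
          (\<Sum>\<beta>\<in>UNIV. sig I $ \<alpha> $ \<beta> * (\<Sum>\<xi>\<in>UNIV. eps_up_dot eps \<beta> \<xi> * C \<gamma> \<xi>)))"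
    proof -
      define E where "E \<beta> \<gamma> = (\<Sum>\<xi>\<in>UNIV. eps_up_dot eps \<beta> \<xi> * C \<gamma> \<xi>)" for \<beta> \<gamma>
      show ?thesis
        unfolding bar E_def[symmetric] D_def by (simp add: sum_2 algebra_simps)
    qed
    also have "(\<Sum>\<alpha>\<in>UNIV. \<Sum>\<gamma>\<in>UNIV. D \<alpha> \<gamma> *
          (\<Sum>\<beta>\<in>UNIV. sig I $ \<alpha> $ \<beta> * (\<Sum>\<xi>\<in>UNIV. eps_up_dot eps \<beta> \<xi> * C \<gamma> \<xi>)))
      = (\<Sum>\<alpha>\<in>UNIV. \<Sum>\<kappa>\<in>UNIV. pauli_map sig $ (\<alpha>, \<kappa>) $ I * (\<Sum>\<gamma>\<in>UNIV. \<Sum>\<xi>\<in>UNIV. D \<alpha> \<gamma> * D \<kappa> \<xi> * C \<gamma> \<xi>))"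
      unfolding dot by (simp add: sum_2 algebra_simps)
    also have "\<dots> = (\<Sum>\<alpha>\<in>UNIV. \<Sum>\<kappa>\<in>UNIV. pauli_map sig $ (\<alpha>, \<kappa>) $ I *
        (\<Sum>y\<in>UNIV. cup s $ (\<alpha>, \<kappa>) $ y * pauli_map sig $ y $ J))"
    proof -
      have "(\<Sum>\<gamma>\<in>UNIV. \<Sum>\<xi>\<in>UNIV. D \<alpha> \<gamma> * D \<kappa> \<xi> * C \<gamma> \<xi>)
        = (\<Sum>y\<in>UNIV. cup s $ (\<alpha>, \<kappa>) $ y * pauli_map sig $ y $ J)" for \<alpha> \<kappa>
      proof -
        have C: "C \<gamma> \<xi> = (\<Sum>y\<in>UNIV. pauli_map sig $ y $ J * cup s $ y $ (\<gamma>, \<xi>))" for \<gamma> \<xi>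
          by (simp add: C_def matrix_matrix_mult_def transpose_def)
        have "(\<Sum>\<gamma>\<in>UNIV. \<Sum>\<xi>\<in>UNIV. D \<alpha> \<gamma> * D \<kappa> \<xi> * C \<gamma> \<xi>)
          = (\<Sum>\<gamma>\<in>UNIV. \<Sum>\<xi>\<in>UNIV. \<Sum>y\<in>UNIV. pauli_map sig $ y $ J * (D \<alpha> \<gamma> * D \<kappa> \<xi> * cup s $ y $ (\<gamma>, \<xi>)))"
          by (simp only: C sum_distrib_left ac_simps)
        also have "\<dots> = (\<Sum>\<gamma>\<in>UNIV. \<Sum>y\<in>UNIV. \<Sum>\<xi>\<in>UNIV. pauli_map sig $ y $ J * (D \<alpha> \<gamma> * D \<kappa> \<xi> * cup s $ y $ (\<gamma>, \<xi>)))"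
          by (rule sum.cong[OF refl], rule sum.swap)
        also have "\<dots> = (\<Sum>y\<in>UNIV. \<Sum>\<gamma>\<in>UNIV. \<Sum>\<xi>\<in>UNIV. pauli_map sig $ y $ J * (D \<alpha> \<gamma> * D \<kappa> \<xi> * cup s $ y $ (\<gamma>, \<xi>)))"
          by (rule sum.swap)
        also have "\<dots> = (\<Sum>y\<in>UNIV. pauli_map sig $ y $ J * cup s $ (\<alpha>, \<kappa>) $ y)"
        proof (rule sum.cong[OF refl])
          fix y :: "2 \<times> 2"
          show "(\<Sum>\<gamma>\<in>UNIV. \<Sum>\<xi>\<in>UNIV. pauli_map sig $ y $ J * (D \<alpha> \<gamma> * D \<kappa> \<xi> * cup s $ y $ (\<gamma>, \<xi>)))
            = pauli_map sig $ y $ J * cup s $ (\<alpha>, \<kappa>) $ y"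
            using cup_rotate[of \<alpha> \<kappa> s "fst y" "snd y"]
            by (simp only: D_def sum_distrib_left[symmetric] prod.collapse)
        qed
        finally show ?thesis by (simp only: mult.commute)
      qed
      then show ?thesis by simp
    qed
    also have "\<dots> = (transpose (pauli_map sig) ** cup s ** pauli_map sig) $ I $ J"
      unfolding matrix_mul_assoc[symmetric]
      by (simp add: matrix_matrix_mult_def transpose_def sum_UNIV_prod)
    finally show ?thesis .
  qed
  then show ?thesis
    by (simp add: vec_eq_iff metric_up_def mat_mult_entry)
qed

lemma metric_lo_eq:
  assumes "P ** pauli_map sig = mat 1" "pauli_map sig ** P = mat 1"
  shows "metric_lo eps a sig s = mat (- Q_of a * h s) ** (P ** cap s ** transpose P)"
  unfolding metric_lo_def
proof (rule matrix_inv_eqI)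
  let ?U = "pauli_map sig" and ?c = "- h (flip s) / Q_of a" and ?d = "- Q_of a * h s"
  have T: "transpose ?U ** transpose P = mat 1"
    by (simp add: assms transpose_mat flip: matrix_transpose_mul)
  have "transpose ?U ** cup s ** ?U ** (P ** cap s ** transpose P)
    = transpose ?U ** (cup s ** ((?U ** P) ** cap s)) ** transpose P"
    by (simp only: matrix_mul_assoc)
  also have "\<dots> = mat 1"
    by (simp add: assms cup_cap T)
  finally have *: "transpose ?U ** cup s ** ?U ** (P ** cap s ** transpose P) = mat 1" .
  have "metric_up eps a sig s ** (mat ?d ** (P ** cap s ** transpose P))
    = mat ?c ** (((transpose ?U ** cup s ** ?U) ** mat ?d) ** (P ** cap s ** transpose P))"
    by (simp only: metric_up_eq matrix_mul_assoc)
  also have "\<dots> = mat ?c ** (mat ?d ** mat 1)"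
    by (simp only: mat_mult_commute[of ?d "transpose ?U ** cup s ** ?U", symmetric]
        matrix_mul_assoc[symmetric, of "mat ?d"] *)
  also have "\<dots> = mat 1"
    using h_flip[of s] Q_nonzero
    by (simp add: vec_eq_iff mat_mult_entry) (simp add: mat_def mult.commute)
  finally show "metric_up eps a sig s ** (mat ?d ** (P ** cap s ** transpose P)) = mat 1" .
qed

lemma pauli_inv_eq: "pauli_inv sig t = mat (- h (flip t) / Q_of a) ** (metric_lo eps a sig t ** (transpose (pauli_map sig) ** cup t))"
proof -
  have "pauli_inv sig t $ L $ x
    = (mat (- h (flip t) / Q_of a) ** (metric_lo eps a sig t ** (transpose (pauli_map sig) ** cup t))) $ L $ x" for L x
  proof -
    have "sig_bar_mixed eps a sig t L (snd x) (fst x) = (\<Sum>J\<in>UNIV. metric_lo eps a sig t $ L $ J *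
      (\<Sum>\<delta>\<in>UNIV. eps_lo_dot eps (snd x) \<delta> * sig_bar eps a sig t J \<delta> (fst x)))"
      unfolding sig_bar_mixed_def sig_bar_lo_def sum_distrib_left
      by (subst sum.swap) (simp only: ac_simps)
    also have "\<dots> = - h (flip t) * (metric_lo eps a sig t ** (transpose (pauli_map sig) ** cup t)) $ L $ x"
      unfolding sig_bar_lowered prod.collapse
      by (simp add: matrix_matrix_mult_def[of "metric_lo eps a sig t"] sum_distrib_left ac_simps)
    finally show ?thesis by (simp add: pauli_inv_def mat_mult_entry)
  qed
  then show ?thesis by (simp add: vec_eq_iff)
qed

text \<open>A two-sided inverse \<open>P\<close> of \<open>pauli_map\<close> exists and determines the lower metric; inserting this into
  the definition of the barred matrices leaves \<open>P\<close> alone. In particular \<open>pauli_inv\<close> is the same for both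
  signs \<open>t\<close>.\<close>
lemma pauli_inv_map:
  assumes "pauli_matrices sig"
  shows "pauli_inv sig t ** pauli_map sig = mat 1" "pauli_map sig ** pauli_inv sig t = mat 1"
proof -
  obtain P where P: "P ** pauli_map sig = mat 1" "pauli_map sig ** P = mat 1"
    using pauli_map_inverse[OF assms] by blast
  have "pauli_inv sig t = mat (- h (flip t) / Q_of a) ** (mat (- Q_of a * h t) ** (P ** (cap t ** ((transpose P ** transpose (pauli_map sig)) ** cup t))))"
    by (simp only: pauli_inv_eq metric_lo_eq[OF P] matrix_mul_assoc)
  also have "transpose P ** transpose (pauli_map sig) = mat 1"
    by (simp add: P transpose_mat flip: matrix_transpose_mul)
  also have "cap t ** (mat 1 ** cup t) = mat 1" by (simp add: cap_cup)
  finally have "pauli_inv sig t = P"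
    using h_flip[of t] Q_nonzero
    by (simp add: vec_eq_iff mat_mult_entry mult.commute)
  then show "pauli_inv sig t ** pauli_map sig = mat 1" "pauli_map sig ** pauli_inv sig t = mat 1"
    using P by simp_all
qed

end

section \<open>Reality\<close>

context spinor_metric
begin

text \<open>Hermiticity of the Pauli matrices in mixed index position. The sign here and the one in
  \<open>pauli_inv_reality\<close> cancel in \<open>F_star\<close>.\<close>
lemma pauli_map_reality:
  assumes "pauli_matrices sig"
  shows "(\<Sum>y\<in>UNIV. (lo (snd y) (fst n) * lo (fst y) (snd n)) * cnj (pauli_map sig $ y $ K)) = - pauli_map sig $ n $ K"
proof -
  obtain \<nu> \<nu>' where n: "n = (\<nu>, \<nu>')" by fastforce
  have cnj: "cnj (pauli_map sig $ (\<gamma>, \<beta>) $ K) = (\<Sum>\<mu>\<in>UNIV. up \<mu> \<beta> * sig K $ \<mu> $ \<gamma>)" for \<gamma> \<beta>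
    using assms by (simp add: pauli_map_def sig_mixed_def eps_up_dot_def pauli_matrices_def)
  have "(\<Sum>y\<in>UNIV. (lo (snd y) (fst n) * lo (fst y) (snd n)) * cnj (pauli_map sig $ y $ K))
    = (\<Sum>\<mu>\<in>UNIV. (\<Sum>\<beta>\<in>UNIV. up \<mu> \<beta> * lo \<beta> \<nu>) * (\<Sum>\<gamma>\<in>UNIV. lo \<gamma> \<nu>' * sig K $ \<mu> $ \<gamma>))"
    unfolding sum_UNIV_prod n fst_conv snd_conv cnj by (simp add: sum_2 algebra_simps)
  also have "\<dots> = - pauli_map sig $ n $ K"
    unfolding up_lo delta_sum by (simp add: n pauli_map_def sig_mixed_def eps_up_dot_eq sum_negf)
  finally show ?thesis .
qed

lemma pauli_inv_reality:
  assumes "pauli_matrices sig"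
  shows "(\<Sum>x\<in>UNIV. cnj (pauli_inv sig t $ L $ x) * (up (fst m) (snd x) * up (snd m) (fst x))) = - pauli_inv sig t $ L $ m"
proof -
  define T Ti :: "complex^(2 \<times> 2)^(2 \<times> 2)"
    where "T = (\<chi> n y. lo (snd y) (fst n) * lo (fst y) (snd n))"
      and "Ti = (\<chi> x m. up (fst m) (snd x) * up (snd m) (fst x))"
  define cl where "cl = (\<chi> L x. cnj (pauli_inv sig t $ L $ x))"
  define cu where "cu = (\<chi> y K. cnj (pauli_map sig $ y $ K))"
  have "(T ** Ti) $ n $ m = mat 1 $ n $ m" for n m
  proof -
    have "(T ** Ti) $ n $ m = (\<Sum>\<alpha>\<in>UNIV. up (fst m) \<alpha> * lo \<alpha> (fst n)) * (\<Sum>\<alpha>\<in>UNIV. up (snd m) \<alpha> * lo \<alpha> (snd n))"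
      unfolding T_def Ti_def matrix_matrix_mult_def sum_UNIV_prod by (simp add: sum_2 algebra_simps)
    also have "\<dots> = mat 1 $ n $ m"
      by (auto simp: up_lo mat_def prod_eq_iff)
    finally show ?thesis .
  qed
  then have "T ** Ti = mat 1" by (simp add: vec_eq_iff)
  then have TiT: "Ti ** T = mat 1" using matrix_left_right_inverse by blast
  have U: "T ** cu = - pauli_map sig"
    using pauli_map_reality[OF assms] by (simp add: vec_eq_iff T_def cu_def matrix_matrix_mult_def)
  have "(cl ** cu) $ L $ K = cnj ((pauli_inv sig t ** pauli_map sig) $ L $ K)" for L K
    by (simp add: cl_def cu_def matrix_matrix_mult_def)
  then have "cl ** cu = mat 1"
    by (simp add: vec_eq_iff pauli_inv_map[OF assms] mat_def)
  have neg: "A ** (- B) = - (A ** B)" "(- A) ** B = - (A ** B)"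
    for A :: "complex^'n^'m" and B :: "complex^'k^'n"
    by (simp_all add: vec_eq_iff matrix_matrix_mult_def sum_negf)
  have "cl ** Ti = cl ** Ti ** (pauli_map sig ** pauli_inv sig t)"
    by (simp add: pauli_inv_map[OF assms])
  also have "\<dots> = - (cl ** (Ti ** T) ** cu ** pauli_inv sig t)"
  proof -
    have "pauli_map sig = - (T ** cu)" using U by simp
    then show ?thesis by (simp add: neg matrix_mul_assoc)
  qed
  also have "\<dots> = - pauli_inv sig t"
    by (simp add: TiT \<open>cl ** cu = mat 1\<close>)
  finally have "(cl ** Ti) $ L $ m = - pauli_inv sig t $ L $ m" by simp
  then show ?thesis by (simp add: cl_def Ti_def matrix_matrix_mult_def)
qed

end

context bicovariant_functionals
begin

lemma f_star_antipode:
  "cnj (f s \<alpha> \<beta> (star x)) = (\<Sum>\<mu>\<in>UNIV. \<Sum>\<nu>\<in>UNIV. up \<mu> \<alpha> * lo \<beta> \<nu> * f (flip s) \<mu> \<nu> (S x))"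
proof -
  have ft: "ft r \<sigma> \<tau> b = (\<Sum>\<mu>\<in>UNIV. \<Sum>\<nu>\<in>UNIV. up \<mu> \<tau> * lo \<sigma> \<nu> * f r \<mu> \<nu> b)" for r \<sigma> \<tau> b
  proof -
    have "(\<Sum>\<mu>\<in>UNIV. \<Sum>\<nu>\<in>UNIV. up \<mu> \<tau> * lo \<sigma> \<nu> * f r \<mu> \<nu> b)
      = (\<Sum>\<delta>\<in>UNIV. (\<Sum>\<nu>\<in>UNIV. lo \<sigma> \<nu> * up \<nu> \<delta>) * (\<Sum>\<gamma>\<in>UNIV. (\<Sum>\<mu>\<in>UNIV. lo \<gamma> \<mu> * up \<mu> \<tau>) * ft r \<delta> \<gamma> b))"
      unfolding f_ft_eps by (simp add: sum_2 algebra_simps)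
    then show ?thesis by (simp only: lo_up delta_sum)
  qed
  show ?thesis
    using f_star[of s \<alpha> \<beta> "star x"] by (simp add: star_star fd_ft ft)
qed

definition spinor_rep_inv :: "pm \<Rightarrow> 2 \<times> 2 \<Rightarrow> 2 \<times> 2 \<Rightarrow> 'a \<Rightarrow> complex"
  where "spinor_rep_inv s m n = conv cop (f s (fst m) (fst n) \<circ> S) (f (flip s) (snd m) (snd n) \<circ> S)"

text \<open>Conjugation exchanges the two signs and replaces each functional by its composition with the
  antipode, up to a base change by spinor metrics; the first factor of the convolution then carries
  the sign \<open>s\<close>, so this is the convolution inverse of \<open>spinor_rep s\<close> up to base change.\<close>
lemma spinor_rep_star:
  "cnj (spinor_rep s x y (star b)) = base_change
    (\<lambda>x m. up (fst m) (snd x) * up (snd m) (fst x)) (\<lambda>n y. lo (snd y) (fst n) * lo (fst y) (snd n))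
    (\<lambda>m n. spinor_rep_inv s m n b) x y"
proof -
  have "cnj (spinor_rep s x y (star b)) = conv cop
      (\<lambda>b. \<Sum>\<mu>\<in>UNIV. \<Sum>\<nu>\<in>UNIV. up \<mu> (snd x) * lo (snd y) \<nu> * (f s \<mu> \<nu> \<circ> S) b)
      (\<lambda>b. \<Sum>\<mu>\<in>UNIV. \<Sum>\<nu>\<in>UNIV. up \<mu> (fst x) * lo (fst y) \<nu> * (f (flip s) \<mu> \<nu> \<circ> S) b) b"
    by (simp add: spinor_rep_def conv_tensor_def conv_star[OF f_linear f_linear] f_star_antipode o_def)
  also have "\<dots> = (\<Sum>\<mu>\<in>UNIV. \<Sum>\<nu>\<in>UNIV. \<Sum>\<mu>'\<in>UNIV. \<Sum>\<nu>'\<in>UNIV.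
      up \<mu> (snd x) * lo (snd y) \<nu> * (up \<mu>' (fst x) * lo (fst y) \<nu>' * spinor_rep_inv s (\<mu>, \<mu>') (\<nu>, \<nu>') b))"
    by (simp only: conv_sum_left conv_sum_right conv_scale_left conv_scale_right spinor_rep_inv_def
        fst_conv snd_conv sum_distrib_left)
  also have "\<dots> = base_change
    (\<lambda>x m. up (fst m) (snd x) * up (snd m) (fst x)) (\<lambda>n y. lo (snd y) (fst n) * lo (fst y) (snd n))
    (\<lambda>m n. spinor_rep_inv s m n b) x y"
    unfolding base_change_def sum_UNIV_prod scaleC_complex fst_conv snd_conv
    by (simp add: sum_2 algebra_simps)
  finally show ?thesis .
qed

end

section \<open>The vector representation\<close>

locale Lorentz_functionals = bicovariant_functionals cop counit S eps a M Md f ft fd ftd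
  for cop :: "'a::complex_star_algebra_1 \<Rightarrow> 'a \<otimes> 'a"
    and counit :: "'a \<Rightarrow> complex" and S :: "'a \<Rightarrow> 'a"
    and eps :: "complex^2^2" and a :: real and M Md :: "2 \<Rightarrow> 2 \<Rightarrow> 'a"
    and f ft fd ftd :: "pm \<Rightarrow> 2 \<Rightarrow> 2 \<Rightarrow> 'a \<Rightarrow> complex" +
  fixes sig :: "4 \<Rightarrow> complex^2^2" and t :: pm
  assumes pauli: "pauli_matrices sig"
begin

abbreviation "P L x \<equiv> pauli_inv sig t $ L $ x"
abbreviation "P' y K \<equiv> pauli_map sig $ y $ K"

lemma P_inverse: "mutually_inverse P P'"
proof -
  have "(\<Sum>x\<in>UNIV. P L x * P' x K) = (pauli_inv sig t ** pauli_map sig) $ L $ K"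
    "(\<Sum>L\<in>UNIV. P' x L * P L y) = (pauli_map sig ** pauli_inv sig t) $ x $ y" for L K x y
    by (simp_all add: matrix_matrix_mult_def)
  then show ?thesis
    by (simp add: mutually_inverse_def pauli_inv_map[OF pauli] mat_def of_bool_def)
qed

definition F :: "pm \<Rightarrow> 4 \<Rightarrow> 4 \<Rightarrow> 'a \<Rightarrow> complex"
  where "F s = functional_base_change P P' (spinor_rep s)"

lemma Lorentz_eq: "Lorentz eps a sig t S M Md = base_change P P' spinor_corep"
proof (intro ext)
  fix L K
  define sb where "sb = sig_bar_mixed eps a sig t L"
  define sm where "sm = sig_mixed eps sig K"
  show "Lorentz eps a sig t S M Md L K = base_change P P' spinor_corep L K"
    unfolding Lorentz_def base_change_def spinor_corep_def corep_tensor_def sum_UNIV_prod pauli_inv_def pauli_map_def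
      sb_def[symmetric] sm_def[symmetric] N_def[symmetric]
    by (simp add: sum_2 scaleC_add_right ac_simps flip: sb_def sm_def)
qed

lemma F_formula: "F s L K b = 1 / Q_of a *
      (\<Sum>\<alpha>\<in>UNIV. \<Sum>\<beta>\<in>UNIV. \<Sum>\<gamma>\<in>UNIV. \<Sum>\<delta>\<in>UNIV.
        sig_bar_mixed eps a sig t L \<alpha> \<delta> * sig_mixed eps sig K \<gamma> \<beta> *
          conv cop (ftd (flip s) \<beta> \<alpha>) (f s \<delta> \<gamma>) b)"
  unfolding F_def base_change_def spinor_rep_def conv_tensor_def sum_UNIV_prod pauli_inv_def pauli_map_def ftd_f
  by (simp add: sum_2 scaleC_complex algebra_simps)

lemma F_hom: "matrix_hom (F s)"
  unfolding F_def by (rule matrix_hom_base_change[OF P_inverse spinor_rep_hom])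

text \<open>The conjugates of \<open>F\<close> form a right convolution inverse of \<open>F\<close>, and so does \<open>F \<circ> S\<close>; inverses
  are unique.\<close>
lemma F_star: "cnj (F s L K b) = F s L K (S (star b))"
proof -
  define H where "H = functional_base_change P P' (spinor_rep_inv s)"
  have star: "cnj (F s L K (star c)) = H L K c" for L K c
  proof -
    have "cnj (F s L K (star c)) = base_change (\<lambda>L x. cnj (P L x)) (\<lambda>y K. cnj (P' y K))
      (\<lambda>x y. cnj (spinor_rep s x y (star c))) L K"
      by (simp add: F_def base_change_def scaleC_complex)
    also have "\<dots> = base_change (\<lambda>L m. - P L m) (\<lambda>n K. - P' n K) (\<lambda>m n. spinor_rep_inv s m n c) L K"
      unfolding spinor_rep_star[abs_def] base_change_comp pauli_map_reality[OF pauli] pauli_inv_reality[OF pauli] ..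
    also have "\<dots> = H L K c"
      by (simp add: H_def base_change_def)
    finally show ?thesis .
  qed
  have fS: "clinear (f r \<mu> \<nu> \<circ> S)" for r \<mu> \<nu>
    using clinear_comp[OF S_linear f_linear] by (simp add: o_def)
  have "H L K b = F s L K (S b)" for L K b
  proof (rule matrix_hom_antipode_unique[OF F_hom])
    show "clinear (H i j)" for i j
      unfolding H_def base_change_def spinor_rep_inv_def
      by (intro clinear_fun_sum clinear_fun_scaleC conv_linear fS)
    show "(\<Sum>k\<in>UNIV. conv cop (F s i k) (H k j) b) = of_bool (i = j) * counit b" for i j b
    proof -
      have "(\<Sum>k\<in>UNIV. conv cop (F s i k) (H k j) b)
        = base_change P P' (\<lambda>x y. of_bool (x = y) *\<^sub>C counit b) i j"
        unfolding F_def H_def conv_base_change[OF P_inverse] spinor_rep_def spinor_rep_inv_def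
          conv_tensor_antipode[OF f_hom f_hom] scaleC_complex ..
      also have "\<dots> = of_bool (i = j) * counit b"
        using base_change_delta[OF P_inverse, of "counit b" i j] by (simp add: scaleC_complex)
      finally show ?thesis .
    qed
  qed
  with star[of L K "star b"] show ?thesis by (simp add: star_star)
qed

lemma R_Lorentz_eq:
  "R_Lorentz (F s) (base_change P P' spinor_corep) = kron (transpose (pauli_map sig)) (transpose (pauli_map sig)) ** spinor_R s
    ** kron (transpose (pauli_inv sig t)) (transpose (pauli_inv sig t))"
proof -
  have "F s K M (base_change P P' spinor_corep L N) = (\<Sum>x\<in>UNIV. \<Sum>w\<in>UNIV. \<Sum>v\<in>UNIV. \<Sum>y\<in>UNIV.
      P' v N * P' y M * spinor_R s $ (v, y) $ (x, w) * (P K x * P L w))" for K M L N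
  proof -
    have "F s K M (base_change P P' spinor_corep L N) = (\<Sum>w\<in>UNIV. \<Sum>v\<in>UNIV. \<Sum>x\<in>UNIV. \<Sum>y\<in>UNIV.
        P' v N * P' y M * spinor_R s $ (v, y) $ (x, w) * (P K x * P L w))"
      unfolding clinear_base_change[OF matrix_homD(1)[OF F_hom]]
      by (simp add: base_change_def F_def spinor_rep_corep scaleC_complex sum_distrib_left ac_simps)
    also have "\<dots> = (\<Sum>w\<in>UNIV. \<Sum>x\<in>UNIV. \<Sum>v\<in>UNIV. \<Sum>y\<in>UNIV.
        P' v N * P' y M * spinor_R s $ (v, y) $ (x, w) * (P K x * P L w))"
      by (rule sum.cong[OF refl], rule sum.swap)
    also have "\<dots> = (\<Sum>x\<in>UNIV. \<Sum>w\<in>UNIV. \<Sum>v\<in>UNIV. \<Sum>y\<in>UNIV.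
        P' v N * P' y M * spinor_R s $ (v, y) $ (x, w) * (P K x * P L w))"
      by (rule sum.swap)
    finally show ?thesis .
  qed
  moreover have "(kron (transpose (pauli_map sig)) (transpose (pauli_map sig)) ** spinor_R s
      ** kron (transpose (pauli_inv sig t)) (transpose (pauli_inv sig t))) $ (N, M) $ (K, L)
    = (\<Sum>x\<in>UNIV. \<Sum>w\<in>UNIV. \<Sum>v\<in>UNIV. \<Sum>y\<in>UNIV.
      P' v N * P' y M * spinor_R s $ (v, y) $ (x, w) * (P K x * P L w))" for K M L N
  proof -
    have "(kron (transpose (pauli_map sig)) (transpose (pauli_map sig)) ** spinor_R s
      ** kron (transpose (pauli_inv sig t)) (transpose (pauli_inv sig t))) $ (N, M) $ (K, L)
      = (\<Sum>q\<in>UNIV. (\<Sum>r\<in>UNIV. (P' (fst r) N * P' (snd r) M) * spinor_R s $ r $ q)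
          * (P K (fst q) * P L (snd q)))"
      by (simp only: matrix_matrix_mult_def kron_def transpose_def vec_lambda_beta fst_conv snd_conv)
    then show ?thesis
      by (simp only: sum_UNIV_prod[where 'i = "2 \<times> 2" and 'j = "2 \<times> 2"] fst_conv snd_conv
          sum_distrib_right)
  qed
  ultimately show ?thesis
    by (simp add: R_Lorentz_def vec_eq_iff split_paired_all)
qed

lemma intertwiner_inverse:
  "kron (transpose (pauli_map sig)) (transpose (pauli_map sig)) ** kron (transpose (pauli_inv sig t)) (transpose (pauli_inv sig t)) = mat 1"
  "kron (transpose (pauli_inv sig t)) (transpose (pauli_inv sig t)) ** kron (transpose (pauli_map sig)) (transpose (pauli_map sig)) = mat 1"
  by (simp_all add: kron_mult pauli_inv_map[OF pauli] transpose_mat kron_mat_1 flip: matrix_transpose_mul)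

lemma R_Lorentz_cubic:
  fixes s
  defines "R \<equiv> R_Lorentz (F s) (base_change P P' spinor_corep)"
  shows "(R + mat (p s ^ 2)) ** (R + mat (p (flip s) ^ 2)) ** (R - mat 1) = 0"
proof -
  define T where "T = kron (transpose (pauli_map sig)) (transpose (pauli_map sig)) ** middle (R_matrix s)"
  define T' where "T' = middle (R_matrix (flip s)) ** kron (transpose (pauli_inv sig t)) (transpose (pauli_inv sig t))"
  define Y where "Y = kron (R_matrix s) (R_matrix (flip s))"
  have R: "R = T ** Y ** T'"
    by (simp add: R_def R_Lorentz_eq T_def T'_def Y_def spinor_R_def matrix_mul_assoc)
  have "T ** T' = kron (transpose (pauli_map sig)) (transpose (pauli_map sig)) ** (middle (R_matrix s) ** middle (R_matrix (flip s)))
      ** kron (transpose (pauli_inv sig t)) (transpose (pauli_inv sig t))"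
    by (simp only: T_def T'_def matrix_mul_assoc)
  then have TT': "T ** T' = mat 1"
    by (simp add: middle_R_matrix_inverse intertwiner_inverse)
  have "T' ** T = middle (R_matrix (flip s)) ** (kron (transpose (pauli_inv sig t)) (transpose (pauli_inv sig t))
      ** kron (transpose (pauli_map sig)) (transpose (pauli_map sig))) ** middle (R_matrix s)"
    by (simp only: T_def T'_def matrix_mul_assoc)
  then have T'T: "T' ** T = mat 1"
    by (simp add: middle_R_matrix_inverse intertwiner_inverse)
  have minus: "A - mat 1 = A + mat (- 1)" for A :: "complex^'n^'n"
    by (simp add: vec_eq_iff mat_def)
  have "(R + mat (p s ^ 2)) ** (R + mat (p (flip s) ^ 2)) ** (R - mat 1)
    = T ** ((Y + mat (p s ^ 2)) ** ((T' ** T) ** ((Y + mat (p (flip s) ^ 2)) ** ((T' ** T) ** (Y + mat (- 1)))))) ** T'"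
    by (simp only: R minus conjugate_add_mat[OF TT'] matrix_mul_assoc)
  also have "\<dots> = T ** ((Y + mat (p s ^ 2)) ** (Y + mat (p (flip s) ^ 2)) ** (Y - mat 1)) ** T'"
    by (simp only: T'T matrix_mul_lid minus matrix_mul_assoc)
  also have "\<dots> = 0"
    unfolding Y_def kron_R_matrix_cubic by (simp add: vec_eq_iff matrix_matrix_mult_def)
  finally show ?thesis .
qed

lemma R_Lorentz_metric_up:
  "(\<Sum>K\<in>UNIV. \<Sum>L\<in>UNIV. R_Lorentz (F s) (base_change P P' spinor_corep) $ (n, m) $ (K, L) * metric_up eps a sig s $ K $ L)
    = metric_up eps a sig s $ n $ m"
proof -
  let ?B = "kron (transpose (pauli_map sig)) (transpose (pauli_map sig))"
  let ?R = "R_Lorentz (F s) (base_change P P' spinor_corep)"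
  define c where "c = - h (flip s) / Q_of a"
  have G: "metric_up eps a sig s $ K $ L = c * (?B *v cup_vec s) $ (K, L)" for K L
    unfolding metric_up_eq c_def[symmetric] mat_mult_entry matrix_mul_assoc[symmetric]
    by (simp add: matrix_matrix_mult_def matrix_vector_mult_def sum_UNIV_prod[where 'i = "2 \<times> 2" and 'j = "2 \<times> 2"]
        kron_def cup_vec_def transpose_def sum_distrib_left ac_simps)
  have "?R *v (?B *v cup_vec s) = ?B *v (spinor_R s *v ((kron (transpose (pauli_inv sig t)) (transpose (pauli_inv sig t)) ** ?B) *v cup_vec s))"
    by (simp only: R_Lorentz_eq matrix_vector_mul_assoc matrix_mul_assoc)
  then have "?R *v (?B *v cup_vec s) = ?B *v cup_vec s"
    by (simp only: intertwiner_inverse matrix_vector_mul_lid spinor_R_cup)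
  then have "(?R *v (?B *v cup_vec s)) $ (n, m) = (?B *v cup_vec s) $ (n, m)" by simp
  then have "(\<Sum>K\<in>UNIV. \<Sum>L\<in>UNIV. ?R $ (n, m) $ (K, L) * (?B *v cup_vec s) $ (K, L)) = (?B *v cup_vec s) $ (n, m)"
    by (simp only: matrix_vector_mult_def[of ?R] vec_lambda_beta sum_UNIV_prod[where 'i = 4 and 'j = 4])
  then have "c * (\<Sum>K\<in>UNIV. \<Sum>L\<in>UNIV. ?R $ (n, m) $ (K, L) * (?B *v cup_vec s) $ (K, L)) = c * (?B *v cup_vec s) $ (n, m)"
    by simp
  then show ?thesis
    unfolding G sum_distrib_left by (simp only: ac_simps)
qed

lemma R_Lorentz_metric_lo:
  "(\<Sum>N\<in>UNIV. \<Sum>M\<in>UNIV. R_Lorentz (F s) (base_change P P' spinor_corep) $ (N, M) $ (K, L) * metric_lo eps a sig s $ N $ M)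
    = metric_lo eps a sig s $ K $ L"
proof -
  let ?A = "kron (pauli_inv sig t) (pauli_inv sig t)"
  let ?R = "R_Lorentz (F s) (base_change P P' spinor_corep)"
  define c where "c = - Q_of a * h s"
  have G: "metric_lo eps a sig s $ K $ L = c * (?A *v cap_vec s) $ (K, L)" for K L
    unfolding metric_lo_eq[OF pauli_inv_map[OF pauli, of t]] c_def[symmetric] mat_mult_entry matrix_mul_assoc[symmetric]
    by (simp add: matrix_matrix_mult_def matrix_vector_mult_def sum_UNIV_prod[where 'i = "2 \<times> 2" and 'j = "2 \<times> 2"]
        kron_def cap_vec_def transpose_def sum_distrib_left ac_simps)
  have transpose_entry: "(transpose A *v v) $ q = (\<Sum>r\<in>UNIV. A $ r $ q * v $ r)"
    for A :: "complex^(4 \<times> 4)^(4 \<times> 4)" and v q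
    by (simp only: matrix_vector_mult_def transpose_def vec_lambda_beta)
  have "transpose ?R *v (?A *v cap_vec s) = ?A *v (transpose (spinor_R s) *v
      (transpose (kron (transpose (pauli_inv sig t)) (transpose (pauli_inv sig t)) ** kron (transpose (pauli_map sig)) (transpose (pauli_map sig))) *v cap_vec s))"
    by (simp only: R_Lorentz_eq matrix_vector_mul_assoc matrix_mul_assoc matrix_transpose_mul transpose_kron
        transpose_transpose)
  then have "transpose ?R *v (?A *v cap_vec s) = ?A *v cap_vec s"
    by (simp only: intertwiner_inverse transpose_mat matrix_vector_mul_lid spinor_R_cap)
  then have "(transpose ?R *v (?A *v cap_vec s)) $ (K, L) = (?A *v cap_vec s) $ (K, L)" by simp
  then have "(\<Sum>N\<in>UNIV. \<Sum>M\<in>UNIV. ?R $ (N, M) $ (K, L) * (?A *v cap_vec s) $ (N, M)) = (?A *v cap_vec s) $ (K, L)"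
    by (simp only: transpose_entry sum_UNIV_prod[where 'i = 4 and 'j = 4])
  then have "c * (\<Sum>N\<in>UNIV. \<Sum>M\<in>UNIV. ?R $ (N, M) $ (K, L) * (?A *v cap_vec s) $ (N, M)) = c * (?A *v cap_vec s) $ (K, L)"
    by simp
  then show ?thesis
    unfolding G sum_distrib_left by (simp only: ac_simps)
qed

end

theorem mainTheorem4:
  fixes cop :: "'a::complex_star_algebra_1 \<Rightarrow> 'a \<otimes> 'a"
    and counit :: "'a \<Rightarrow> complex"
    and S :: "'a \<Rightarrow> 'a"
    and eps :: "complex^2^2"
    and a :: real
    and M Md :: "2 \<Rightarrow> 2 \<Rightarrow> 'a"
    and f ft fd ftd :: "pm \<Rightarrow> 2 \<Rightarrow> 2 \<Rightarrow> 'a \<Rightarrow> complex"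
    and sig :: "4 \<Rightarrow> complex^2^2"
    and t :: pm
    and \<Lambda> :: "4 \<Rightarrow> 4 \<Rightarrow> 'a"
    and G_up G_lo :: "pm \<Rightarrow> complex^4^4"
  assumes "bicovariant_functionals cop counit S eps a M Md f ft fd ftd"
    and "pauli_matrices sig"
  defines "\<Lambda> \<equiv> Lorentz eps a sig t S M Md"
    and "G_up \<equiv> metric_up eps a sig"
    and "G_lo \<equiv> metric_lo eps a sig"
  shows "\<exists>F :: pm \<Rightarrow> 4 \<Rightarrow> 4 \<Rightarrow> 'a \<Rightarrow> complex.
    (\<forall>s L K. clinear (F s L K)) \<and>
    (\<forall>s L K b. F s L K b = 1 / Q_of a *
      (\<Sum>\<alpha>\<in>UNIV. \<Sum>\<beta>\<in>UNIV. \<Sum>\<gamma>\<in>UNIV. \<Sum>\<delta>\<in>UNIV.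
        sig_bar_mixed eps a sig t L \<alpha> \<delta> * sig_mixed eps sig K \<gamma> \<beta> *
          conv cop (ftd (flip s) \<beta> \<alpha>) (f s \<delta> \<gamma>) b)) \<and>
    (\<forall>s.
      (\<forall>L K b. (\<Sum>I\<in>UNIV. \<Lambda> L I * conv_left cop (F s I K) b)
        = (\<Sum>I\<in>UNIV. conv_right cop b (F s L I) * \<Lambda> I K)) \<and>
      (\<forall>L K b. cnj (F s L K b) = F s L K (S (star b))) \<and>
      (\<forall>L K b c. F s L K (b * c) = (\<Sum>I\<in>UNIV. F s L I b * F s I K c)) \<and>
      (\<forall>L K b. F s L K (counit b *\<^sub>C 1) = of_bool (K = L) * counit b) \<and>
      (\<forall>L K b. (\<Sum>I\<in>UNIV. conv cop (F s L I) (F s I K \<circ> S) b)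
        = of_bool (K = L) * counit b) \<and>
      (\<forall>L K b. (\<Sum>I\<in>UNIV. conv cop (F s L I \<circ> S) (F s I K) b)
        = of_bool (K = L) * counit b) \<and>
      (let R = R_Lorentz (F s) \<Lambda> in
        (\<forall>N M. (\<Sum>K\<in>UNIV. \<Sum>L\<in>UNIV. R $ (N, M) $ (K, L) * G_up s $ K $ L)
          = G_up s $ N $ M) \<and>
        (\<forall>K L. (\<Sum>N\<in>UNIV. \<Sum>M\<in>UNIV. R $ (N, M) $ (K, L) * G_lo s $ N $ M)
          = G_lo s $ K $ L) \<and>
        leg12 R ** leg23 R ** leg12 R = leg23 R ** leg12 R ** leg23 R \<and>
        (R + mat (a_pow a s ^ 2)) ** (R + mat (a_pow a (flip s) ^ 2)) ** (R - mat 1) = 0))"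
proof -
  interpret Lorentz_functionals cop counit S eps a M Md f ft fd ftd sig t
    using assms(1,2) by (simp add: Lorentz_functionals_def Lorentz_functionals_axioms_def)
  have \<Lambda>: "\<Lambda> = base_change P P' spinor_corep"
    unfolding assms(3) by (rule Lorentz_eq)
  have corep: "corepresentation \<Lambda>"
    unfolding \<Lambda> by (rule corepresentation_base_change[OF P_inverse corep_spinor_corep])
  have bicov: "bicovariant \<Lambda> (F s)" for s
    unfolding \<Lambda> F_def by (rule bicovariant_base_change[OF P_inverse bicov_spinor_corep])
  note hom = matrix_homD[OF F_hom]
  show ?thesis
  proof (intro exI[of _ F] conjI allI)
    fix s
    show "clinear (F s L K)" for L K by (rule hom)
    show "F s L K b = 1 / Q_of a *
      (\<Sum>\<alpha>\<in>UNIV. \<Sum>\<beta>\<in>UNIV. \<Sum>\<gamma>\<in>UNIV. \<Sum>\<delta>\<in>UNIV.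
        sig_bar_mixed eps a sig t L \<alpha> \<delta> * sig_mixed eps sig K \<gamma> \<beta> *
          conv cop (ftd (flip s) \<beta> \<alpha>) (f s \<delta> \<gamma>) b)" for L K b
      by (rule F_formula)
    show "(\<Sum>I\<in>UNIV. \<Lambda> L I * conv_left cop (F s I K) b)
        = (\<Sum>I\<in>UNIV. conv_right cop b (F s L I) * \<Lambda> I K)" for L K b
      using bicov by (simp add: bicovariant_def)
    show "cnj (F s L K b) = F s L K (S (star b))" for L K b by (rule F_star)
    show "F s L K (b * c) = (\<Sum>I\<in>UNIV. F s L I b * F s I K c)" for L K b c by (rule hom)
    show "F s L K (counit b *\<^sub>C 1) = of_bool (K = L) * counit b" for L K b
      by (auto simp: clinear_scaleC[OF hom(1)] hom(3) scaleC_complex)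
    show "(\<Sum>I\<in>UNIV. conv cop (F s L I) (F s I K \<circ> S) b) = of_bool (K = L) * counit b" for L K b
      by (simp add: matrix_hom_antipode_right[OF F_hom] eq_commute)
    show "(\<Sum>I\<in>UNIV. conv cop (F s L I \<circ> S) (F s I K) b) = of_bool (K = L) * counit b" for L K b
      by (simp add: matrix_hom_antipode_left[OF F_hom] eq_commute)
    show "let R = R_Lorentz (F s) \<Lambda> in
        (\<forall>N M. (\<Sum>K\<in>UNIV. \<Sum>L\<in>UNIV. R $ (N, M) $ (K, L) * G_up s $ K $ L) = G_up s $ N $ M) \<and>
        (\<forall>K L. (\<Sum>N\<in>UNIV. \<Sum>M\<in>UNIV. R $ (N, M) $ (K, L) * G_lo s $ N $ M) = G_lo s $ K $ L) \<and>
        leg12 R ** leg23 R ** leg12 R = leg23 R ** leg12 R ** leg23 R \<and>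
        (R + mat (a_pow a s ^ 2)) ** (R + mat (a_pow a (flip s) ^ 2)) ** (R - mat 1) = 0"
      unfolding Let_def
    proof (intro conjI allI)
      show "leg12 (R_Lorentz (F s) \<Lambda>) ** leg23 (R_Lorentz (F s) \<Lambda>) ** leg12 (R_Lorentz (F s) \<Lambda>)
        = leg23 (R_Lorentz (F s) \<Lambda>) ** leg12 (R_Lorentz (F s) \<Lambda>) ** leg23 (R_Lorentz (F s) \<Lambda>)"
        by (rule R_Lorentz_braid[OF F_hom corep bicov])
    qed (simp_all only: \<Lambda> assms(4,5) R_Lorentz_metric_up R_Lorentz_metric_lo R_Lorentz_cubic)
  qed
qed

end
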